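(* For all sufficiently large integers $s$ and $q$ such that $q\ge \frac{100s^2}{\log s}$, the following holds for all sufficiently large $n$. Every extremal graph which maximizes the number of proper $q$-colorings over graphs with $n$ vertices and $\frac{s-1}{2s}n^2+o(n^2)$ edges is $o(n^2)$-close to the Turán graph $T_s(n)$.
   Context: Graphs are finite and simple; $\log$ is the natural logarithm. $T_s(n)$ denotes the complete $s$-partite graph on $n$ vertices with nearly equal parts (sizes differing by at most one). The edit distance of two graphs with the same number of vertices is the minimum number of edges that need to be added or deleted from one graph to make it isomorphic to the other. $G$ is $d$-close to $H$ if their edit distance is at most $d$. "Extremal" means: $G$ has the maximum number of proper $q$-colorings among all graphs with the same number of vertices and the same number of edges as $G$. Asymptotic notation is as $n\to\infty$ with $s,q$ fixed: the conclusion means that for every $\varepsilon>0$ there are $\eta>0$ and $n_0$ such that for every $n\ge n_0$, every extremal $n$-vertex graph whose number of edges differs from $\frac{s-1}{2s}n^2$ by at most $\eta n^2$ is $\varepsilon n^2$-close to $T_s(n)$. *)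

theory Defs
  imports Complex_Main "HOL-Library.Ramsey" "HOL-Library.FuncSet"
begin

type_synonym 'a sgraph = "'a set \<times> 'a set set"

abbreviation verts :: "'a sgraph \<Rightarrow> 'a set" where "verts \<equiv> fst"
abbreviation edges :: "'a sgraph \<Rightarrow> 'a set set" where "edges \<equiv> snd"

text \<open>\<^term>\<open>nsets V 2\<close> is the set of two-element subsets of \<^term>\<open>V\<close>.\<close>
definition sgraph :: "'a sgraph \<Rightarrow> bool" where
  "sgraph G \<longleftrightarrow> finite (verts G) \<and> edges G \<subseteq> nsets (verts G) 2"

definition sgraph_iso :: "'a sgraph \<Rightarrow> 'b sgraph \<Rightarrow> bool" where
  "sgraph_iso G H \<longleftrightarrow> (\<exists>f. bij_betw f (verts G) (verts H) \<and>
     (\<forall>u\<in>verts G. \<forall>v\<in>verts G. {u, v} \<in> edges G \<longleftrightarrow> {f u, f v} \<in> edges H))"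

text \<open>Editing \<^term>\<open>G\<close> yields a graph \<open>(verts G, F)\<close>, at the cost of one per edge in the symmetric
  difference of \<^term>\<open>edges G\<close> and \<open>F\<close>. The value is meaningful only for graphs with equally many
  vertices.\<close>
definition edit_distance :: "'a sgraph \<Rightarrow> 'b sgraph \<Rightarrow> nat" where
  "edit_distance G H = (LEAST k. \<exists>F. sgraph (verts G, F) \<and> sgraph_iso (verts G, F) H \<and>
     k = card ((edges G - F) \<union> (F - edges G)))"

definition close_to :: "real \<Rightarrow> 'a sgraph \<Rightarrow> 'b sgraph \<Rightarrow> bool" where
  "close_to d G H \<longleftrightarrow> card (verts G) = card (verts H) \<and> real (edit_distance G H) \<le> d"

text \<open>The parts of the \<open>s\<close>-partite Turan graph are the residue classes modulo \<open>s\<close>; the lemma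
  below shows that they are balanced.\<close>
definition turan_graph :: "nat \<Rightarrow> nat \<Rightarrow> nat sgraph" where
  "turan_graph s n = ({..<n}, {{i, j} | i j. i < n \<and> j < n \<and> i mod s \<noteq> j mod s})"

lemma turan_part_card:
  assumes "r < s"
  shows "card {i. i < n \<and> i mod s = r} \<in> {n div s, n div s + 1}"
proof -
  define m where "m = n div s"
  have *: "m * s \<le> n" "n < (m + 1) * s"
    using assms by (auto simp: m_def dividend_less_div_times)
  have inj: "inj_on (\<lambda>k. k * s + r) A" for A
    using assms by (auto simp: inj_on_def)
  have "(\<lambda>k. k * s + r) ` {..<m} \<subseteq> {i. i < n \<and> i mod s = r}"
  proof clarsimp
    fix k assume "k < m"
    then have "(k + 1) * s \<le> m * s" by (intro mult_right_mono) auto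
    with * assms show "k * s + r < n \<and> r mod s = r" by auto
  qed
  from card_mono[OF _ this] have 1: "m \<le> card {i. i < n \<and> i mod s = r}"
    using card_image[OF inj] by simp
  have "{i. i < n \<and> i mod s = r} \<subseteq> (\<lambda>k. k * s + r) ` {..m}"
  proof
    fix i assume i: "i \<in> {i. i < n \<and> i mod s = r}"
    then have "i = i div s * s + r" by (metis (mono_tags) div_mult_mod_eq mem_Collect_eq)
    moreover have "i div s \<le> m" using i by (auto simp: m_def intro: div_le_mono)
    ultimately show "i \<in> (\<lambda>k. k * s + r) ` {..m}" by blast
  qed
  from card_mono[OF _ this] have "card {i. i < n \<and> i mod s = r} \<le> m + 1"
    using card_image[OF inj] by simp
  with 1 show ?thesis by (auto simp: m_def)
qed

text \<open>Extensional functions are used so that each coloring of the vertices is counted once.\<close>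
definition proper_colorings :: "nat \<Rightarrow> 'a sgraph \<Rightarrow> ('a \<Rightarrow> nat) set" where
  "proper_colorings q G =
     {c \<in> verts G \<rightarrow>\<^sub>E {..<q}. \<forall>u v. {u, v} \<in> edges G \<longrightarrow> c u \<noteq> c v}"

text \<open>Every finite graph is isomorphic to one whose vertices are natural numbers, so nothing is lost
  by comparing such graphs only.\<close>
definition extremal :: "nat \<Rightarrow> nat sgraph \<Rightarrow> bool" where
  "extremal q G \<longleftrightarrow> sgraph G \<and>
     (\<forall>H :: nat sgraph. sgraph H \<and> card (verts H) = card (verts G) \<and> card (edges H) = card (edges G)
        \<longrightarrow> card (proper_colorings q H) \<le> card (proper_colorings q G))"

end

theory Submission
  imports Defs "HOL-Analysis.Analysis" "HOL-Real_Asymp.Real_Asymp"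
begin

text \<open>
  Why the theorem is true. Give every vertex of a graph a list of colors so that most edges join
  vertices with disjoint lists. Choosing each color from its list gives colorings, and up to a
  factor \<open>exp (o(n))\<close> all proper colorings of a graph arise from one such assignment. What remains is
  a question about the distribution \<open>\<alpha>\<close> of the list of a random vertex, which is a probability
  distribution on nonempty sets of colors: \<open>log_size\<close>, the mean of \<open>ln (card A)\<close>, is the exponential
  growth rate of the number of colorings, and \<open>clash\<close>, the probability that two independent random
  sets meet, is \<open>1\<close> minus the edge density of the graph of all pairs with disjoint lists. An edge
  count near \<open>(s - 1) / (2 * s) * n\<^sup>2\<close> means a clash of about \<open>1 / s\<close>, and the Turan graph with \<open>s\<close> balanced sets of colors has the rate \<open>turan_value\<close>.

  The assignment of lists comes from containers: an independent set lies in a set that spans few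
  edges and that is determined by a bounded number of its vertices, and one such set is used for
  each color (\<open>coloring_lists\<close>). That an extremal graph has a rate of at least
  \<open>turan_value - o(1)\<close> is seen from a graph with at least as many edges as needed, obtained from the
  Turan graph by adding few edges inside one part (\<open>comparison_graph\<close>).

  The main point is that, for the \<open>s\<close> and \<open>q\<close> in question, a distribution with clash at most \<open>1 / s\<close> and \<open>log_size\<close> at least
  \<open>turan_value\<close> is uniform on \<open>s\<close> disjoint sets (\<open>uniform_partition_if_value\<close>). Put \<open>M = q / s\<close>. By
  \<open>card (A \<inter> B) \<le> sqrt (card A * card B)\<close> and the Cauchy-Schwarz inequality the mean of
  \<open>sqrt (card A)\<close> is at most \<open>sqrt M\<close>, so that \<open>log_size \<le> ln M\<close>. This settles the case that \<open>s\<close>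
  divides \<open>q\<close>; in general \<open>turan_value\<close> falls short of \<open>ln M\<close> by an amount of order \<open>1 / M\<^sup>2\<close>, which
  leaves only the conclusion that most sets have a size near \<open>M\<close>. To make up for the rounding take
  an optimal \<open>\<alpha>\<close>. By Lagrange multipliers the probability \<open>meet A\<close> that a random set meets \<open>A\<close> is an
  affine function of \<open>ln (card A)\<close> on the support. A greedy choice gives pairwise disjoint sets of the
  support that every set of the support meets. If there are at most \<open>s\<close> of them, equality holds in
  a convexity estimate, and \<open>\<alpha>\<close> is uniform on \<open>s\<close> disjoint sets. If there are more, they are on average
  smaller than \<open>M\<close>. A color in \<open>A\<close> is used with probability at most \<open>meet A\<close>, while the colors are
  used with probability at least \<open>1 / s\<close> on average because \<open>log_size\<close> is so large. Comparing the two, with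
  the small sets for the colors inside them and with random sets for all other colors, gives
  \<open>kernel_inequality\<close>, where the small sets cause a loss and the random sets an error of order
  \<open>s / M\<close>. A set of size \<open>x \<le> M / 2\<close> loses \<open>x * ln (M / x) \<ge> ln M\<close>, and this exceeds the
  error because \<open>s / M \<le> ln M / 50\<close>; here the bound \<open>q \<ge> 100 * s\<^sup>2 / ln s\<close> is used in full. If all the disjoint sets are larger than
  \<open>M / 2\<close>, they lose about \<open>M\<close> in total, which is far more than any error term.

  Since distributions form a compact set, a distribution that nearly satisfies the two inequalities
  is near to a uniform one (\<open>stability\<close>). The lists of an extremal graph are therefore,
  for almost all vertices, among \<open>s\<close> disjoint sets that occur about equally often. Vertices with the
  same list span few edges, and a count of the edges shows that few of the others are missing.
\<close>

section \<open>Distributions on sets of colors\<close>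

definition color_sets :: "nat \<Rightarrow> nat set set" where
  "color_sets q = Pow {..<q} - {{}}"

definition expect :: "nat \<Rightarrow> (nat set \<Rightarrow> real) \<Rightarrow> (nat set \<Rightarrow> real) \<Rightarrow> real" where
  "expect q \<alpha> f = (\<Sum>A\<in>color_sets q. \<alpha> A * f A)"

definition meet :: "nat \<Rightarrow> (nat set \<Rightarrow> real) \<Rightarrow> nat set \<Rightarrow> real" where
  "meet q \<alpha> A = expect q \<alpha> (\<lambda>B. of_bool (A \<inter> B \<noteq> {}))"

text \<open>The probability that two independent random sets meet. For the lists of a graph, a clash of
  \<^term>\<open>1 / s\<close> corresponds to the edge density of the Turan graph with \<open>s\<close> parts.\<close>
definition clash :: "nat \<Rightarrow> (nat set \<Rightarrow> real) \<Rightarrow> real" where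
  "clash q \<alpha> = expect q \<alpha> (meet q \<alpha>)"

definition usage :: "nat \<Rightarrow> (nat set \<Rightarrow> real) \<Rightarrow> nat \<Rightarrow> real" where
  "usage q \<alpha> i = expect q \<alpha> (\<lambda>B. of_bool (i \<in> B))"

definition log_size :: "nat \<Rightarrow> (nat set \<Rightarrow> real) \<Rightarrow> real" where
  "log_size q \<alpha> = expect q \<alpha> (\<lambda>A. ln (card A))"

definition distribution :: "nat \<Rightarrow> (nat set \<Rightarrow> real) \<Rightarrow> bool" where
  "distribution q \<alpha> \<longleftrightarrow> (\<forall>A. 0 \<le> \<alpha> A) \<and> (\<forall>A. A \<notin> color_sets q \<longrightarrow> \<alpha> A = 0) \<and> sum \<alpha> (color_sets q) = 1"

text \<open>The value at \<open>q / s\<close> of the piecewise linear function that agrees with \<open>ln\<close> at the integers. Since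
  \<open>ln\<close> is concave, this is the largest mean of \<open>ln\<close> over \<open>s\<close> positive integers of sum \<open>q\<close>.\<close>
definition turan_value :: "nat \<Rightarrow> nat \<Rightarrow> real" where
  "turan_value s q = (let a = real (q div s) in ln a + (real q / real s - a) * (ln (a + 1) - ln a))"

definition uniform_partition :: "nat \<Rightarrow> nat \<Rightarrow> (nat set \<Rightarrow> real) \<Rightarrow> bool" where
  "uniform_partition s q \<alpha> \<longleftrightarrow> (\<exists>P \<subseteq> color_sets q. card P = s \<and> disjoint P \<and>
     (\<forall>A. \<alpha> A = (if A \<in> P then 1 / real s else 0)))"

lemma finite_color_sets [simp]: "finite (color_sets q)"
  by (simp add: color_sets_def)

lemma color_setsD: assumes "A \<in> color_sets q"
  shows "A \<subseteq> {..<q}" "A \<noteq> {}" "finite A" "1 \<le> card A" "card A \<le> q"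
proof -
  show *: "A \<subseteq> {..<q}" "A \<noteq> {}" using assms by (auto simp: color_sets_def)
  show f: "finite A" using * finite_subset by blast
  show "1 \<le> card A" using * f by (simp add: Suc_le_eq card_gt_0_iff)
  show "card A \<le> q" using card_mono[OF _ *(1)] by simp
qed

lemma expect_add: "expect q \<alpha> (\<lambda>A. f A + g A) = expect q \<alpha> f + expect q \<alpha> g"
  by (simp add: expect_def algebra_simps sum.distrib)

lemma expect_diff: "expect q \<alpha> (\<lambda>A. f A - g A) = expect q \<alpha> f - expect q \<alpha> g"
  by (simp add: expect_def algebra_simps sum_subtractf)

lemma expect_cmult: "expect q \<alpha> (\<lambda>A. c * f A) = c * expect q \<alpha> f"
  by (simp add: expect_def sum_distrib_left mult_ac)

lemma expect_sum: "expect q \<alpha> (\<lambda>A. \<Sum>i\<in>I. f i A) = (\<Sum>i\<in>I. expect q \<alpha> (f i))"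
  unfolding expect_def by (subst sum.swap) (simp add: sum_distrib_left)

locale color_distr =
  fixes q :: nat and \<alpha> :: "nat set \<Rightarrow> real"
  assumes distribution: "distribution q \<alpha>"
begin

abbreviation E where "E \<equiv> expect q \<alpha>"

definition supp where "supp = {A \<in> color_sets q. \<alpha> A > 0}"

lemma nonneg: "0 \<le> \<alpha> A" and outside: "A \<notin> color_sets q \<Longrightarrow> \<alpha> A = 0"
  and total: "sum \<alpha> (color_sets q) = 1"
  using distribution by (auto simp: distribution_def)

lemma supp_color_set: "A \<in> supp \<Longrightarrow> A \<in> color_sets q" by (simp add: supp_def)
lemmas suppD = color_setsD[OF supp_color_set]
lemma supp_pos: "A \<in> supp \<Longrightarrow> 0 < \<alpha> A" by (simp add: supp_def)
lemma finite_supp [simp]: "finite supp" by (simp add: supp_def)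

lemma not_supp: "A \<notin> supp \<Longrightarrow> \<alpha> A = 0"
  using nonneg[of A] outside[of A] by (auto simp: supp_def not_less intro: antisym)

lemma expect_supp: "E f = (\<Sum>A\<in>supp. \<alpha> A * f A)"
  unfolding expect_def
  by (rule sum.mono_neutral_right) (auto simp: supp_color_set not_supp)

lemma total_supp: "sum \<alpha> supp = 1"
  using total expect_supp[of "\<lambda>_. 1"] by (simp add: expect_def)

lemma expect_mono: assumes "\<And>A. A \<in> supp \<Longrightarrow> f A \<le> g A" shows "E f \<le> E g"
  unfolding expect_supp by (intro sum_mono mult_left_mono assms nonneg)

lemma expect_cong: assumes "\<And>A. A \<in> supp \<Longrightarrow> f A = g A" shows "E f = E g"
  unfolding expect_supp by (intro sum.cong refl) (simp add: assms)

lemma expect_const [simp]: "E (\<lambda>_. c) = c"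
  using total by (simp add: expect_def flip: sum_distrib_right)

lemma expect_nonneg: assumes "\<And>A. A \<in> supp \<Longrightarrow> 0 \<le> f A" shows "0 \<le> E f"
  using expect_mono[of "\<lambda>_. 0" f] assms by simp

text \<open>The equality case of an averaging argument. It turns numerical tightness into statements about
  every single set of the support.\<close>

lemma expect_eq_const:
  assumes "\<And>A. A \<in> supp \<Longrightarrow> c \<le> f A" "E f \<le> c" "A \<in> supp"
  shows "f A = c"
proof (rule ccontr)
  assume "f A \<noteq> c"
  then have "c < f A" using assms by force
  have "(\<Sum>B\<in>supp. \<alpha> B * c) < (\<Sum>B\<in>supp. \<alpha> B * f B)"
    by (rule sum_strict_mono_ex1)
       (use assms \<open>c < f A\<close> supp_pos nonneg in \<open>auto intro!: mult_left_mono bexI[of _ A]\<close>)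
  then have "E (\<lambda>_. c) < E f" unfolding expect_supp .
  then show False using assms(2) by simp
qed

lemma expect_CS:
  assumes "\<And>A. A \<in> supp \<Longrightarrow> 0 \<le> f A"  "\<And>A. A \<in> supp \<Longrightarrow> 0 \<le> g A"
  shows "E (\<lambda>A. sqrt (f A) * sqrt (g A)) \<le> sqrt (E f) * sqrt (E g)"
proof -
  have "(E (\<lambda>A. sqrt (f A) * sqrt (g A)))\<^sup>2
      = (\<Sum>A\<in>supp. (sqrt (\<alpha> A) * sqrt (f A)) * (sqrt (\<alpha> A) * sqrt (g A)))\<^sup>2"
    unfolding expect_supp
    by (intro arg_cong[of _ _ "\<lambda>x. x\<^sup>2"] sum.cong refl)
      (simp add: nonneg algebra_simps flip: real_sqrt_mult, simp add: real_sqrt_mult mult.assoc[symmetric] nonneg)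
  also have "\<dots> \<le> (\<Sum>A\<in>supp. (sqrt (\<alpha> A) * sqrt (f A))\<^sup>2) * (\<Sum>A\<in>supp. (sqrt (\<alpha> A) * sqrt (g A))\<^sup>2)"
    by (rule Cauchy_Schwarz_ineq_sum)
  also have "\<dots> = E f * E g"
    unfolding expect_supp using assms nonneg by (simp add: power_mult_distrib cong: sum.cong)
  finally have "E (\<lambda>A. sqrt (f A) * sqrt (g A)) \<le> sqrt (E f * E g)"
    by (rule real_le_rsqrt)
  then show ?thesis by (simp add: real_sqrt_mult)
qed

lemma usage_le_meet: assumes "i \<in> A" shows "usage q \<alpha> i \<le> meet q \<alpha> A"
  unfolding usage_def meet_def by (rule expect_mono) (use assms in auto)

lemma usage_pos_iff: "0 < usage q \<alpha> i \<longleftrightarrow> (\<exists>A\<in>supp. i \<in> A)"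
proof
  assume "0 < usage q \<alpha> i"
  then show "\<exists>A\<in>supp. i \<in> A"
    by (rule contrapos_pp) (auto simp: usage_def expect_supp not_less intro!: sum_nonpos)
next
  assume "\<exists>A\<in>supp. i \<in> A"
  then obtain A where A: "A \<in> supp" "i \<in> A" by blast
  have "\<alpha> A * of_bool (i \<in> A) \<le> usage q \<alpha> i"
    unfolding usage_def expect_supp using A nonneg by (intro member_le_sum) auto
  then show "0 < usage q \<alpha> i" using A supp_pos by force
qed

lemma sum_usage: assumes "U \<subseteq> {..<q}" shows "(\<Sum>i\<in>U. usage q \<alpha> i) = E (\<lambda>A. card (A \<inter> U))"
proof -
  have "(\<Sum>i\<in>U. usage q \<alpha> i) = E (\<lambda>A. \<Sum>i\<in>U. of_bool (i \<in> A))"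
    by (simp add: usage_def expect_sum)
  also have "\<dots> = E (\<lambda>A. card (A \<inter> U))"
  proof (rule expect_cong)
    fix A assume "A \<in> supp"
    have "finite U" using assms finite_subset by blast
    then show "(\<Sum>i\<in>U. of_bool (i \<in> A)) = real (card (A \<inter> U))"
      by (simp add: of_bool_def Int_def conj_commute flip: sum.inter_filter)
  qed
  finally show ?thesis .
qed

lemma sum_usage_all: "(\<Sum>i<q. usage q \<alpha> i) = E (\<lambda>A. card A)"
  unfolding sum_usage[OF order_refl]
  by (rule expect_cong) (use suppD(1) in \<open>simp add: Int_absorb2\<close>)

lemma mult_sqrt_card: assumes "A \<in> supp"
  shows "sqrt (card A) * sqrt (card A) = card A" "sqrt (card A) > 0"
  using suppD[OF assms] by auto

text \<open>The weight \<open>1 / sqrt (card A)\<close> is chosen so that the squared length of this vector is a lower bound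
  for the clash, whereas the sum of its entries is the mean of \<open>sqrt (card A)\<close>.\<close>
definition flat :: "nat \<Rightarrow> real" where
  "flat i = E (\<lambda>A. of_bool (i \<in> A) / sqrt (card A))"

lemma sum_flat: assumes "U \<subseteq> {..<q}"
  shows "(\<Sum>i\<in>U. flat i) = E (\<lambda>A. card (A \<inter> U) / sqrt (card A))"
proof -
  have fU: "finite U" using assms finite_subset by blast
  have "(\<Sum>i\<in>U. flat i) = E (\<lambda>A. \<Sum>i\<in>U. of_bool (i \<in> A) / sqrt (card A))"
    by (simp add: flat_def expect_sum)
  also have "\<dots> = E (\<lambda>A. card (A \<inter> U) / sqrt (card A))"
  proof (rule expect_cong)
    fix A
    have "(\<Sum>i\<in>U. of_bool (i \<in> A)) = real (card (A \<inter> U))"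
      using fU by (simp add: of_bool_def Int_def conj_commute flip: sum.inter_filter)
    then show "(\<Sum>i\<in>U. of_bool (i \<in> A) / sqrt (card A)) = card (A \<inter> U) / sqrt (card A)"
      by (simp flip: sum_divide_distrib)
  qed
  finally show ?thesis .
qed

lemma sum_flat_all: "(\<Sum>i<q. flat i) = E (\<lambda>A. sqrt (card A))"
  unfolding sum_flat[OF order_refl]
  by (rule expect_cong) (use suppD mult_sqrt_card in \<open>auto simp add: Int_absorb2 field_simps\<close>)

lemma overlap_bound: assumes "A \<in> supp" "B \<in> supp"
  shows "card (A \<inter> B) / (sqrt (card A) * sqrt (card B)) \<le> of_bool (A \<inter> B \<noteq> {})"
proof (cases "A \<inter> B = {}")
  case False
  have "card (A \<inter> B) \<le> card A" "card (A \<inter> B) \<le> card B"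
    using assms suppD by (auto intro!: card_mono)
  then have "sqrt (card (A \<inter> B)) * sqrt (card (A \<inter> B)) \<le> sqrt (card A) * sqrt (card B)"
    by (intro mult_mono) auto
  then show ?thesis using False mult_sqrt_card assms by (simp add: divide_simps)
qed simp

lemma flat_le_meet: assumes "A \<in> supp" shows "(\<Sum>i\<in>A. flat i) / sqrt (card A) \<le> meet q \<alpha> A"
proof -
  have "(\<Sum>i\<in>A. flat i) / sqrt (card A) = E (\<lambda>B. 1 / sqrt (card A) * (card (B \<inter> A) / sqrt (card B)))"
    unfolding sum_flat[OF suppD(1)[OF assms]] expect_cmult by simp
  also have "\<dots> \<le> meet q \<alpha> A"
    unfolding meet_def using overlap_bound[OF assms]
    by (intro expect_mono) (simp add: Int_commute mult.commute)
  finally show ?thesis .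
qed

lemma sum_flat_sq: "(\<Sum>i<q. (flat i)\<^sup>2) \<le> clash q \<alpha>"
proof -
  have "(\<Sum>i<q. (flat i)\<^sup>2) = (\<Sum>i<q. E (\<lambda>A. of_bool (i \<in> A) / sqrt (card A) * flat i))"
    using expect_cmult[of q \<alpha> "flat _" "\<lambda>A. of_bool (_ \<in> A) / sqrt (card A)"]
    by (intro sum.cong refl) (simp add: power2_eq_square mult.commute flat_def)
  also have "\<dots> = E (\<lambda>A. \<Sum>i<q. of_bool (i \<in> A) / sqrt (card A) * flat i)"
    by (simp add: expect_sum)
  also have "\<dots> \<le> clash q \<alpha>"
    unfolding clash_def
  proof (rule expect_mono)
    fix A assume A: "A \<in> supp"
    have "(\<Sum>i<q. of_bool (i \<in> A) / sqrt (card A) * flat i) = (\<Sum>i\<in>A. flat i / sqrt (card A))"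
      using suppD(1)[OF A] by (intro sum.mono_neutral_cong_right) auto
    also have "\<dots> \<le> meet q \<alpha> A" using flat_le_meet[OF A] by (simp add: sum_divide_distrib)
    finally show "(\<Sum>i<q. of_bool (i \<in> A) / sqrt (card A) * flat i) \<le> meet q \<alpha> A" .
  qed
  finally show ?thesis .
qed

end

section \<open>Optimal distributions and Lagrange multipliers\<close>

lemma ln_step_antimono: assumes "0 < x" "x \<le> y" shows "ln (y + 1) - ln y \<le> ln (x + 1) - ln (x::real)"
proof -
  have "(y + 1) * x \<le> (x + 1) * y" using assms by (simp add: algebra_simps)
  then have "ln ((y + 1) * x) \<le> ln ((x + 1) * y)" using assms by (intro ln_mono) auto
  then show ?thesis using assms by (simp add: ln_mult)
qed

text \<open>The secant of \<open>ln\<close> through the neighbouring integers \<open>a\<close> and \<open>a + 1\<close> is an upper bound for \<open>ln\<close> at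
  all positive integers. This sharpening of the tangent bound is what makes \<open>turan_value\<close> the exact optimum for
  a given mean size, even if \<open>s\<close> does not divide \<open>q\<close>.\<close>

lemma ln_nat_le_secant: fixes a y :: nat assumes "1 \<le> a" "1 \<le> y"
  shows "ln (real y) \<le> ln (real a) + (real y - a) * (ln (real a + 1) - ln a)"
proof (cases "a \<le> y")
  case True
  then show ?thesis
  proof (induction y rule: dec_induct)
    case (step y)
    then show ?case using ln_step_antimono[of "real a" "real y"] assms by (simp add: algebra_simps)
  qed simp
next
  case False
  then have "y \<le> a" by simp
  then show ?thesis using assms(2)
  proof (induction rule: inc_induct)
    case (step y)
    then show ?case using ln_step_antimono[of "real y" "real a"] by (simp add: algebra_simps)
  qed simp
qed

lemma expect_dist_add: "expect q (\<lambda>A. \<beta> A + t * v A) f = expect q \<beta> f + t * expect q v f"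
  by (simp add: expect_def algebra_simps sum.distrib sum_distrib_left)

lemma meet_sym: "expect q \<beta> (meet q v) = expect q v (meet q \<beta>)"
  unfolding meet_def expect_def sum_distrib_left
  by (subst sum.swap) (simp add: mult.left_commute Int_commute)

lemma clash_dist_add:
  "clash q (\<lambda>A. \<beta> A + t * v A) = clash q \<beta> + t * (2 * expect q v (meet q \<beta>) + t * clash q v)"
proof -
  have m: "meet q (\<lambda>A. \<beta> A + t * v A) = (\<lambda>A. meet q \<beta> A + t * meet q v A)"
    unfolding meet_def expect_dist_add ..
  show ?thesis
    unfolding clash_def m expect_dist_add expect_add expect_cmult meet_sym[of q \<beta> v]
    by (simp add: algebra_simps)
qed

lemma expect_points:
  assumes "A \<in> color_sets q" "B \<in> color_sets q" "C \<in> color_sets q"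
  shows "expect q (\<lambda>S. x * of_bool (S = A) + y * of_bool (S = B) + z * of_bool (S = C)) f
    = x * f A + y * f B + z * f C"
proof -
  have *: "(\<Sum>S\<in>color_sets q. x * of_bool (S = A) * f S) = x * f A" if "A \<in> color_sets q" for A x
    using that by (simp add: of_bool_def if_distrib if_distribR sum.delta' cong: if_cong)
  show ?thesis
    using *[OF assms(1)] *[OF assms(2)] *[OF assms(3)]
    by (simp add: expect_def algebra_simps sum.distrib)
qed

lemma (in color_distr) log_size_le:
  fixes a :: nat assumes "1 \<le> a"
  shows "log_size q \<alpha> \<le> ln (real a) + (E (\<lambda>A. card A) - a) * (ln (real a + 1) - ln a)"
proof -
  have "log_size q \<alpha> \<le> E (\<lambda>A. (ln (real a) - a * (ln (real a + 1) - ln a))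
      + (ln (real a + 1) - ln a) * card A)"
    unfolding log_size_def
  proof (rule expect_mono)
    fix A assume "A \<in> supp"
    show "ln (card A) \<le> (ln (real a) - a * (ln (real a + 1) - ln a)) + (ln (real a + 1) - ln a) * card A"
      using ln_nat_le_secant[OF assms suppD(4)[OF \<open>A \<in> supp\<close>]] by (simp add: algebra_simps)
  qed
  also have "\<dots> = ln (real a) + (E (\<lambda>A. card A) - a) * (ln (real a + 1) - ln a)"
    unfolding expect_add expect_cmult expect_const by (simp add: algebra_simps)
  finally show ?thesis .
qed

locale optimal_distr = color_distr +
  fixes s :: nat
  assumes s_pos: "0 < s" and s_le_q: "s \<le> q"
    and clash_le: "clash q \<alpha> \<le> 1 / s"
    and optimal: "\<And>\<beta>. distribution q \<beta> \<Longrightarrow> clash q \<beta> \<le> 1 / s \<Longrightarrow> log_size q \<beta> \<le> log_size q \<alpha>"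
    and value_ge: "turan_value s q \<le> log_size q \<alpha>"
begin

lemma q_pos: "0 < q" using s_pos s_le_q by simp

text \<open>The secant bound is strictly increasing in the mean size and equals \<open>turan_value\<close> at \<open>q / s\<close>.\<close>

lemma mean_size: "real q / s \<le> E (\<lambda>A. card A)"
proof -
  have a: "1 \<le> q div s" using s_pos s_le_q by (simp add: Suc_le_eq div_greater_zero_iff)
  then have "ln (real (q div s) + 1) - ln (real (q div s)) > 0" by simp
  moreover have "turan_value s q \<le> ln (real (q div s))
      + (E (\<lambda>A. card A) - q div s) * (ln (real (q div s) + 1) - ln (real (q div s)))"
    using log_size_le[OF a] value_ge by linarith
  ultimately show ?thesis by (simp add: turan_value_def Let_def)
qed

text \<open>First-order optimality. If \<open>\<alpha> + t * v\<close> increased the objective and decreased the clash to first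
  order, then a small \<open>t > 0\<close> would contradict the optimality of \<open>\<alpha>\<close>.\<close>

lemma improving_direction:
  assumes supp: "\<And>A. A \<notin> supp \<Longrightarrow> v A = 0" and sum: "sum v (color_sets q) = 0"
    and gain: "0 < expect q v (\<lambda>A. ln (card A))"
  shows "0 \<le> expect q v (meet q \<alpha>)"
proof (rule ccontr)
  assume neg: "\<not> ?thesis"
  have "\<forall>\<^sub>F t in at_right 0. \<forall>A\<in>supp. 0 < \<alpha> A + t * v A"
  proof (intro eventually_ball_finite ballI finite_supp)
    fix A assume "A \<in> supp"
    have "((\<lambda>t. \<alpha> A + t * v A) \<longlongrightarrow> \<alpha> A + 0 * v A) (at_right 0)" by (intro tendsto_intros)
    from order_tendstoD(1)[OF this, of 0] show "\<forall>\<^sub>F t in at_right 0. 0 < \<alpha> A + t * v A"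
      using supp_pos[OF \<open>A \<in> supp\<close>] by simp
  qed
  moreover have "\<forall>\<^sub>F t in at_right 0. 2 * expect q v (meet q \<alpha>) + t * clash q v < 0"
  proof -
    have "((\<lambda>t. 2 * expect q v (meet q \<alpha>) + t * clash q v) \<longlongrightarrow> 2 * expect q v (meet q \<alpha>) + 0 * clash q v) (at_right 0)"
      by (intro tendsto_intros)
    from order_tendstoD(2)[OF this, of 0] show ?thesis using neg by simp
  qed
  moreover have "\<forall>\<^sub>F t in at_right (0::real). 0 < t" by (rule eventually_at_right_less)
  ultimately have "\<forall>\<^sub>F t in at_right 0. (\<forall>A\<in>supp. 0 < \<alpha> A + t * v A) \<and>
      2 * expect q v (meet q \<alpha>) + t * clash q v < 0 \<and> 0 < t" by eventually_elim auto
  then obtain t where t: "\<And>A. A \<in> supp \<Longrightarrow> 0 < \<alpha> A + t * v A"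
      "2 * expect q v (meet q \<alpha>) + t * clash q v < 0" "0 < t"
    using eventually_happens'[OF trivial_limit_at_right_real] by blast
  let ?\<beta> = "\<lambda>A. \<alpha> A + t * v A"
  have "distribution q ?\<beta>" unfolding distribution_def
  proof (intro conjI allI impI)
    show "0 \<le> ?\<beta> A" for A using t(1)[of A] supp[of A] nonneg[of A] by (cases "A \<in> supp") auto
    show "?\<beta> A = 0" if "A \<notin> color_sets q" for A
      using that supp[of A] outside[of A] supp_color_set[of A] by auto
    show "sum ?\<beta> (color_sets q) = 1"
      using sum total by (simp add: sum.distrib flip: sum_distrib_left)
  qed
  moreover have "clash q ?\<beta> \<le> 1 / s"
    using clash_le mult_pos_neg[OF t(3,2)] by (simp add: clash_dist_add)
  ultimately have "log_size q ?\<beta> \<le> log_size q \<alpha>" by (rule optimal)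
  then show False using mult_pos_pos[OF t(3) gain] by (simp add: log_size_def expect_dist_add)
qed

lemma improving_triple:
  assumes "A \<in> supp" "B \<in> supp" "C \<in> supp" "x + y + z = 0"
    and "0 < x * ln (card A) + y * ln (card B) + z * ln (card C)"
  shows "0 \<le> x * meet q \<alpha> A + y * meet q \<alpha> B + z * meet q \<alpha> C"
proof -
  let ?v = "\<lambda>S. x * of_bool (S = A) + y * of_bool (S = B) + z * of_bool (S = C)"
  note pts = expect_points[OF assms(1-3)[THEN supp_color_set]]
  have "sum ?v (color_sets q) = 0"
    using pts[of x y z "\<lambda>_. 1"] assms(4) by (simp add: expect_def)
  then have "0 \<le> expect q ?v (meet q \<alpha>)"
    using assms by (intro improving_direction) (auto simp: pts)
  then show ?thesis by (simp add: pts)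
qed

text \<open>The Lagrange condition, with \<open>\<mu>\<close> the reciprocal of the usual multiplier. Some set of different size
  has to exist, since otherwise no direction changes the objective. Every \<open>v\<close> supported
  on three sets that leaves the objective unchanged must leave the clash unchanged to first order,
  because both \<open>v\<close> and \<open>- v\<close> can be tilted towards a larger objective.\<close>

lemma meet_affine_in_log_size:
  assumes "A0 \<in> supp" "B0 \<in> supp" "ln (card B0) < ln (card A0)"
  obtains \<mu> where "0 \<le> \<mu>" "\<And>A. A \<in> supp \<Longrightarrow> meet q \<alpha> A = clash q \<alpha> + \<mu> * (ln (card A) - log_size q \<alpha>)"
proof -
  define l :: "nat set \<Rightarrow> real" where "l A = ln (card A)" for A
  have lt: "l B0 < l A0" using assms by (simp add: l_def)
  define \<mu> where "\<mu> = (meet q \<alpha> A0 - meet q \<alpha> B0) / (l A0 - l B0)"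
  have mu_eq: "meet q \<alpha> A0 = meet q \<alpha> B0 + \<mu> * (l A0 - l B0)" using lt by (simp add: \<mu>_def)
  have "0 \<le> 1 * meet q \<alpha> A0 + (-1) * meet q \<alpha> B0 + 0 * meet q \<alpha> B0"
    by (rule improving_triple) (use assms in auto)
  then have mu: "0 \<le> \<mu>" using lt by (simp add: \<mu>_def)
  have affine: "meet q \<alpha> C = meet q \<alpha> B0 + \<mu> * (l C - l B0)" if C: "C \<in> supp" for C
  proof -
    define r where "r = (l C - l B0) / (l A0 - l B0)"
    have r: "r * (l A0 - l B0) = l C - l B0" using lt by (simp add: r_def)
    have e: "0 \<le> \<sigma> * (meet q \<alpha> C - (1 - r) * meet q \<alpha> B0 - r * meet q \<alpha> A0) + \<epsilon> * (meet q \<alpha> A0 - meet q \<alpha> B0)"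
      if "0 < \<epsilon>" for \<epsilon> \<sigma>
    proof -
      have "0 \<le> \<sigma> * meet q \<alpha> C + (- \<sigma> * (1 - r) - \<epsilon>) * meet q \<alpha> B0 + (- \<sigma> * r + \<epsilon>) * meet q \<alpha> A0"
      proof (rule improving_triple[OF C assms(2,1)])
        have "\<sigma> * l C + (- \<sigma> * (1 - r) - \<epsilon>) * l B0 + (- \<sigma> * r + \<epsilon>) * l A0
            = \<sigma> * ((l C - l B0) - r * (l A0 - l B0)) + \<epsilon> * (l A0 - l B0)"
          by (simp add: algebra_simps)
        also have "\<dots> > 0" using r lt that by simp
        finally show "0 < \<sigma> * ln (card C) + (- \<sigma> * (1 - r) - \<epsilon>) * ln (card B0) + (- \<sigma> * r + \<epsilon>) * ln (card A0)"
          by (simp add: l_def)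
      qed (simp add: algebra_simps)
      then show ?thesis by (simp add: algebra_simps)
    qed
    (* let the tilt tend to 0; then use both signs *)
    have lim: "0 \<le> \<sigma> * (meet q \<alpha> C - (1 - r) * meet q \<alpha> B0 - r * meet q \<alpha> A0)" for \<sigma>
    proof (rule tendsto_lowerbound[where F = "at_right (0::real)"])
      let ?f = "\<lambda>\<epsilon>. \<sigma> * (meet q \<alpha> C - (1 - r) * meet q \<alpha> B0 - r * meet q \<alpha> A0) + \<epsilon> * (meet q \<alpha> A0 - meet q \<alpha> B0)"
      have "(?f \<longlongrightarrow> \<sigma> * (meet q \<alpha> C - (1 - r) * meet q \<alpha> B0 - r * meet q \<alpha> A0) + 0 * (meet q \<alpha> A0 - meet q \<alpha> B0)) (at_right 0)"
        by (intro tendsto_intros)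
      then show "(?f \<longlongrightarrow> \<sigma> * (meet q \<alpha> C - (1 - r) * meet q \<alpha> B0 - r * meet q \<alpha> A0)) (at_right 0)" by simp
      show "\<forall>\<^sub>F \<epsilon> in at_right 0. 0 \<le> ?f \<epsilon>"
        using eventually_at_right_less[of 0] by eventually_elim (rule e)
    qed simp
    have "meet q \<alpha> C = (1 - r) * meet q \<alpha> B0 + r * meet q \<alpha> A0"
      using lim[of 1] lim[of "-1"] by simp
    also have "\<dots> = meet q \<alpha> B0 + \<mu> * (l C - l B0)"
      unfolding r[symmetric] by (simp add: mu_eq algebra_simps)
    finally show ?thesis .
  qed
  have "clash q \<alpha> = E (\<lambda>A. (meet q \<alpha> B0 - \<mu> * l B0) + \<mu> * l A)"
    unfolding clash_def by (rule expect_cong) (simp add: affine algebra_simps)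
  also have "\<dots> = meet q \<alpha> B0 - \<mu> * l B0 + \<mu> * log_size q \<alpha>"
    unfolding expect_add expect_const expect_cmult by (simp add: log_size_def l_def)
  finally have "meet q \<alpha> A = clash q \<alpha> + \<mu> * (ln (card A) - log_size q \<alpha>)" if "A \<in> supp" for A
    using affine[OF that] by (simp add: l_def algebra_simps)
  with mu show thesis by (rule that)
qed

text \<open>Each color is used with probability at most \<open>1 / s\<close>, because all sets that contain it meet a given
  one of them. As the mean size is at least \<open>q / s\<close>, equality holds throughout, so that every set that
  meets \<open>A\<close> contains all of \<open>A\<close>.\<close>

lemma uniform_if_meet_const:
  assumes meet: "\<And>A. A \<in> supp \<Longrightarrow> meet q \<alpha> A = 1 / s"
  shows "uniform_partition s q \<alpha>"
proof -
  have le: "usage q \<alpha> i \<le> 1 / s" for i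
  proof (cases "\<exists>A\<in>supp. i \<in> A")
    case True
    then show ?thesis using usage_le_meet meet by metis
  next
    case False
    then show ?thesis using usage_pos_iff[of i] by (simp add: not_less order.trans[of _ 0])
  qed
  have eq: "usage q \<alpha> i = 1 / s" if "i < q" for i
  proof (rule ccontr)
    assume "usage q \<alpha> i \<noteq> 1 / s"
    then have "(\<Sum>i<q. usage q \<alpha> i) < (\<Sum>i<q. 1 / s)"
      using le that by (intro sum_strict_mono_ex1) (auto simp: order.strict_iff_order)
    then show False using mean_size by (simp add: sum_usage_all)
  qed
  have sub: "A \<subseteq> B" if "A \<in> supp" "B \<in> supp" "A \<inter> B \<noteq> {}" for A B
  proof
    fix i assume "i \<in> A"
    then have "i < q" using suppD(1)[OF that(1)] by auto
    have "E (\<lambda>B. of_bool (A \<inter> B \<noteq> {}) - of_bool (i \<in> B)) = 0"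
      unfolding expect_diff using meet[OF that(1)] eq[OF \<open>i < q\<close>] by (simp add: meet_def usage_def)
    then have "of_bool (A \<inter> B \<noteq> {}) - of_bool (i \<in> B) = (0::real)"
      by (intro expect_eq_const[OF _ _ that(2)]) (use \<open>i \<in> A\<close> in auto)
    then show "i \<in> B" using that(3) by (auto split: if_splits)
  qed
  have dj: "A = B" if "A \<in> supp" "B \<in> supp" "A \<inter> B \<noteq> {}" for A B
    using sub[OF that] sub[OF that(2,1)] that(3) by (auto simp: Int_commute)
  have val: "\<alpha> A = 1 / s" if "A \<in> supp" for A
  proof -
    have "meet q \<alpha> A = (\<Sum>B\<in>supp. \<alpha> B * of_bool (B = A))"
      unfolding meet_def expect_supp using dj[OF that] suppD(2)[OF that] by (intro sum.cong refl) auto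
    then show ?thesis using that meet[OF that] by (simp add: of_bool_def if_distrib cong: if_cong)
  qed
  have "sum \<alpha> supp = real (card supp) / s" by (simp add: val)
  then have "card supp = s" using s_pos by (simp add: total_supp)
  moreover have "disjoint supp" using dj by (auto simp: disjoint_def)
  moreover have "\<alpha> A = (if A \<in> supp then 1 / real s else 0)" for A using val not_supp by simp
  moreover have "supp \<subseteq> color_sets q" using supp_color_set by blast
  ultimately show ?thesis unfolding uniform_partition_def by blast
qed

end

section \<open>Disjoint kernels of the support\<close>

text \<open>The greedy choice: take a set with the smallest value of \<open>p\<close>, discard all sets that meet it, and
  continue with the others.\<close>

lemma disjoint_kernel:
  fixes p :: "'a set \<Rightarrow> real"
  assumes "finite R" "{} \<notin> R"
  obtains F where "F \<subseteq> R" "disjoint F" "\<And>B. B \<in> R \<Longrightarrow> \<exists>A\<in>F. A \<inter> B \<noteq> {} \<and> p A \<le> p B"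
proof -
  have "\<exists>F\<subseteq>R. disjoint F \<and> (\<forall>B\<in>R. \<exists>A\<in>F. A \<inter> B \<noteq> {} \<and> p A \<le> p B)"
    using assms
  proof (induction rule: finite_psubset_induct)
    case (psubset R)
    show ?case
    proof (cases "R = {}")
      case False
      then obtain A where A: "A \<in> R" "\<And>B. B \<in> R \<Longrightarrow> p A \<le> p B"
        using psubset.hyps ex_min_if_finite[of "p ` R"] by (auto simp: not_less)
      define R' where "R' = {B \<in> R. A \<inter> B = {}}"
      have "A \<notin> R'" using A(1) psubset.prems by (auto simp: R'_def)
      then have "R' \<subset> R" using A by (auto simp: R'_def)
      then obtain F where F: "F \<subseteq> R'" "disjoint F" "\<forall>B\<in>R'. \<exists>A\<in>F. A \<inter> B \<noteq> {} \<and> p A \<le> p B"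
        using psubset.IH[of R'] psubset.prems by blast
      have "\<exists>C\<in>insert A F. C \<inter> B \<noteq> {} \<and> p C \<le> p B" if "B \<in> R" for B
        using that F(3) A by (cases "B \<in> R'") (auto simp: R'_def)
      moreover have "disjoint (insert A F)"
        using F by (auto simp: disjoint_def R'_def)
      ultimately show ?thesis using F(1) A(1) by (intro exI[of _ "insert A F"]) (auto simp: R'_def)
    qed auto
  qed
  then show thesis using that by blast
qed

context optimal_distr begin

text \<open>Assign every set of the support to a member \<open>C\<close> of the kernel that it meets, and let \<open>r C\<close> be the
  probability of the sets assigned to \<open>C\<close>. Then \<open>r C \<le> meet C\<close>, so that the clash is at least the sum
  of the squares of the \<open>r C\<close>. These are at most \<open>s\<close> numbers of sum \<open>1\<close>, so the clash can be at most
  \<open>1 / s\<close> only in the case of equality.\<close>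

lemma meet_const_if_small_kernel:
  assumes F: "F \<subseteq> supp" "disjoint F" and small: "card F \<le> s"
    and kernel: "\<And>B. B \<in> supp \<Longrightarrow> \<exists>A\<in>F. A \<inter> B \<noteq> {} \<and> meet q \<alpha> A \<le> meet q \<alpha> B"
    and "A \<in> supp"
  shows "meet q \<alpha> A = 1 / s"
proof -
  obtain f where f: "\<And>B. B \<in> supp \<Longrightarrow> f B \<in> F" "\<And>B. B \<in> supp \<Longrightarrow> f B \<inter> B \<noteq> {}"
    "\<And>B. B \<in> supp \<Longrightarrow> meet q \<alpha> (f B) \<le> meet q \<alpha> B" using kernel by metis
  have finF: "finite F" using F(1) finite_subset finite_supp by blast
  define r where "r C = E (\<lambda>B. of_bool (f B = C))" for C
  have r_le: "r C \<le> meet q \<alpha> C" for C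
    unfolding r_def meet_def by (rule expect_mono) (use f in auto)
  have split: "E (\<lambda>B. g (f B)) = (\<Sum>C\<in>F. g C * r C)" for g
  proof -
    have "E (\<lambda>B. g (f B)) = E (\<lambda>B. \<Sum>C\<in>F. g C * of_bool (f B = C))"
      by (rule expect_cong) (use f(1) finF in \<open>simp add: of_bool_def if_distrib cong: if_cong\<close>)
    then show ?thesis by (simp add: expect_sum expect_cmult r_def)
  qed
  have r_total: "(\<Sum>C\<in>F. r C) = 1" using split[of "\<lambda>_. 1"] by simp
  have fE: "E (\<lambda>B. meet q \<alpha> (f B)) \<le> 1 / s"
    using expect_mono[of "\<lambda>B. meet q \<alpha> (f B)" "meet q \<alpha>"] f(3) clash_le by (simp add: clash_def)
  have "(\<Sum>C\<in>F. (r C)\<^sup>2) \<le> (\<Sum>C\<in>F. meet q \<alpha> C * r C)"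
  proof (rule sum_mono)
    fix C
    have "0 \<le> r C" unfolding r_def by (rule expect_nonneg) auto
    then show "(r C)\<^sup>2 \<le> meet q \<alpha> C * r C"
      using r_le[of C] by (simp add: power2_eq_square mult_right_mono)
  qed
  also have "\<dots> \<le> 1 / s" using fE split by simp
  finally have sq: "(\<Sum>C\<in>F. (r C)\<^sup>2) \<le> 1 / s" .
  have "(\<Sum>C\<in>F. (r C - 1 / s)\<^sup>2) = (\<Sum>C\<in>F. (r C)\<^sup>2) - 2 / s * (\<Sum>C\<in>F. r C) + card F * (1 / s)\<^sup>2"
  proof -
    have *: "(r C - 1 / s)\<^sup>2 = (r C)\<^sup>2 - 2 / s * r C + (1 / s)\<^sup>2" for C
      by (simp add: power2_diff)
    show ?thesis unfolding * by (simp only: sum.distrib sum_subtractf sum_constant flip: sum_distrib_left)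
  qed
  also have "\<dots> \<le> 1 / s - 2 / s + s * (1 / s)\<^sup>2"
    using sq small by (intro add_mono mult_right_mono) (auto simp: r_total)
  also have "\<dots> = 0" using s_pos by (simp add: power2_eq_square)
  finally have zero: "(\<Sum>C\<in>F. (r C - 1 / s)\<^sup>2) \<le> 0" .
  have "(r C - 1 / s)\<^sup>2 \<le> 0" if "C \<in> F" for C
    using order_trans[OF member_le_sum[OF that, of "\<lambda>C. (r C - 1 / s)\<^sup>2"] zero] finF by simp
  then have r_eq: "r C = 1 / s" if "C \<in> F" for C using that by simp
  show ?thesis
  proof (rule expect_eq_const[OF _ _ \<open>A \<in> supp\<close>])
    show "1 / s \<le> meet q \<alpha> B" if "B \<in> supp" for B
      using f(3)[OF that] r_le[of "f B"] r_eq[OF f(1)[OF that]] by simp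
    show "E (meet q \<alpha>) \<le> 1 / s" using clash_le by (simp add: clash_def)
  qed
qed

lemma meet_const_if_usage_const:
  assumes "\<And>i. i < q \<Longrightarrow> usage q \<alpha> i = 1 / s" "A \<in> supp"
  shows "meet q \<alpha> A = 1 / s"
proof (rule expect_eq_const[OF _ _ assms(2)])
  fix B assume "B \<in> supp"
  then obtain i where "i \<in> B" "i < q" using suppD(1,2) by blast
  then show "1 / s \<le> meet q \<alpha> B" using usage_le_meet assms(1) by metis
qed (use clash_le in \<open>simp add: clash_def\<close>)

text \<open>This covers the case in which there is no Lagrange multiplier. The estimate
  \<open>card (A \<inter> B) \<le> x\<close> for intersecting sets bounds the variance of the usage of the colors by \<open>0\<close>.\<close>

lemma meet_const_if_size_const:
  assumes size: "\<And>A. A \<in> supp \<Longrightarrow> card A = x" and "A \<in> supp"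
  shows "meet q \<alpha> A = 1 / s"
proof (rule meet_const_if_usage_const[OF _ assms(2)])
  have mean: "E (\<lambda>A. card A) = x"
    using expect_cong[of "\<lambda>A. real (card A)" "\<lambda>_. real x"] size by simp
  have "(\<Sum>i<q. (usage q \<alpha> i)\<^sup>2) = (\<Sum>i<q. E (\<lambda>A. usage q \<alpha> i * of_bool (i \<in> A)))"
    unfolding expect_cmult by (simp add: usage_def power2_eq_square)
  also have "\<dots> = E (\<lambda>A. \<Sum>i<q. usage q \<alpha> i * of_bool (i \<in> A))"
    by (rule expect_sum[symmetric])
  also have "\<dots> \<le> E (\<lambda>A. x * meet q \<alpha> A)"
  proof (rule expect_mono)
    fix A assume A: "A \<in> supp"
    have "(\<Sum>i<q. usage q \<alpha> i * of_bool (i \<in> A)) = (\<Sum>i\<in>A. usage q \<alpha> i)"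
      using suppD(1)[OF A] by (intro sum.mono_neutral_cong_right) auto
    also have "\<dots> \<le> (\<Sum>i\<in>A. meet q \<alpha> A)" by (intro sum_mono usage_le_meet)
    finally show "(\<Sum>i<q. usage q \<alpha> i * of_bool (i \<in> A)) \<le> x * meet q \<alpha> A" using size[OF A] by simp
  qed
  also have "\<dots> \<le> x * (1 / s)"
    unfolding expect_cmult using clash_le by (intro mult_left_mono) (auto simp: clash_def)
  finally have sq: "(\<Sum>i<q. (usage q \<alpha> i)\<^sup>2) \<le> x / s" by simp
  have "(\<Sum>i<q. (usage q \<alpha> i - 1 / s)\<^sup>2)
      = (\<Sum>i<q. (usage q \<alpha> i)\<^sup>2) - 2 / s * (\<Sum>i<q. usage q \<alpha> i) + q * (1 / s)\<^sup>2"
  proof -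
    have *: "(usage q \<alpha> i - 1 / s)\<^sup>2 = (usage q \<alpha> i)\<^sup>2 - 2 / s * usage q \<alpha> i + (1 / s)\<^sup>2" for i
      by (simp add: power2_diff)
    show ?thesis unfolding * sum.distrib sum_subtractf sum_distrib_left by simp
  qed
  also have "\<dots> \<le> x / s - 2 / s * x + q * (1 / s)\<^sup>2"
    using sq mean by (simp add: sum_usage_all)
  also have "\<dots> = (q / s - x) * (1 / s)" by (simp add: algebra_simps power2_eq_square)
  also have "\<dots> \<le> 0" using mean_size mean by (intro mult_nonpos_nonneg) auto
  finally have zero: "(\<Sum>i<q. (usage q \<alpha> i - 1 / s)\<^sup>2) \<le> 0" .
  fix i assume "i < q"
  then have "(usage q \<alpha> i - 1 / s)\<^sup>2 \<le> 0"
    using order_trans[OF member_le_sum[of i "{..<q}" "\<lambda>i. (usage q \<alpha> i - 1 / s)\<^sup>2"] zero] by simp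
  then show "usage q \<alpha> i = 1 / s" by simp
qed

text \<open>The multiplier \<open>\<mu> = 0\<close> belongs to the first alternative: then \<open>meet\<close> is constant on the support,
  no color is used more often than that constant, and the mean size forces it to be \<open>1 / s\<close>.\<close>

lemma uniform_or_large_kernel:
  obtains "uniform_partition s q \<alpha>"
  | \<mu> F where "0 < \<mu>" "\<And>A. A \<in> supp \<Longrightarrow> meet q \<alpha> A = clash q \<alpha> + \<mu> * (ln (card A) - log_size q \<alpha>)"
    "F \<subseteq> supp" "disjoint F" "\<And>B. B \<in> supp \<Longrightarrow> \<exists>A\<in>F. A \<inter> B \<noteq> {}" "s < card F"
proof (cases "\<forall>A\<in>supp. meet q \<alpha> A = 1 / s")
  case True
  then show thesis using that(1) uniform_if_meet_const by blast
next
  case nonconst: False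
  have "{} \<notin> supp" using suppD(2) by blast
  from disjoint_kernel[OF finite_supp this, of "meet q \<alpha>"] obtain F where F: "F \<subseteq> supp" "disjoint F"
    "\<And>B. B \<in> supp \<Longrightarrow> \<exists>A\<in>F. A \<inter> B \<noteq> {} \<and> meet q \<alpha> A \<le> meet q \<alpha> B" by metis
  have card: "s < card F" using nonconst meet_const_if_small_kernel[OF F(1,2) _ F(3)] by force
  have "\<exists>A\<in>supp. \<exists>B\<in>supp. ln (card B) < ln (card A)"
  proof (rule ccontr)
    assume *: "\<not> ?thesis"
    obtain A0 where "A0 \<in> supp" using nonconst by blast
    have "card A = card A0" if "A \<in> supp" for A
    proof -
      have "ln (card A) = ln (card A0)" using * that \<open>A0 \<in> supp\<close> by (auto simp: not_less intro!: antisym)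
      then show ?thesis
        using suppD(4)[OF that] suppD(4)[OF \<open>A0 \<in> supp\<close>] by simp
    qed
    then show False using nonconst meet_const_if_size_const by blast
  qed
  then obtain \<mu> where \<mu>: "0 \<le> \<mu>"
      "\<And>A. A \<in> supp \<Longrightarrow> meet q \<alpha> A = clash q \<alpha> + \<mu> * (ln (card A) - log_size q \<alpha>)"
    using meet_affine_in_log_size by metis
  have "\<mu> \<noteq> 0"
  proof
    assume "\<mu> = 0"
    then have meet: "meet q \<alpha> A = clash q \<alpha>" if "A \<in> supp" for A using \<mu> that by simp
    have le: "usage q \<alpha> i \<le> clash q \<alpha>" for i
    proof (cases "\<exists>A\<in>supp. i \<in> A")
      case True
      then show ?thesis using usage_le_meet meet by metis
    next
      case False
      moreover have "0 \<le> clash q \<alpha>" unfolding clash_def meet_def by (intro expect_nonneg) auto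
      ultimately show ?thesis using usage_pos_iff[of i] by (simp add: not_less)
    qed
    have "real q * (1 / s) \<le> real q * clash q \<alpha>"
      using mean_size sum_mono[of "{..<q}" "usage q \<alpha>" "\<lambda>_. clash q \<alpha>", OF le]
      by (simp add: sum_usage_all)
    then have "1 / s \<le> clash q \<alpha>" using q_pos by (subst (asm) mult_le_cancel_left_pos) auto
    then have "clash q \<alpha> = 1 / s" using clash_le by simp
    then show False using nonconst meet by simp
  qed
  then have "0 < \<mu>" using \<mu>(1) by simp
  moreover have "\<exists>A\<in>F. A \<inter> B \<noteq> {}" if "B \<in> supp" for B using F(3)[OF that] by blast
  ultimately show thesis using that(2)[OF _ \<mu>(2) F(1,2) _ card] by blast
qed

end

section \<open>Numerical estimates\<close>

text \<open>Quantitative concavity of the logarithm: \<open>x - 1 - ln x\<close> controls the square of \<open>x - 1\<close>.\<close>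

lemma log_excess_ge:
  fixes x :: real assumes "0 < x"
  shows "x \<le> 1 \<Longrightarrow> (x - 1)\<^sup>2 \<le> 2 * (x - 1 - ln x)"
    and "1 \<le> x \<Longrightarrow> (x - 1)\<^sup>2 \<le> 2 * x * (x - 1 - ln x)"
proof -
  let ?g = "\<lambda>y::real. y - 1 - ln y - (y - 1)\<^sup>2 / 2"
  assume "x \<le> 1"
  have "?g 1 \<le> ?g x"
  proof (rule DERIV_nonpos_imp_nonincreasing[OF \<open>x \<le> 1\<close>])
    fix y :: real assume "x \<le> y" "y \<le> 1"
    then have "y > 0" using assms by simp
    have "(?g has_real_derivative - (y - 1)\<^sup>2 / y) (at y)"
      using \<open>y > 0\<close> by (auto intro!: derivative_eq_intros simp: field_simps power2_eq_square)
    then show "\<exists>d. (?g has_real_derivative d) (at y) \<and> d \<le> 0"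
      using \<open>y > 0\<close> by (intro exI conjI) auto
  qed
  then show "(x - 1)\<^sup>2 \<le> 2 * (x - 1 - ln x)" by simp
next
  let ?h = "\<lambda>y::real. (y - 1 / y) / 2 - ln y"
  assume "1 \<le> x"
  have "?h 1 \<le> ?h x"
  proof (rule DERIV_nonneg_imp_nondecreasing[OF \<open>1 \<le> x\<close>])
    fix y :: real assume "1 \<le> y"
    have "(?h has_real_derivative (1 - 1 / y)\<^sup>2 / 2) (at y)"
      using \<open>1 \<le> y\<close> by (auto intro!: derivative_eq_intros simp: field_simps power2_eq_square)
    then show "\<exists>d. (?h has_real_derivative d) (at y) \<and> 0 \<le> d"
      by (intro exI conjI) auto
  qed
  then have "2 * x * ln x \<le> 2 * x * ((x - 1 / x) / 2)" using assms by (intro mult_left_mono) auto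
  also have "\<dots> = x\<^sup>2 - 1" using assms by (simp add: field_simps power2_eq_square)
  finally show "(x - 1)\<^sup>2 \<le> 2 * x * (x - 1 - ln x)" by (simp add: power2_eq_square algebra_simps)
qed

lemma log_excess_nonneg: fixes x :: real shows "0 < x \<Longrightarrow> 0 \<le> x - 1 - ln x"
  using ln_le_minus_one[of x] by simp

lemma log_excess_ge_6: fixes x :: real assumes "0 < x" "x \<le> 6"
  shows "(x - 1)\<^sup>2 \<le> 12 * (x - 1 - ln x)"
proof -
  define e where "e = x - 1 - ln x"
  have e: "0 \<le> e" using log_excess_nonneg assms by (simp add: e_def)
  have "(x - 1)\<^sup>2 \<le> 12 * e"
  proof (cases "x \<le> 1")
    case True
    then have "(x - 1)\<^sup>2 \<le> 2 * e" using log_excess_ge(1)[OF assms(1)] by (simp add: e_def)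
    then show ?thesis using e by linarith
  next
    case False
    have "2 * x * e \<le> 12 * e" using assms e by (intro mult_right_mono) auto
    moreover have "(x - 1)\<^sup>2 \<le> 2 * x * e" using log_excess_ge(2)[OF assms(1)] False by (simp add: e_def)
    ultimately show ?thesis by linarith
  qed
  then show ?thesis by (simp add: e_def)
qed

text \<open>With \<open>x = sqrt (card A / M)\<close>, the left-hand side is \<open>(card A / M) * ln (card A / M)\<close>. The right-hand
  side has a small expectation.\<close>

lemma square_log_bound: fixes x :: real assumes "0 < x" "x \<le> 6"
  shows "x\<^sup>2 * (2 * ln x) \<le> 2 * (x - 1) + 96 * (x - 1 - ln x)"
proof -
  define e where "e = x - 1 - ln x"
  have e: "0 \<le> e" using log_excess_nonneg assms by (simp add: e_def)
  have "x\<^sup>2 * (2 * ln x) = 2 * (x - 1) + 2 * (x + 1) * (x - 1)\<^sup>2 - 2 * x\<^sup>2 * e"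
    by (simp add: e_def power2_eq_square algebra_simps)
  moreover have "2 * (x + 1) * (x - 1)\<^sup>2 - 2 * x\<^sup>2 * e \<le> 96 * e"
  proof (cases "x \<le> 1")
    case True
    have "2 * (x + 1) * (x - 1)\<^sup>2 \<le> 2 * 2 * (2 * e)"
      using True assms e log_excess_ge(1)[OF assms(1)] by (intro mult_mono) (auto simp: e_def)
    moreover have "0 \<le> 2 * x\<^sup>2 * e" using e by simp
    ultimately show ?thesis using e by linarith
  next
    case False
    have "2 * (x + 1) * (x - 1)\<^sup>2 \<le> 2 * (x + 1) * (2 * x * e)"
      using False log_excess_ge(2)[OF assms(1)] by (intro mult_left_mono) (auto simp: e_def)
    then have "2 * (x + 1) * (x - 1)\<^sup>2 - 2 * x\<^sup>2 * e \<le> (2 * (x * x) + 4 * x) * e"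
      by (simp add: power2_eq_square algebra_simps)
    also have "\<dots> \<le> (2 * (6 * 6) + 4 * 6) * e"
      using False assms e by (intro mult_right_mono add_mono mult_left_mono mult_mono) auto
    finally show ?thesis by simp
  qed
  ultimately show ?thesis by (simp add: e_def)
qed

lemma log_weighted_square_below_1: fixes x :: real assumes "0 < x" "x \<le> 1"
  shows "(2 * x * ln x)\<^sup>2 \<le> 8 * (x - 1 - ln x)"
proof -
  have "ln (1 / x) \<le> 1 / x - 1" using assms by (intro ln_le_minus_one) auto
  then have "- (x * ln x) \<le> 1 - x" using assms by (simp add: ln_div field_simps)
  moreover have "0 \<le> - (x * ln x)" using assms by (simp add: mult_nonneg_nonpos)
  ultimately have "(- (x * ln x))\<^sup>2 \<le> (1 - x)\<^sup>2" by (intro power_mono) auto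
  then show ?thesis using log_excess_ge(1)[OF assms]
    by (simp add: power_mult_distrib power2_commute[of 1])
qed

lemma log_weighted_square_above_1: fixes x :: real assumes "1 \<le> x" "x \<le> 6"
  shows "(2 * x * ln x)\<^sup>2 \<le> 1728 * (x - 1 - ln x)"
proof -
  have "2 * x * ln x \<le> 2 * 6 * (x - 1)" using assms by (intro mult_mono ln_le_minus_one) auto
  then have "(2 * x * ln x)\<^sup>2 \<le> (2 * 6 * (x - 1))\<^sup>2" using assms by (intro power_mono) auto
  also have "\<dots> = 144 * (x - 1)\<^sup>2" by (simp add: power2_eq_square algebra_simps)
  finally show ?thesis using log_excess_ge_6[of x] assms by simp
qed

lemma ln_le_affine: fixes x :: real shows "0 < x \<Longrightarrow> ln x \<le> 1 + 4 / 25 * x"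
proof -
  assume "0 < x"
  have "(5/2 :: real)\<^sup>2 \<le> (exp 1)\<^sup>2"
    using exp_lower_Taylor_quadratic[of 1] by (intro power_mono) auto
  then have "25/4 \<le> exp (2::real)" by (simp add: power2_eq_square flip: exp_add)
  then have "ln (25/4) \<le> (2::real)" using ln_mono[of "25/4" "exp (2::real)"] by simp
  moreover have "ln (x / (25/4)) \<le> x / (25/4) - 1" using \<open>0 < x\<close> by (intro ln_le_minus_one) auto
  moreover have "ln (x / (25/4)) = ln x - ln (25/4)" using \<open>0 < x\<close> by (simp add: ln_div ln_mult)
  ultimately show ?thesis by simp
qed

text \<open>The loss by rounding \<open>q / s\<close> to integers: if \<open>t\<close> is the fractional part of \<open>M = q / s\<close> and \<open>a\<close> its
  integral part, then it is at most \<open>t * (1 - t) / (a * (a + 1))\<close>.\<close>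

lemma turan_value_ge:
  assumes "0 < s" "real q / s \<ge> 4"
  shows "ln (real q / s) - 1 / (3 * (real q / s)\<^sup>2) \<le> turan_value s q"
proof -
  define M where "M = real q / s"
  define a where "a = real (q div s)"
  define t where "t = M - a"
  have "s * (q div s) \<le> q" "q < s * (q div s + 1)" using assms(1) dividend_less_times_div[of s q] by auto
  then have "real (s * (q div s)) \<le> q" "real q < real (s * (q div s + 1))"
    by (simp_all only: of_nat_le_iff of_nat_less_iff)
  then have a: "a \<le> M" "M < a + 1" using assms(1) by (auto simp: M_def a_def field_simps)
  have M: "M \<ge> 4" using assms by (simp add: M_def)
  then have "a > 0" using a by simp
  have t: "0 \<le> t" "t \<le> 1" using a by (auto simp: t_def)
  have "ln (M / a) \<le> M / a - 1" "ln (M / (a + 1)) \<le> M / (a + 1) - 1"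
    using \<open>a > 0\<close> M by (intro ln_le_minus_one; simp)+
  then have "(1 - t) * ln (M / a) \<le> (1 - t) * (t / a)" "t * ln (M / (a + 1)) \<le> t * (- (1 - t) / (a + 1))"
    using \<open>a > 0\<close> t by (intro mult_left_mono; simp add: t_def field_simps)+
  moreover have "ln M = (1 - t) * (ln a + ln (M / a)) + t * (ln (a + 1) + ln (M / (a + 1)))"
    using \<open>a > 0\<close> M by (simp add: ln_div algebra_simps)
  moreover have "(1 - t) * (ln a + ln (M / a)) + t * (ln (a + 1) + ln (M / (a + 1)))
      = ln a + t * (ln (a + 1) - ln a) + ((1 - t) * ln (M / a) + t * ln (M / (a + 1)))"
    by (simp only: algebra_simps)
  ultimately have "ln M \<le> ln a + t * (ln (a + 1) - ln a) + ((1 - t) * (t / a) + t * (- (1 - t) / (a + 1)))"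
    by linarith
  also have "(1 - t) * (t / a) + t * (- (1 - t) / (a + 1)) = t * (1 - t) / (a * (a + 1))"
    using \<open>a > 0\<close> by (simp add: field_simps)
  also have "\<dots> \<le> (1 / 4) / (3 / 4 * M\<^sup>2)"
  proof (rule frac_le)
    have "(M - 1) * M \<le> a * (a + 1)" using a M by (intro mult_mono) auto
    moreover have "3 / 4 * M\<^sup>2 \<le> (M - 1) * M" using mult_right_mono[OF M, of M] M unfolding power2_eq_square left_diff_distrib by linarith
    ultimately show "3 / 4 * M\<^sup>2 \<le> a * (a + 1)" by linarith
    have "0 \<le> (t - 1/2)\<^sup>2" by simp
    then show "t * (1 - t) \<le> 1 / 4" by (simp add: power2_eq_square algebra_simps)
  qed (use M in auto)
  finally show ?thesis
    unfolding turan_value_def Let_def by (simp add: a_def t_def M_def)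
qed

section \<open>A kernel with more than s sets\<close>

text \<open>This locale collects the second alternative of \<open>uniform_or_large_kernel\<close>. It is contradictory
  for the range of \<open>s\<close> and \<open>q\<close> in question.\<close>

locale large_kernel = optimal_distr +
  fixes \<mu> :: real and F :: "nat set set"
  assumes mu_pos: "0 < \<mu>"
    and meet_eq: "\<And>A. A \<in> supp \<Longrightarrow> meet q \<alpha> A = clash q \<alpha> + \<mu> * (ln (card A) - log_size q \<alpha>)"
    and F_supp: "F \<subseteq> supp" and F_disjoint: "disjoint F"
    and F_kernel: "\<And>B. B \<in> supp \<Longrightarrow> \<exists>A\<in>F. A \<inter> B \<noteq> {}"
    and F_card: "s < card F"
    and s_small: "1000000 * (s * sqrt s) \<le> (q / s)\<^sup>2"
    and q_large: "50 * s \<le> (q / s) * ln (q / s)"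
begin

definition M where "M = real q / real s"
text \<open>An upper bound for the rounding loss \<open>ln M - turan_value s q\<close>.\<close>
definition d where "d = 1 / (3 * M\<^sup>2)"
text \<open>Sizes are measured on this scale because the mean of \<open>X\<close> is at most \<open>1\<close>.\<close>
definition X where "X A = sqrt (card A / M)" for A :: "nat set"
definition excess where "excess A = X A - 1 - ln (X A)" for A

lemma s_ge_1: "1 \<le> real s" using s_pos by simp

lemma M_gt: "1000 \<le> M"
proof -
  have "1 * 1 \<le> s * sqrt s" using s_ge_1 by (intro mult_mono) auto
  then have "1000\<^sup>2 \<le> M\<^sup>2" using s_small by (simp add: M_def)
  then show ?thesis by (rule power2_le_imp_le) (simp add: M_def)
qed

lemma q_eq: "real q = s * M" using s_pos by (simp add: M_def)

lemma finite_F: "finite F" using F_supp finite_subset finite_supp by blast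

lemma d_bounds: "0 < d" "d \<le> 1 / 1000" "d * s \<le> 1 / 1000000" "d * M \<le> 1 / 3000"
proof -
  have M: "0 < M" using M_gt by simp
  show "0 < d" using M by (simp add: d_def)
  have dMM: "d * M\<^sup>2 = 1 / 3" using M by (simp add: d_def)
  have "d * M * 1000 \<le> d * M * M" using M_gt \<open>0 < d\<close> by (intro mult_left_mono) auto
  then show dM: "d * M \<le> 1 / 3000" using dMM by (simp add: power2_eq_square)
  have "d * 1 \<le> d * M" using M_gt \<open>0 < d\<close> by (intro mult_left_mono) auto
  then show "d \<le> 1 / 1000" using dM by simp
  have "1000000 * (real s * 1) \<le> 1000000 * (s * sqrt s)" using s_ge_1 by (intro mult_left_mono) auto
  also have "\<dots> \<le> M\<^sup>2" using s_small by (simp add: M_def)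
  finally have "d * (1000000 * s) \<le> d * M\<^sup>2" using \<open>0 < d\<close> by (intro mult_left_mono) auto
  then show "d * s \<le> 1 / 1000000" using dMM by simp
qed

lemma log_size_ge: "ln M - d \<le> log_size q \<alpha>"
  using turan_value_ge[OF s_pos, of q] value_ge M_gt by (simp add: M_def d_def)

lemma X_facts: assumes "A \<in> supp"
  shows "0 < X A" "real (card A) = M * (X A)\<^sup>2" "sqrt (card A) = sqrt M * X A"
    "ln (card A) = ln M + 2 * ln (X A)" "0 \<le> excess A"
proof -
  have c: "0 < real (card A)" using suppD(4)[OF assms] by simp
  have M: "0 < M" using M_gt by simp
  show X: "0 < X A" using c M by (simp add: X_def)
  show eq: "real (card A) = M * (X A)\<^sup>2" using c M by (simp add: X_def)
  show "sqrt (card A) = sqrt M * X A" using c M by (simp add: X_def flip: real_sqrt_mult)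
  show "ln (card A) = ln M + 2 * ln (X A)"
    unfolding eq using X M by (simp add: ln_mult ln_realpow power2_eq_square)
  show "0 \<le> excess A" unfolding excess_def by (rule log_excess_nonneg[OF X])
qed

lemma sum_flat_X: "(\<Sum>i<q. flat i) = sqrt M * E X"
  unfolding sum_flat_all expect_cmult[symmetric] by (rule expect_cong) (rule X_facts(3))

text \<open>By the Cauchy-Schwarz inequality for \<open>flat\<close>, the mean of \<open>X\<close> is at most \<open>1\<close>. On the other hand the mean
  of \<open>ln X\<close> is at least \<open>- d / 2\<close>. Hence all the slack in these estimates is of order \<open>d\<close>.\<close>

lemma mean_X: "E X \<le> 1" "1 - d / 2 \<le> E X" "0 \<le> E X"
  and mean_excess: "E excess \<le> d / 2"
  and flat_variance: "(\<Sum>i<q. (flat i - E X * sqrt M / q)\<^sup>2) \<le> d / s"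
proof -
  have M: "0 < M" using M_gt by simp
  have sq: "(\<Sum>i<q. (flat i)\<^sup>2) \<le> 1 / s" using sum_flat_sq clash_le by linarith
  define x where "x = E X"
  show x0: "0 \<le> E X" by (rule expect_nonneg) (use X_facts(1) in force)
  have var: "(\<Sum>i<q. (flat i - x * sqrt M / q)\<^sup>2) = (\<Sum>i<q. (flat i)\<^sup>2) - x\<^sup>2 / s"
  proof -
    have *: "(flat i - x * sqrt M / q)\<^sup>2 = (flat i)\<^sup>2 - 2 * (x * sqrt M / q) * flat i + (x * sqrt M / q)\<^sup>2" for i
      by (simp add: power2_diff)
    have "(\<Sum>i<q. (flat i - x * sqrt M / q)\<^sup>2)
      = (\<Sum>i<q. (flat i)\<^sup>2) - 2 * (x * sqrt M / q) * (\<Sum>i<q. flat i) + q * (x * sqrt M / q)\<^sup>2"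
      unfolding * sum.distrib sum_subtractf sum_distrib_left by simp
    also have "\<dots> = (\<Sum>i<q. (flat i)\<^sup>2) - x\<^sup>2 * (sqrt M * sqrt M) / q"
    proof -
      have "2 * (x * sqrt M / q) * (sqrt M * x) = 2 * (x\<^sup>2 * (sqrt M * sqrt M) / q)"
        by (simp add: power2_eq_square mult_ac)
      moreover have "q * (x * sqrt M / q)\<^sup>2 = x\<^sup>2 * (sqrt M * sqrt M) / q"
        using q_pos by (simp add: power2_eq_square mult_ac)
      ultimately show ?thesis unfolding sum_flat_X x_def[symmetric] by linarith
    qed
    also have "sqrt M * sqrt M = M" using M by simp
    also have "x\<^sup>2 * M / q = x\<^sup>2 / s" using M s_pos by (simp add: q_eq)
    finally show ?thesis .
  qed
  have "0 \<le> (\<Sum>i<q. (flat i - x * sqrt M / q)\<^sup>2)" by (intro sum_nonneg) auto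
  then have "x\<^sup>2 / s \<le> 1 / s" using var sq by linarith
  then have "x\<^sup>2 \<le> 1" using s_pos by (simp add: divide_le_cancel)
  then show le1: "E X \<le> 1" by (simp add: power2_le_imp_le[of _ 1] x_def power_le_one_iff abs_square_le_1)
  have "log_size q \<alpha> = ln M + 2 * E (\<lambda>A. ln (X A))"
  proof -
    have "log_size q \<alpha> = E (\<lambda>A. ln M + 2 * ln (X A))"
      unfolding log_size_def by (rule expect_cong) (rule X_facts(4))
    then show ?thesis by (simp add: expect_add expect_cmult)
  qed
  then have ln_ge: "- (d / 2) \<le> E (\<lambda>A. ln (X A))" using log_size_ge by linarith
  have ex: "E excess = E X - 1 - E (\<lambda>A. ln (X A))"
    by (simp add: excess_def[abs_def] expect_diff)
  then show "E excess \<le> d / 2" using ln_ge le1 by linarith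
  have "0 \<le> E excess" by (rule expect_nonneg) (rule X_facts(5))
  then show ge: "1 - d / 2 \<le> E X" using ex ln_ge by linarith
  have "1 - x\<^sup>2 = (1 + x) * (1 - x)" by (simp add: power2_eq_square algebra_simps)
  also have "\<dots> \<le> 2 * (d / 2)" using ge le1 x0 by (intro mult_mono) (auto simp: x_def)
  finally have "(1 - x\<^sup>2) / s \<le> d / s" using s_pos by (intro divide_right_mono) auto
  then show "(\<Sum>i<q. (flat i - E X * sqrt M / q)\<^sup>2) \<le> d / s"
    using var sq unfolding x_def by (simp add: diff_divide_distrib)
qed

lemma meet_le: assumes "A \<in> supp" shows "meet q \<alpha> A \<le> 1 / s + \<mu> * (2 * ln (X A) + d)"
proof -
  have "\<mu> * (ln (card A) - log_size q \<alpha>) \<le> \<mu> * (2 * ln (X A) + d)"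
    using log_size_ge mu_pos X_facts(4)[OF assms] by (intro mult_left_mono) auto
  then show ?thesis using meet_eq[OF assms] clash_le by linarith
qed

lemma sum_card_F: "(\<Sum>A\<in>F. card A) \<le> q"
proof -
  have "(\<Sum>A\<in>F. card A) = card (\<Union>F)"
    using F_disjoint F_supp suppD(3) by (subst card_Union_disjoint) (auto simp: disjoint_def pairwise_def disjnt_def)
  also have "\<dots> \<le> card {..<q}" using F_supp suppD(1) by (intro card_mono) auto
  finally show ?thesis by simp
qed

text \<open>Every set meets some member of the kernel, so the values \<open>meet A\<close> for \<open>A\<close> in the kernel have sum at
  least \<open>1\<close>. By the Lagrange condition and the concavity of \<open>ln\<close> this sum is at most
  \<open>k / s - \<mu> * (k - s - k * d)\<close> for a kernel of \<open>k > s\<close> sets that share \<open>q\<close> colors.\<close>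

lemma mu_le: "\<mu> \<le> 5 / (4 * s)"
proof -
  define k where "k = real (card F)"
  have k: "real s + 1 \<le> k" using F_card by (simp add: k_def)
  then have k0: "0 < k" by simp
  have M: "0 < M" using M_gt by simp
  have "1 \<le> E (\<lambda>B. \<Sum>A\<in>F. of_bool (A \<inter> B \<noteq> {}))"
  proof -
    have "1 \<le> (\<Sum>A\<in>F. of_bool (A \<inter> B \<noteq> {}) :: real)" if B: "B \<in> supp" for B
    proof -
      obtain A where A: "A \<in> F" "A \<inter> B \<noteq> {}" using F_kernel[OF B] by blast
      have "of_bool (A \<inter> B \<noteq> {}) \<le> (\<Sum>A\<in>F. of_bool (A \<inter> B \<noteq> {}) :: real)"
        using A finite_F by (intro member_le_sum) auto
      then show ?thesis using A by simp
    qed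
    from expect_mono[of "\<lambda>_. 1", OF this] show ?thesis by simp
  qed
  also have "\<dots> = (\<Sum>A\<in>F. meet q \<alpha> A)" by (simp add: expect_sum meet_def)
  also have "\<dots> \<le> (\<Sum>A\<in>F. 1 / s + \<mu> * (2 * ln (X A) + d))"
    using F_supp by (intro sum_mono meet_le) auto
  also have "\<dots> = k / s + \<mu> * (\<Sum>A\<in>F. 2 * ln (X A) + d)"
    by (simp add: sum.distrib sum_distrib_left[symmetric] k_def)
  finally have 1: "1 \<le> k / s + \<mu> * (\<Sum>A\<in>F. 2 * ln (X A) + d)" .
  (* tangents of ln at 1, relative to the average size q / k *)
  have "(\<Sum>A\<in>F. 2 * ln (X A) + d) \<le> (\<Sum>A\<in>F. (s / k - 2 + d) + card A * (k / q))"
  proof (rule sum_mono)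
    fix A assume "A \<in> F"
    then have A: "A \<in> supp" using F_supp by auto
    have c: "0 < real (card A)" using suppD(4)[OF A] by simp
    have "2 * ln (X A) = ln (card A / M)" using X_facts(4)[OF A] c M by (simp add: ln_div)
    also have "\<dots> = ln (s / k) + ln (card A * k / q)"
      using c M k0 s_pos q_pos by (simp add: ln_div ln_mult M_def)
    also have "ln (s / k) \<le> s / k - 1" using k0 s_pos by (intro ln_le_minus_one) auto
    also have "ln (card A * k / q) \<le> card A * k / q - 1" using k0 c q_pos by (intro ln_le_minus_one) auto
    finally show "2 * ln (X A) + d \<le> (s / k - 2 + d) + card A * (k / q)" by simp
  qed
  also have "\<dots> = s - 2 * k + k * d + (\<Sum>A\<in>F. card A) * (k / q)"
    unfolding sum.distrib sum_constant of_nat_sum sum_distrib_right[symmetric] k_def[symmetric]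
    using k0 by (simp add: algebra_simps)
  also have "\<dots> \<le> s - 2 * k + k * d + q * (k / q)"
    using sum_card_F k0 by (intro add_left_mono mult_right_mono) (auto simp flip: of_nat_sum)
  also have "\<dots> = - (k - s - k * d)" using q_pos by simp
  finally have 2: "(\<Sum>A\<in>F. 2 * ln (X A) + d) \<le> - (k - s - k * d)" .
  have "k \<le> 2 * s * (k - s)"
  proof -
    have "1 * (k - s) + s * 1 \<le> s * (k - s) + s * (k - s)"
      using s_ge_1 k by (intro add_mono mult_right_mono mult_left_mono) auto
    then show ?thesis by simp
  qed
  then have "d * k \<le> d * (2 * s * (k - s))" using d_bounds by (intro mult_left_mono) auto
  also have "\<dots> = (d * s) * (2 * (k - s))" by simp
  also have "\<dots> \<le> 1 / 1000000 * (2 * (k - s))" using d_bounds k by (intro mult_right_mono) auto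
  finally have 3: "4 / 5 * (k - s) \<le> k - s - k * d" using k by (simp add: mult.commute)
  have "\<mu> * (4 / 5 * (k - s)) \<le> \<mu> * (k - s - k * d)" using 3 mu_pos by (intro mult_left_mono) auto
  also have "\<dots> \<le> - (\<mu> * (\<Sum>A\<in>F. 2 * ln (X A) + d))"
    using mult_left_mono[OF 2, of \<mu>] mu_pos unfolding mult_minus_right by linarith
  also have "\<dots> \<le> k / s - 1" using 1 by linarith
  also have "\<dots> = (k - s) * (1 / s)" using s_pos by (simp add: field_simps)
  finally have "(k - s) * (\<mu> * (4 / 5)) \<le> (k - s) * (1 / s)" by (simp add: mult_ac)
  then have "\<mu> * (4 / 5) \<le> 1 / s" using k by (subst (asm) mult_le_cancel_left_pos) auto
  then show ?thesis using s_pos by (simp add: field_simps)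
qed

text \<open>The vector \<open>flat\<close> is nearly constant, so that a set \<open>A\<close> is met with probability at least about
  \<open>X A / s\<close>. By the Lagrange condition this probability grows only like the logarithm of \<open>X A\<close>.\<close>

lemma X_le_6: assumes A: "A \<in> supp" shows "X A \<le> 6"
proof (rule ccontr)
  assume "\<not> X A \<le> 6"
  then have X: "6 < X A" by simp
  have M: "0 < M" using M_gt by simp
  have c: "0 < sqrt (card A)" using mult_sqrt_card(2)[OF A] .
  define u where "u = E X * sqrt M / q"
  have "(\<Sum>i\<in>A. u - flat i)\<^sup>2 \<le> (\<Sum>i\<in>A. 1\<^sup>2) * (\<Sum>i\<in>A. (u - flat i)\<^sup>2)"
    using Cauchy_Schwarz_ineq_sum[of "\<lambda>_. 1" "\<lambda>i. u - flat i" A] unfolding mult_1 .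
  also have "\<dots> \<le> card A * (\<Sum>i<q. (u - flat i)\<^sup>2)"
    using suppD(1)[OF A] by (auto intro!: mult_left_mono sum_mono2)
  also have "\<dots> \<le> card A * (d / s)"
    using flat_variance by (intro mult_left_mono) (auto simp: u_def power2_commute)
  finally have "(\<Sum>i\<in>A. u - flat i) \<le> sqrt (card A * (d / s))" by (rule real_le_rsqrt)
  then have "card A * u - sqrt (card A) * sqrt (d / s) \<le> (\<Sum>i\<in>A. flat i)"
    by (simp add: sum_subtractf flip: real_sqrt_mult)
  then have "(card A * u - sqrt (card A) * sqrt (d / s)) / sqrt (card A) \<le> (\<Sum>i\<in>A. flat i) / sqrt (card A)"
    using c by (intro divide_right_mono) auto
  also have "\<dots> \<le> meet q \<alpha> A" by (rule flat_le_meet[OF A])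
  also have "\<dots> \<le> 1 / s + \<mu> * (2 * ln (X A) + d)" by (rule meet_le[OF A])
  also have "\<dots> \<le> 1 / s + 5 / (4 * s) * (2 * (1 + 4 / 25 * X A) + d)"
  proof -
    have "0 \<le> ln (X A)" using X by simp
    then have p1: "0 \<le> 2 * ln (X A) + d" using d_bounds(1) by linarith
    have p2: "2 * ln (X A) + d \<le> 2 * (1 + 4 / 25 * X A) + d"
      using ln_le_affine[of "X A"] X by simp
    have "\<mu> * (2 * ln (X A) + d) \<le> 5 / (4 * s) * (2 * (1 + 4 / 25 * X A) + d)"
      by (intro mult_mono[OF mu_le] p1 p2) simp
    then show ?thesis by linarith
  qed
  also have "(card A * u - sqrt (card A) * sqrt (d / s)) / sqrt (card A) = sqrt (card A) * u - sqrt (d / s)"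
  proof -
    have "card A * u = sqrt (card A) * (sqrt (card A) * u)"
      by (simp flip: mult.assoc)
    then show ?thesis using c
      by (simp only: right_diff_distrib[symmetric] nonzero_mult_div_cancel_left less_imp_neq[THEN not_sym] not_False_eq_True)
  qed
  also have "sqrt (card A) * u = X A * E X / s"
  proof -
    have "sqrt (card A) * u = X A * E X * (sqrt M * sqrt M) / q"
      by (simp add: u_def X_facts(3)[OF A] mult_ac)
    then show ?thesis using M s_pos by (simp add: q_eq)
  qed
  finally have "s * (X A * E X / s - sqrt (d / s)) \<le> s * (1 / s + 5 / (4 * s) * (2 * (1 + 4 / 25 * X A) + d))"
    by (rule mult_left_mono) simp
  moreover have "s * sqrt (d / s) = sqrt (d * s)"
  proof -
    have "s * sqrt (d / s) = sqrt (real s * real s) * sqrt (d / s)" using s_pos by simp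
    also have "\<dots> = sqrt (d * s)" unfolding real_sqrt_mult[symmetric] using s_pos by (simp add: mult_ac)
    finally show ?thesis .
  qed
  moreover have "s * (1 / s + 5 / (4 * s) * y) = 1 + 5 / 4 * y" for y
    using s_pos by (simp add: distrib_left)
  moreover have "s * (X A * E X / s - sqrt (d / s)) = X A * E X - s * sqrt (d / s)"
    using s_pos by (simp add: right_diff_distrib)
  moreover have "1 + 5 / 4 * (2 * (1 + 4 / 25 * X A) + d) = 7 / 2 + 2 / 5 * X A + 5 / 4 * d"
    by (simp add: field_simps)
  ultimately have "X A * E X - sqrt (d * s) \<le> 7 / 2 + 2 / 5 * X A + 5 / 4 * d"
    by (simp only:)
  moreover have "sqrt (d * s) \<le> 1 / 1000"
  proof (rule real_le_lsqrt)
    show "d * s \<le> (1 / 1000)\<^sup>2" using d_bounds(3) by (simp add: power2_eq_square)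
  qed simp
  moreover have "X A * (999 / 1000) \<le> X A * E X"
    using X mean_X(2) d_bounds by (intro mult_left_mono) auto
  ultimately show False using X d_bounds(2) by linarith
qed

lemma usage_le_6: "usage q \<alpha> i \<le> 6 / s"
proof (cases "\<exists>A\<in>supp. i \<in> A")
  case True
  then obtain A where A: "A \<in> supp" "i \<in> A" by blast
  have X: "0 < X A" "X A \<le> 6" using X_facts(1) X_le_6 A by auto
  have "2 * ln (X A) + d \<le> 4" using ln_le_affine[OF X(1)] X(2) d_bounds by simp
  then have "\<mu> * (2 * ln (X A) + d) \<le> \<mu> * 4" using mu_pos by (intro mult_left_mono) auto
  also have "\<dots> \<le> 5 / (4 * s) * 4" using mu_le by (intro mult_right_mono) auto
  finally have "\<mu> * (2 * ln (X A) + d) \<le> 5 / s" by simp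
  then show ?thesis using usage_le_meet[OF A(2)] meet_le[OF A(1)] by (simp add: field_simps)
next
  case False
  then show ?thesis using usage_pos_iff[of i] by (simp add: not_less order.trans[of _ 0])
qed

lemma usage_le_2: assumes "A \<in> supp" "i \<in> A" "X A \<le> 1" shows "usage q \<alpha> i \<le> 2 / s"
proof -
  have "ln (X A) \<le> 0" using assms X_facts(1) by simp
  then have "2 * ln (X A) + d \<le> 4 / 5" using d_bounds by simp
  then have "\<mu> * (2 * ln (X A) + d) \<le> \<mu> * (4 / 5)" using mu_pos by (intro mult_left_mono) auto
  also have "\<dots> \<le> 5 / (4 * s) * (4 / 5)" using mu_le by (intro mult_right_mono) auto
  finally have "\<mu> * (2 * ln (X A) + d) \<le> 1 / s" by simp
  then show ?thesis using usage_le_meet[OF assms(2)] meet_le[OF assms(1)] by (simp add: field_simps)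
qed

end

section \<open>The kernel inequality\<close>

context large_kernel begin

text \<open>An upper bound for \<open>ln (card A) - log_size q \<alpha>\<close>.\<close>
definition surplus where "surplus A = 2 * ln (X A) + d" for A

lemma sum_Union_F: assumes "J \<subseteq> F" shows "(\<Sum>i\<in>\<Union>J. f i) = (\<Sum>A\<in>J. \<Sum>i\<in>A. f i)"
proof -
  have "A \<inter> B = {}" if "A \<in> J" "B \<in> J" "A \<noteq> B" for A B
    using that assms F_disjoint unfolding disjoint_def by blast
  moreover have "finite A" if "A \<in> J" for A using that assms F_supp suppD(3) by blast
  ultimately have "sum f (\<Union>J) = (sum \<circ> sum) f J" by (intro sum.Union_disjoint) auto
  then show ?thesis by simp
qed

lemma card_Union_F: assumes "J \<subseteq> F" shows "card (\<Union>J) = (\<Sum>A\<in>J. card A)"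
  using sum_Union_F[OF assms, of "\<lambda>_. 1 :: nat"] by simp

lemma Union_F_subset: assumes "J \<subseteq> F" shows "\<Union>J \<subseteq> {..<q}"
  using assms F_supp suppD(1) by blast

text \<open>Let \<open>\<Delta> i\<close> be the amount by which the usage of the color \<open>i\<close> exceeds \<open>1 / s\<close>. The sum of all \<open>\<Delta> i\<close> is
  nonnegative, and \<open>\<Delta> i \<le> \<mu> * surplus A\<close> for every set \<open>A\<close> of the support that contains \<open>i\<close>. The colors
  in the union of \<open>J\<close> are compared with the member of \<open>J\<close> that contains them, and the others with
  random sets.\<close>

lemma kernel_inequality: assumes J: "J \<subseteq> F"
  shows "0 \<le> (\<Sum>A\<in>J. card A * surplus A) + s * E (\<lambda>B. card (B - \<Union>J) * surplus B)"
proof -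
  define U where "U = \<Union>J"
  define \<Delta> where "\<Delta> i = usage q \<alpha> i - 1 / s" for i
  have U: "U \<subseteq> {..<q}" using Union_F_subset[OF J] by (simp add: U_def)
  have \<Delta>: "\<Delta> i \<le> \<mu> * surplus A" if "A \<in> supp" "i \<in> A" for i A
    using usage_le_meet[OF that(2)] meet_le[OF that(1)] by (simp add: \<Delta>_def surplus_def)
  have "0 \<le> (\<Sum>i<q. \<Delta> i)" using mean_size by (simp add: \<Delta>_def sum_subtractf sum_usage_all)
  also have "\<dots> = (\<Sum>i\<in>U. \<Delta> i) + (\<Sum>i\<in>{..<q} - U. \<Delta> i)"
    using sum.subset_diff[OF U, of \<Delta>] by simp
  also have "(\<Sum>i\<in>U. \<Delta> i) \<le> (\<Sum>A\<in>J. card A * (\<mu> * surplus A))"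
    unfolding U_def sum_Union_F[OF J]
  proof (rule sum_mono)
    fix A assume "A \<in> J"
    then have "A \<in> supp" using J F_supp by auto
    from sum_mono[of A \<Delta> "\<lambda>_. \<mu> * surplus A", OF \<Delta>[OF this]]
    show "(\<Sum>i\<in>A. \<Delta> i) \<le> card A * (\<mu> * surplus A)" by simp
  qed
  also have "(\<Sum>i\<in>{..<q} - U. \<Delta> i) \<le> (\<Sum>i\<in>{..<q} - U. s * (\<Delta> i * usage q \<alpha> i))"
  proof (rule sum_mono)
    fix i
    (* replacing the weight 1 / s by the usage increases the sum, as both deviate in the same direction *)
    have "s * (\<Delta> i * usage q \<alpha> i) = \<Delta> i + s * (\<Delta> i)\<^sup>2"
      using s_pos by (simp add: \<Delta>_def power2_eq_square field_simps)
    then show "\<Delta> i \<le> s * (\<Delta> i * usage q \<alpha> i)" by simp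
  qed
  also have "\<dots> = s * E (\<lambda>B. \<Sum>i\<in>{..<q} - U. \<Delta> i * of_bool (i \<in> B))"
    unfolding expect_sum sum_distrib_left[symmetric] expect_cmult usage_def ..
  also have "\<dots> \<le> s * E (\<lambda>B. \<mu> * (card (B - U) * surplus B))"
  proof (intro mult_left_mono expect_mono)
    fix B assume B: "B \<in> supp"
    have "(\<Sum>i\<in>{..<q} - U. \<Delta> i * of_bool (i \<in> B)) = (\<Sum>i\<in>B - U. \<Delta> i)"
      using suppD(1)[OF B] by (intro sum.mono_neutral_cong_right) auto
    also have "\<dots> \<le> (\<Sum>i\<in>B - U. \<mu> * surplus B)" using \<Delta>[OF B] by (intro sum_mono) auto
    finally show "(\<Sum>i\<in>{..<q} - U. \<Delta> i * of_bool (i \<in> B)) \<le> \<mu> * (card (B - U) * surplus B)"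
      by (simp add: mult_ac)
  qed simp
  finally have "0 \<le> \<mu> * ((\<Sum>A\<in>J. card A * surplus A) + s * E (\<lambda>B. card (B - U) * surplus B))"
    by (simp add: expect_cmult sum_distrib_left algebra_simps)
  then show ?thesis using mu_pos by (simp add: zero_le_mult_iff U_def)
qed

lemma Md: "M * d = 1 / (3 * M)"
  using M_gt by (simp add: d_def power2_eq_square)

lemma mean_size_log: "E (\<lambda>B. card B * (2 * ln (X B))) \<le> 48 * M * d"
proof -
  have M: "0 \<le> M" using M_gt by simp
  have "E (\<lambda>B. card B * (2 * ln (X B))) \<le> E (\<lambda>B. M * (2 * (X B - 1) + 96 * excess B))"
  proof (rule expect_mono)
    fix B assume B: "B \<in> supp"
    have "(X B)\<^sup>2 * (2 * ln (X B)) \<le> 2 * (X B - 1) + 96 * excess B"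
      unfolding excess_def using square_log_bound X_facts(1) X_le_6 B by blast
    from mult_left_mono[OF this M] show "card B * (2 * ln (X B)) \<le> M * (2 * (X B - 1) + 96 * excess B)"
      unfolding X_facts(2)[OF B] by (simp add: mult_ac)
  qed
  also have "\<dots> = M * (2 * (E X - 1) + 96 * E excess)"
    by (simp only: expect_cmult expect_add expect_diff expect_const)
  also have "\<dots> \<le> M * (48 * d)"
    using mean_X(1) mean_excess M by (intro mult_left_mono; simp)
  finally show ?thesis by simp
qed

lemma mean_size_le: "E (\<lambda>B. card B) \<le> 2 * M"
proof -
  have M: "0 \<le> M" using M_gt by simp
  have "E (\<lambda>B. card B) \<le> E (\<lambda>B. M * (1 + 2 * (X B - 1) + 12 * excess B))"
  proof (rule expect_mono)
    fix B assume B: "B \<in> supp"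
    have "(X B - 1)\<^sup>2 \<le> 12 * excess B"
      unfolding excess_def using log_excess_ge_6 X_facts(1) X_le_6 B by blast
    then have "(X B)\<^sup>2 \<le> 1 + 2 * (X B - 1) + 12 * excess B"
      by (simp add: power2_eq_square algebra_simps)
    from mult_left_mono[OF this M] show "card B \<le> M * (1 + 2 * (X B - 1) + 12 * excess B)"
      unfolding X_facts(2)[OF B] .
  qed
  also have "\<dots> = M * (1 + 2 * (E X - 1) + 12 * E excess)"
    by (simp only: expect_cmult expect_add expect_diff expect_const)
  also have "\<dots> \<le> M * 2"
    using mean_X(1) mean_excess M d_bounds(2) by (intro mult_left_mono; simp)
  finally show ?thesis by simp
qed

lemma s_times_sqrt: fixes y :: real assumes "0 \<le> y" shows "s * sqrt (y / s) = sqrt (s * y)"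
proof -
  have "s * sqrt (y / s) = sqrt (real s * real s) * sqrt (y / s)" by simp
  also have "\<dots> = sqrt (s * y)" unfolding real_sqrt_mult[symmetric] using s_pos by simp
  finally show ?thesis .
qed

text \<open>All colors of \<open>B\<close> together contribute a term of order \<open>s * M * d\<close>, that is, of order \<open>s / M\<close>. The colors of the
  union of \<open>J\<close> have to be removed again. Only sets with \<open>X B < 1\<close> matter for this, and the
  Cauchy-Schwarz inequality separates the size of \<open>B \<inter> \<Union>J\<close> from the deviation of \<open>X B\<close> from \<open>1\<close>.\<close>

lemma rest_bound_small:
  assumes J: "J \<subseteq> F" and small: "\<And>A. A \<in> J \<Longrightarrow> X A \<le> 1"
  shows "s * E (\<lambda>B. card (B - \<Union>J) * surplus B) \<le> 17 * (s / M) + sqrt (3 * (s / M) * card (\<Union>J))"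
proof -
  define U where "U = \<Union>J"
  have M: "0 < M" using M_gt by simp
  have U: "U \<subseteq> {..<q}" using Union_F_subset[OF J] by (simp add: U_def)
  have "E (\<lambda>B. card (B - U) * surplus B)
      \<le> E (\<lambda>B. (card B * (2 * ln (X B)) + d * card B) + sqrt (card (B \<inter> U)) * sqrt (8 * M * excess B))"
  proof (rule expect_mono)
    fix B assume B: "B \<in> supp"
    note X = X_facts[OF B]
    have cB: "real (card (B - U)) = real (card B) - card (B \<inter> U)"
      using suppD(3)[OF B] card_Diff_subset_Int[of B U] card_mono[of B "B \<inter> U"] by (simp add: of_nat_diff)
    have "- (card (B \<inter> U) * (2 * ln (X B))) \<le> sqrt (card (B \<inter> U)) * sqrt (8 * M * excess B)"
    proof (cases "X B \<le> 1")
      case True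
      then have neg: "0 \<le> - (2 * ln (X B))" using X(1) by simp
      have "- (card (B \<inter> U) * (2 * ln (X B))) = sqrt (card (B \<inter> U)) * (sqrt (card (B \<inter> U)) * (- (2 * ln (X B))))"
        by (simp flip: mult.assoc)
      also have "\<dots> \<le> sqrt (card (B \<inter> U)) * (sqrt (card B) * (- (2 * ln (X B))))"
        using neg suppD(3)[OF B] by (intro mult_left_mono mult_right_mono) (auto intro: card_mono)
      also have "sqrt (card B) * (- (2 * ln (X B))) \<le> sqrt (8 * M * excess B)"
      proof (rule real_le_rsqrt)
        have "(sqrt (card B) * (- (2 * ln (X B))))\<^sup>2 = M * (2 * X B * ln (X B))\<^sup>2"
          using M by (simp add: X(3) power_mult_distrib)
        also have "\<dots> \<le> M * (8 * excess B)"
          using log_weighted_square_below_1[OF X(1) True] M by (intro mult_left_mono) (auto simp: excess_def)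
        finally show "(sqrt (card B) * (- (2 * ln (X B))))\<^sup>2 \<le> 8 * M * excess B" by simp
      qed
      finally show ?thesis by (simp add: mult_left_mono)
    next
      case False
      then have "0 \<le> card (B \<inter> U) * (2 * ln (X B))" by simp
      moreover have "0 \<le> sqrt (card (B \<inter> U)) * sqrt (8 * M * excess B)" using M X(5) by simp
      ultimately show ?thesis by linarith
    qed
    moreover have "d * card (B \<inter> U) \<ge> 0" using d_bounds by simp
    ultimately show "card (B - U) * surplus B
        \<le> (card B * (2 * ln (X B)) + d * card B) + sqrt (card (B \<inter> U)) * sqrt (8 * M * excess B)"
      unfolding cB surplus_def left_diff_distrib right_diff_distrib distrib_left mult.commute[of _ d] by linarith
  qed
  also have "\<dots> = (E (\<lambda>B. card B * (2 * ln (X B))) + d * E (\<lambda>B. card B))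
      + E (\<lambda>B. sqrt (card (B \<inter> U)) * sqrt (8 * M * excess B))"
    by (simp only: expect_add expect_cmult)
  also have "\<dots> \<le> (48 * M * d + d * (2 * M)) + sqrt (2 * card U / s) * sqrt (4 * M * d)"
  proof (intro add_mono mean_size_log mult_left_mono mean_size_le)
    have "E (\<lambda>B. sqrt (card (B \<inter> U)) * sqrt (8 * M * excess B))
        \<le> sqrt (E (\<lambda>B. card (B \<inter> U))) * sqrt (E (\<lambda>B. 8 * M * excess B))"
      using M X_facts(5) by (intro expect_CS) auto
    also have "\<dots> \<le> sqrt (2 * card U / s) * sqrt (4 * M * d)"
    proof (intro mult_mono real_sqrt_le_mono)
      have "E (\<lambda>B. card (B \<inter> U)) = (\<Sum>i\<in>U. usage q \<alpha> i)" by (simp add: sum_usage[OF U])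
      also have "\<dots> \<le> (\<Sum>i\<in>U. 2 / s)"
        using small J F_supp by (intro sum_mono) (auto simp: U_def intro!: usage_le_2)
      finally show "E (\<lambda>B. card (B \<inter> U)) \<le> 2 * card U / s" by (simp add: mult.commute)
      show "E (\<lambda>B. 8 * M * excess B) \<le> 4 * M * d"
        unfolding expect_cmult using mult_left_mono[OF mean_excess, of "8 * M"] M by simp
    qed (use M X_facts(5) in \<open>auto intro!: expect_nonneg\<close>)
    finally show "E (\<lambda>B. sqrt (card (B \<inter> U)) * sqrt (8 * M * excess B))
        \<le> sqrt (2 * card U / s) * sqrt (4 * M * d)" .
  qed (use d_bounds in auto)
  finally have "s * E (\<lambda>B. card (B - U) * surplus B)
      \<le> s * ((48 * M * d + d * (2 * M)) + sqrt (2 * card U / s) * sqrt (4 * M * d))"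
    by (rule mult_left_mono) simp
  also have "\<dots> = 50 * real s * (M * d) + s * sqrt (2 * card U / s) * sqrt (4 * (M * d))"
    by (simp add: algebra_simps)
  also have "\<dots> = 50 / 3 * (s / M) + sqrt (8 / 3 * (s / M) * card U)"
  proof -
    have "0 \<le> 2 * real (card U)" by simp
    from s_times_sqrt[OF this] show ?thesis
      unfolding Md by (simp add: mult_ac flip: real_sqrt_mult)
  qed
  also have "\<dots> \<le> 17 * (s / M) + sqrt (3 * (s / M) * card U)"
    using M by (intro add_mono mult_right_mono real_sqrt_le_mono) auto
  finally show ?thesis by (simp add: U_def)
qed

text \<open>This bound is good if \<open>J\<close> covers almost all colors. It uses the Cauchy-Schwarz inequality for the
  sets with \<open>X B > 1\<close>.\<close>

lemma rest_bound:
  assumes J: "J \<subseteq> F"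
  shows "s * E (\<lambda>B. card (B - \<Union>J) * surplus B) \<le> s / M + sqrt (1728 * (s / M) * (q - real (card (\<Union>J))))"
proof -
  define U where "U = \<Union>J"
  have M: "0 < M" using M_gt by simp
  have U: "U \<subseteq> {..<q}" using Union_F_subset[OF J] by (simp add: U_def)
  have cU: "real (card ({..<q} - U)) = q - real (card U)"
    using card_Diff_subset[of U "{..<q}"] U card_mono[OF _ U] finite_subset[OF U] by (simp add: of_nat_diff)
  have "E (\<lambda>B. card (B - U) * surplus B)
      \<le> E (\<lambda>B. d * card B + sqrt (card (B - U)) * sqrt (1728 * M * excess B))"
  proof (rule expect_mono)
    fix B assume B: "B \<in> supp"
    note X = X_facts[OF B]
    have le: "card (B - U) \<le> card B" using suppD(3)[OF B] by (intro card_mono) auto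
    have "card (B - U) * (2 * ln (X B)) \<le> sqrt (card (B - U)) * sqrt (1728 * M * excess B)"
    proof (cases "1 \<le> X B")
      case True
      then have pos: "0 \<le> 2 * ln (X B)" by simp
      have "card (B - U) * (2 * ln (X B)) = sqrt (card (B - U)) * (sqrt (card (B - U)) * (2 * ln (X B)))"
        by (simp flip: mult.assoc)
      also have "\<dots> \<le> sqrt (card (B - U)) * (sqrt (card B) * (2 * ln (X B)))"
        using pos le by (intro mult_left_mono mult_right_mono) auto
      also have "sqrt (card B) * (2 * ln (X B)) \<le> sqrt (1728 * M * excess B)"
      proof (rule real_le_rsqrt)
        have "(sqrt (card B) * (2 * ln (X B)))\<^sup>2 = M * (2 * X B * ln (X B))\<^sup>2"
          using M by (simp add: X(3) power_mult_distrib)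
        also have "\<dots> \<le> M * (1728 * excess B)"
          using log_weighted_square_above_1[OF True X_le_6[OF B]] M by (intro mult_left_mono) (auto simp: excess_def)
        finally show "(sqrt (card B) * (2 * ln (X B)))\<^sup>2 \<le> 1728 * M * excess B" by simp
      qed
      finally show ?thesis by (simp add: mult_left_mono)
    next
      case False
      then have "card (B - U) * (2 * ln (X B)) \<le> 0" using X(1) by (simp add: mult_nonneg_nonpos)
      moreover have "0 \<le> sqrt (card (B - U)) * sqrt (1728 * M * excess B)" using M X(5) by simp
      ultimately show ?thesis by linarith
    qed
    moreover have "d * card (B - U) \<le> d * card B" using d_bounds le by simp
    ultimately show "card (B - U) * surplus B \<le> d * card B + sqrt (card (B - U)) * sqrt (1728 * M * excess B)"
      unfolding surplus_def by (simp add: algebra_simps)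
  qed
  also have "\<dots> = d * E (\<lambda>B. card B)
      + E (\<lambda>B. sqrt (card (B - U)) * sqrt (1728 * M * excess B))"
    by (simp only: expect_add expect_cmult)
  also have "\<dots> \<le> d * (2 * M) + sqrt (6 * (q - real (card U)) / s) * sqrt (864 * M * d)"
  proof (intro add_mono mult_left_mono mean_size_le)
    have "E (\<lambda>B. sqrt (card (B - U)) * sqrt (1728 * M * excess B))
        \<le> sqrt (E (\<lambda>B. card (B - U))) * sqrt (E (\<lambda>B. 1728 * M * excess B))"
      using M X_facts(5) by (intro expect_CS) auto
    also have "\<dots> \<le> sqrt (6 * (q - real (card U)) / s) * sqrt (864 * M * d)"
    proof (intro mult_mono real_sqrt_le_mono)
      have "E (\<lambda>B. card (B - U)) = E (\<lambda>B. card (B \<inter> ({..<q} - U)))"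
        using suppD(1) by (intro expect_cong) (auto intro!: arg_cong[of _ _ card])
      also have "\<dots> = (\<Sum>i\<in>{..<q} - U. usage q \<alpha> i)" by (simp add: sum_usage)
      also have "\<dots> \<le> (\<Sum>i\<in>{..<q} - U. 6 / s)" by (intro sum_mono usage_le_6)
      also have "\<dots> = 6 * (q - real (card U)) / s" unfolding sum_constant cU by simp
      finally show "E (\<lambda>B. card (B - U)) \<le> 6 * (q - real (card U)) / s" .
      then show "0 \<le> sqrt (6 * (q - real (card U)) / s)"
        using expect_nonneg[of "\<lambda>B. card (B - U)"] by (intro real_sqrt_ge_zero) linarith
      show "E (\<lambda>B. 1728 * M * excess B) \<le> 864 * M * d"
        unfolding expect_cmult using mult_left_mono[OF mean_excess, of "1728 * M"] M by simp
    qed (use M X_facts(5) in \<open>auto intro!: expect_nonneg\<close>)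
    finally show "E (\<lambda>B. sqrt (card (B - U)) * sqrt (1728 * M * excess B))
        \<le> sqrt (6 * (q - real (card U)) / s) * sqrt (864 * M * d)" .
  qed (use d_bounds in auto)
  finally have "s * E (\<lambda>B. card (B - U) * surplus B)
      \<le> s * (d * (2 * M) + sqrt (6 * (q - real (card U)) / s) * sqrt (864 * M * d))"
    by (rule mult_left_mono) simp
  also have "\<dots> = 2 * real s * (M * d) + s * sqrt (6 * (q - real (card U)) / s) * sqrt (864 * (M * d))"
    by (simp only: distrib_left mult_ac)
  also have "\<dots> = 2 / 3 * (s / M) + sqrt (1728 * (s / M) * (q - real (card U)))"
  proof -
    have "0 \<le> 6 * (q - real (card U))" using card_mono[OF _ U] by simp
    from s_times_sqrt[OF this] show ?thesis
      unfolding Md by (simp add: mult_ac flip: real_sqrt_mult)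
  qed
  also have "\<dots> \<le> s / M + sqrt (1728 * (s / M) * (q - real (card U)))"
    using M mult_right_mono[of "2 / 3" 1 "s / M"] by simp
  finally show ?thesis by (simp add: U_def)
qed

end

section \<open>There is no kernel with more than s sets\<close>

lemma sqrt_le_weighted_mean: assumes "0 \<le> a" "0 \<le> b" "y = a * b" shows "sqrt y \<le> (a + b) / 2"
  using arith_geo_mean_sqrt[OF assms(1,2)] assms(3) by simp

context large_kernel begin

lemma size_log: assumes "A \<in> supp" shows "card A * (2 * ln (X A)) \<le> (card A / M) * (card A - M)"
proof -
  have M: "0 < M" using M_gt by simp
  have c: "0 < real (card A)" using suppD(4)[OF assms] by simp
  have "2 * ln (X A) = ln (card A / M)" using X_facts(4)[OF assms] c M by (simp add: ln_div)
  also have "\<dots> \<le> card A / M - 1" using c M by (intro ln_le_minus_one) auto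
  finally have "card A * (2 * ln (X A)) \<le> card A * (card A / M - 1)" using c by simp
  also have "\<dots> = (card A / M) * (card A - M)" using M by (simp add: field_simps)
  finally show ?thesis .
qed

lemma X_le_1_iff: "X A \<le> 1 \<longleftrightarrow> card A \<le> M"
  using M_gt by (simp add: X_def)

lemma sum_size_d: assumes "J \<subseteq> F" shows "(\<Sum>A\<in>J. card A * d) \<le> s / M"
proof -
  have M: "0 < M" using M_gt by simp
  have "(\<Sum>A\<in>J. card A * d) \<le> (\<Sum>A\<in>F. card A * d)"
    using assms finite_F d_bounds(1) by (intro sum_mono2) auto
  also have "\<dots> = real (\<Sum>A\<in>F. card A) * d" by (simp add: sum_distrib_right)
  also have "\<dots> \<le> q * d" using sum_card_F d_bounds(1) by (intro mult_right_mono) linarith+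
  also have "\<dots> = s * (M * d)" by (simp add: q_eq)
  also have "\<dots> \<le> s / M" unfolding Md using M by (simp add: field_simps)
  finally show ?thesis .
qed

text \<open>Here the lower bound for \<open>q\<close> is decisive. The kernel inequality for \<open>J = {A}\<close> bounds the loss
  \<open>y = x * ln (M / x)\<close> by error terms of order \<open>s / M \<le> ln M / 50\<close>, but \<open>y \<ge> ln M\<close> for an integer \<open>x\<close>
  between \<open>1\<close> and \<open>M / 2\<close>.\<close>

lemma not_very_small: assumes A: "A \<in> F" shows "M / 2 < card A"
proof (rule ccontr)
  assume "\<not> M / 2 < card A"
  define x where "x = real (card A)"
  have x: "1 \<le> x" "x \<le> M / 2"
    using suppD(4)[of A] A F_supp \<open>\<not> M / 2 < card A\<close> by (auto simp: x_def)
  have M: "1000 \<le> M" by (rule M_gt)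
  have As: "A \<in> supp" using A F_supp by auto
  define y where "y = x * ln (M / x)"
  have lnMx: "ln (M / x) = - (2 * ln (X A))"
    using X_facts(4)[OF As] x M by (simp add: x_def ln_div)
  have ln2: "1 / 2 \<le> ln (2::real)" using ln2_ge_two_thirds by simp
  (* y >= ln M: since x is an integer, ln x <= (x - 1) * ln 2 *)
  have "ln 2 \<le> ln (M / x)" using x M by (intro ln_mono) (auto simp: field_simps)
  with ln2 have "1 / 2 \<le> ln (M / x)" by (rule order_trans)
  then have y_half: "x * (1 / 2) \<le> y" unfolding y_def using x by (intro mult_left_mono) auto
  have y_lnM: "ln M \<le> y"
  proof -
    have "card A - 1 < 2 ^ (card A - 1)" by (rule less_exp)
    then have "card A \<le> 2 ^ (card A - 1)" using suppD(4)[OF As] by linarith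
    then have "real (card A) \<le> 2 ^ (card A - 1)"
      using of_nat_le_iff[of "card A" "2 ^ (card A - 1)", where ?'a = real] by simp
    then have "ln x \<le> ln (2 ^ (card A - 1))" using x by (intro ln_mono) (auto simp: x_def)
    also have "\<dots> = (x - 1) * ln 2" using x by (simp add: ln_realpow x_def of_nat_diff)
    also have "\<dots> \<le> (x - 1) * ln (M / x)"
      using x \<open>ln 2 \<le> ln (M / x)\<close> by (intro mult_left_mono) auto
    also have "\<dots> = y - (ln M - ln x)" using x M by (simp add: y_def left_diff_distrib ln_div)
    finally show ?thesis by simp
  qed
  have "0 \<le> card A * surplus A + s * E (\<lambda>B. card (B - A) * surplus B)"
    using kernel_inequality[of "{A}"] A by simp
  also have "s * E (\<lambda>B. card (B - A) * surplus B) \<le> 17 * (s / M) + sqrt (3 * (s / M) * card A)"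
    using rest_bound_small[of "{A}"] A x M X_le_1_iff[of A] by (simp add: x_def)
  also have "card A * surplus A = - y + x * d"
    unfolding surplus_def y_def lnMx by (simp add: x_def algebra_simps)
  finally have main: "y \<le> x * d + 17 * (s / M) + sqrt (3 * (s / M) * x)" by (simp add: x_def)
  have "1 \<le> ln M"
  proof -
    have "exp 1 \<le> M" using exp_le M by linarith
    then show ?thesis using ln_ge_iff[of M 1] M by simp
  qed
  then have y1: "1 \<le> y" using y_lnM by simp
  have "s / M \<le> ln M / 50" using q_large M by (simp add: M_def[symmetric] field_simps)
  then have sM: "s / M \<le> y / 50" using y_lnM by simp
  have "x * d \<le> M * d" using x M d_bounds(1) by (intro mult_right_mono) auto
  then have "x * d \<le> 1 / 3000" using d_bounds(4) by (simp add: mult.commute)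
  moreover have "sqrt (3 * (s / M) * x) \<le> 7 / 20 * y"
  proof (rule real_le_lsqrt)
    have "3 * (s / M) * x \<le> 3 * (y / 50) * (2 * y)"
      using sM y_half x y1 by (intro mult_mono) auto
    also have "\<dots> \<le> (7 / 20 * y)\<^sup>2" by (simp add: power2_eq_square)
    finally show "3 * (s / M) * x \<le> (7 / 20 * y)\<^sup>2" .
  qed (use y1 in auto)
  ultimately show False using main sM y1 by simp
qed

text \<open>All sets of the kernel have more than \<open>M / 2\<close> elements, and more than \<open>s\<close> of them share \<open>s * M\<close>
  colors. Up to second-order terms the set \<open>A\<close> contributes \<open>card A - M\<close> to the kernel inequality, which
  adds up to at most \<open>- M\<close>. The second-order terms are small for sets whose size differs from \<open>M\<close> by at
  most \<open>\<zeta>\<close>. The sets in \<open>V\<close>, which are smaller, have a small total deviation \<open>T\<close> by the kernel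
  inequality for \<open>V\<close>. For the colors of the sets that are larger than \<open>M + \<zeta>\<close>, random sets are used
  instead; such a set takes away more than \<open>M + \<zeta>\<close> colors, and this pays for the error term.\<close>

lemma contradiction: False
proof -
  have M: "1000 \<le> M" by (rule M_gt)
  then have M0: "0 < M" by simp
  have s1: "1 \<le> sqrt s" using s_ge_1 by simp
  have ss: "sqrt s * sqrt s = s" by simp
  define R where "R = s * sqrt s / M"
  define \<zeta> where "\<zeta> = M / (4 * sqrt s)"
  have \<zeta>: "0 < \<zeta>" "\<zeta> \<le> M"
  proof -
    show "0 < \<zeta>" using M0 s1 by (simp add: \<zeta>_def)
    have "M / (4 * sqrt s) \<le> M / 1" using M0 s1 by (intro divide_left_mono) linarith+
    then show "\<zeta> \<le> M" by (simp add: \<zeta>_def)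
  qed
  have R: "1000000 * R \<le> M" using s_small M0 by (simp add: R_def M_def[symmetric] power2_eq_square divide_le_eq)
  have R0: "0 \<le> R" using M0 by (simp add: R_def)
  have sR: "s / M \<le> R"
    using M0 s1 mult_left_mono[OF s1, of s] by (simp add: R_def divide_right_mono)
  define k where "k = real (card F)"
  have k: "real s + 1 \<le> k" using F_card by (simp add: k_def)
  have big: "M / 2 < card A" if "A \<in> F" for A using not_very_small[OF that] .
  have sumF: "(\<Sum>A\<in>F. real (card A)) \<le> s * M"
    using sum_card_F q_eq by (simp flip: of_nat_sum)
  have "(\<Sum>A\<in>F. M / 2) \<le> (\<Sum>A\<in>F. real (card A))" using big by (intro sum_mono) force
  then have "k * (M / 2) \<le> 2 * s * (M / 2)" using sumF by (simp add: k_def)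
  then have k2: "k \<le> 2 * s" using M0 by (subst (asm) mult_le_cancel_right_pos) auto
  define V where "V = {A \<in> F. card A < M - \<zeta>}"
  define T where "T = (\<Sum>A\<in>V. M - card A)"
  have V: "V \<subseteq> F" "finite V" using finite_F by (auto simp: V_def)
  have T0: "0 \<le> T" unfolding T_def using \<zeta> by (intro sum_nonneg) (auto simp: V_def)
  have T: "T \<le> 120 * R"
  proof -
    have "0 \<le> (\<Sum>A\<in>V. card A * surplus A) + s * E (\<lambda>B. card (B - \<Union>V) * surplus B)"
      by (rule kernel_inequality[OF V(1)])
    also have "s * E (\<lambda>B. card (B - \<Union>V) * surplus B) \<le> 17 * (s / M) + sqrt (3 * (s / M) * card (\<Union>V))"
      using \<zeta> by (intro rest_bound_small[OF V(1)]) (auto simp: V_def X_le_1_iff)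
    also have "(\<Sum>A\<in>V. card A * surplus A) \<le> - (T / 2) + s / M"
    proof -
      have "(\<Sum>A\<in>V. card A * surplus A) = (\<Sum>A\<in>V. card A * (2 * ln (X A))) + (\<Sum>A\<in>V. card A * d)"
        by (simp add: surplus_def distrib_left sum.distrib)
      moreover have "(\<Sum>A\<in>V. card A * (2 * ln (X A))) \<le> (\<Sum>A\<in>V. - ((M - card A) / 2))"
      proof (rule sum_mono)
        fix A assume A: "A \<in> V"
        have "card A * (2 * ln (X A)) \<le> (card A / M) * (card A - M)"
          using size_log A V F_supp by blast
        also have "\<dots> \<le> (1 / 2) * (card A - M)"
          using A big[of A] V \<zeta> M0 by (intro mult_right_mono_neg) (auto simp: V_def field_simps)
        also have "\<dots> = - ((M - card A) / 2)" by (simp add: field_simps)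
        finally show "card A * (2 * ln (X A)) \<le> - ((M - card A) / 2)" .
      qed
      moreover have "(\<Sum>A\<in>V. - ((M - card A) / 2)) = - (T / 2)"
        by (simp add: T_def sum_negf flip: sum_divide_distrib)
      ultimately show ?thesis using sum_size_d[OF V(1)] by linarith
    qed
    finally have 1: "T / 2 \<le> 18 * (s / M) + sqrt (3 * (s / M) * card (\<Union>V))" by simp
    have "card (\<Union>V) \<le> 4 * sqrt s * T"
    proof -
      have "real (card (\<Union>V)) = (\<Sum>A\<in>V. real (card A))" by (simp add: card_Union_F[OF V(1)])
      also have "\<dots> \<le> (\<Sum>A\<in>V. (4 * sqrt s) * (M - card A))"
      proof (rule sum_mono)
        fix A assume "A \<in> V"
        then have A: "real (card A) \<le> M" "\<zeta> \<le> M - card A" using \<zeta> by (auto simp: V_def)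
        have "M = (4 * sqrt s) * \<zeta>" using s1 by (simp add: \<zeta>_def)
        also have "\<dots> \<le> (4 * sqrt s) * (M - card A)" using A s1 by (intro mult_left_mono) auto
        finally show "card A \<le> (4 * sqrt s) * (M - card A)" using A by linarith
      qed
      also have "\<dots> = 4 * sqrt s * T" by (simp add: T_def sum_distrib_left)
      finally show ?thesis .
    qed
    then have "3 * (s / M) * card (\<Union>V) \<le> 3 * (s / M) * (4 * sqrt s * T)"
      using M0 by (intro mult_left_mono) auto
    then have "sqrt (3 * (s / M) * card (\<Union>V)) \<le> sqrt (3 * (s / M) * (4 * sqrt s * T))" by simp
    also have "\<dots> \<le> (T / 2 + 24 * R) / 2"
      using T0 R0 by (intro sqrt_le_weighted_mean) (auto simp: R_def)
    finally show ?thesis using 1 sR by simp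
  qed
  (* u is the number of colors outside the sets of J, m the number of sets that are too large *)
  define J where "J = {A \<in> F. card A \<le> M + \<zeta>}"
  have J: "J \<subseteq> F" "finite J" using finite_F by (auto simp: J_def)
  have VJ: "V \<subseteq> J" using \<zeta> by (auto simp: V_def J_def)
  define m where "m = real (card (F - J))"
  have cardJ: "real (card J) = k - m"
    using card_Diff_subset[OF J(2,1)] card_mono[OF finite_F J(1)] by (simp add: m_def k_def of_nat_diff)
  define u where "u = s * M - real (card (\<Union>J))"
  have sumJ: "(\<Sum>A\<in>J. real (card A)) = s * M - u"
    by (simp add: u_def card_Union_F[OF J(1)])
  have um: "m * (M + \<zeta>) \<le> u"
  proof -
    have "m * (M + \<zeta>) = (\<Sum>A\<in>F - J. M + \<zeta>)" by (simp add: m_def)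
    also have "\<dots> \<le> (\<Sum>A\<in>F - J. real (card A))" by (intro sum_mono) (auto simp: J_def)
    also have "\<dots> = (\<Sum>A\<in>F. real (card A)) - (\<Sum>A\<in>J. real (card A))"
      using sum.subset_diff[OF J(1) finite_F, of "\<lambda>A. real (card A)"] by simp
    finally show ?thesis using sumF sumJ by linarith
  qed
  have u0: "0 \<le> u" using um M0 \<zeta> by (auto simp: m_def intro: order_trans[rotated])
  have "0 \<le> (\<Sum>A\<in>J. card A * surplus A) + s * E (\<lambda>B. card (B - \<Union>J) * surplus B)"
    by (rule kernel_inequality[OF J(1)])
  also have "s * E (\<lambda>B. card (B - \<Union>J) * surplus B) \<le> s / M + sqrt (1728 * (s / M) * u)"
    using rest_bound[OF J(1)] by (simp add: u_def q_eq)
  also have "sqrt (1728 * (s / M) * u) \<le> (u / (4 * sqrt s) + 6912 * R) / 2"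
    using u0 R0 s1 M0 ss by (intro sqrt_le_weighted_mean) (auto simp: R_def field_simps)
  also have "(\<Sum>A\<in>J. card A * surplus A) \<le> (s * M - u - (k - m) * M) + (M / 8 + T / 2) + s / M"
  proof -
    have "(\<Sum>A\<in>J. card A * surplus A) = (\<Sum>A\<in>J. card A * (2 * ln (X A))) + (\<Sum>A\<in>J. card A * d)"
      by (simp add: surplus_def distrib_left sum.distrib)
    moreover have "(\<Sum>A\<in>J. card A * (2 * ln (X A)))
        \<le> (\<Sum>A\<in>J. (card A - M) + (M / (16 * s) + (if A \<in> V then (M - card A) / 2 else 0)))"
    proof (rule sum_mono)
      fix A assume A: "A \<in> J"
      have "card A * (2 * ln (X A)) \<le> (card A / M) * (card A - M)"
        using size_log A J F_supp by blast
      also have "\<dots> = (card A - M) + (card A - M)\<^sup>2 / M" using M0 by (simp add: field_simps power2_eq_square)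
      also have "(card A - M)\<^sup>2 / M \<le> M / (16 * s) + (if A \<in> V then (M - card A) / 2 else 0)"
      proof (cases "A \<in> V")
        case True
        then have pos: "0 \<le> M - card A" "M - card A \<le> M / 2" using \<zeta> big[of A] V by (auto simp: V_def)
        have "(card A - M)\<^sup>2 = (M - card A) * (M - card A)" by (simp add: power2_eq_square algebra_simps)
        also have "\<dots> \<le> (M - card A) * (M / 2)" using pos by (intro mult_left_mono) auto
        finally have "(card A - M)\<^sup>2 / M \<le> (M - card A) / 2" using M0 by (simp add: divide_le_eq)
        moreover have "0 \<le> M / (16 * s)" using M0 by simp
        ultimately show ?thesis unfolding if_P[OF True] by linarith
      next
        case False
        then have "\<bar>card A - M\<bar> \<le> \<zeta>" using A by (auto simp: V_def J_def)
        then have "(card A - M)\<^sup>2 \<le> \<zeta>\<^sup>2" by (intro abs_le_square_iff[THEN iffD1]) (use \<zeta> in auto)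
        also have "\<zeta>\<^sup>2 = M * M / (16 * s)" by (simp add: \<zeta>_def power2_eq_square power_divide)
        finally show ?thesis using False M0 by (simp add: divide_le_eq mult.commute)
      qed
      finally show "card A * (2 * ln (X A)) \<le> (card A - M) + (M / (16 * s) + (if A \<in> V then (M - card A) / 2 else 0))"
        by simp
    qed
    moreover have "(\<Sum>A\<in>J. (card A - M) + (M / (16 * s) + (if A \<in> V then (M - card A) / 2 else 0)))
        = (s * M - u - (k - m) * M) + ((k - m) * (M / (16 * s)) + T / 2)"
    proof -
      have "(\<Sum>A\<in>J. if A \<in> V then (M - card A) / 2 else 0) = T / 2"
        using VJ J by (simp add: T_def sum_divide_distrib Int_absorb1 flip: sum.inter_restrict)
      then show ?thesis by (simp add: sum.distrib sum_subtractf sumJ cardJ)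
    qed
    moreover have "(k - m) * (M / (16 * s)) \<le> M / 8"
    proof -
      have "(k - m) * (M / (16 * s)) \<le> (2 * s) * (M / (16 * s))"
        using k2 M0 by (intro mult_right_mono) (auto simp: m_def)
      also have "\<dots> = M / 8" using s_pos by simp
      finally show ?thesis .
    qed
    ultimately show ?thesis using sum_size_d[OF J(1)] by linarith
  qed
  finally have main: "0 \<le> (s * M - u - (k - m) * M) + (M / 8 + T / 2) + s / M
      + (s / M + (u / (4 * sqrt s) + 6912 * R) / 2)" by simp
  have "m * M \<le> u - u / (8 * sqrt s)"
  proof -
    define z where "z = \<zeta> / M"
    have z: "0 < z" "z \<le> 1" using \<zeta> M0 by (auto simp: z_def)
    have "m * M * 1 \<le> m * M * ((1 + z) * (1 - z / 2))"
    proof (rule mult_left_mono)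
      have "0 \<le> z * (1 - z)" using z by simp
      then show "1 \<le> (1 + z) * (1 - z / 2)" by (simp add: algebra_simps)
    qed (use M0 in \<open>simp add: m_def\<close>)
    also have "\<dots> = m * (M + \<zeta>) * (1 - z / 2)" using M0 by (simp add: z_def field_simps)
    also have "\<dots> \<le> u * (1 - z / 2)" using um z by (intro mult_right_mono) auto
    also have "\<dots> = u - u / (8 * sqrt s)" using M0 s1 by (simp add: z_def \<zeta>_def algebra_simps)
    finally show ?thesis by simp
  qed
  moreover have half: "(u / (4 * sqrt s) + 6912 * R) / 2 = u / (8 * sqrt s) + 3456 * R"
    by (simp add: add_divide_distrib)
  moreover have "s * M + M \<le> k * M" using mult_right_mono[OF k, of M] M0 by (simp add: distrib_right)
  ultimately have "0 \<le> - M + M / 8 + T / 2 + 2 * (s / M) + 3456 * R"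
    using main unfolding half distrib_right left_diff_distrib by linarith
  then have "0 \<le> - (7 / 8 * M) + 3518 * R" using T sR by simp
  then show False using R M0 by simp
qed

end

theorem optimal_distr_uniform:
  assumes "optimal_distr q \<alpha> s"
    and "1000000 * (s * sqrt s) \<le> (q / s)\<^sup>2"
    and "50 * s \<le> (q / s) * ln (q / s)"
  shows "uniform_partition s q \<alpha>"
proof -
  interpret optimal_distr q \<alpha> s by fact
  show ?thesis
  proof (rule uniform_or_large_kernel)
    fix \<mu> F
    assume *: "0 < \<mu>" "\<And>A. A \<in> supp \<Longrightarrow> meet q \<alpha> A = clash q \<alpha> + \<mu> * (ln (card A) - log_size q \<alpha>)"
    "F \<subseteq> supp" "disjoint F" "\<And>B. B \<in> supp \<Longrightarrow> \<exists>A\<in>F. A \<inter> B \<noteq> {}" "s < card F"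
    interpret large_kernel q \<alpha> s \<mu> F
      by unfold_locales (use * assms in auto)
    show ?thesis using contradiction ..
  qed
qed

section \<open>Uniqueness and stability of the optimum\<close>

lemma continuous_coordinate [continuous_intros]:
  fixes S :: "(nat set \<Rightarrow> real) set" shows "continuous_on S (\<lambda>\<alpha>. \<alpha> A)"
  by (rule continuous_on_subset[OF continuous_on_product_coordinates]) simp

lemma continuous_expect [continuous_intros]:
  assumes "\<And>A. A \<in> color_sets q \<Longrightarrow> continuous_on S (\<lambda>\<alpha>. f \<alpha> A)"
  shows "continuous_on S (\<lambda>\<alpha>. expect q \<alpha> (f \<alpha>))"
  unfolding expect_def using assms by (intro continuous_intros) auto

lemma continuous_clash [continuous_intros]: "continuous_on S (clash q)"
  unfolding clash_def[abs_def] meet_def by (intro continuous_intros)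

lemma continuous_log_size [continuous_intros]: "continuous_on S (log_size q)"
  unfolding log_size_def[abs_def] by (intro continuous_intros)

text \<open>Distributions form a closed subset of a product of copies of the unit interval.\<close>

lemma compact_distr: "compact {\<alpha>. distribution q \<alpha>}"
proof -
  let ?box = "PiE UNIV (\<lambda>_. {0..1}) :: (nat set \<Rightarrow> real) set"
  have "compactin (product_topology (\<lambda>_. euclidean) UNIV) ?box"
    by (simp add: compactin_PiE)
  then have box: "compact ?box"
    by (simp add: euclidean_product_topology)
  have "closed {\<alpha> :: nat set \<Rightarrow> real. distribution q \<alpha>}"
    unfolding distribution_def
    by (intro closed_Collect_conj closed_Collect_all closed_Collect_imp closed_Collect_le closed_Collect_eq
        continuous_intros open_Collect_const)
  moreover have "{\<alpha>. distribution q \<alpha>} \<subseteq> ?box"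
  proof
    fix \<alpha> assume "\<alpha> \<in> {\<alpha>. distribution q \<alpha>}"
    then interpret color_distr q \<alpha> by unfold_locales simp
    have "\<alpha> A \<le> 1" for A
    proof (cases "A \<in> color_sets q")
      case True
      then show ?thesis using member_le_sum[OF True, of \<alpha>] nonneg total by simp
    qed (simp add: outside)
    then show "\<alpha> \<in> ?box" using nonneg by auto
  qed
  ultimately show ?thesis using compact_Int_closed[OF box] by (metis Int_absorb1)
qed

lemma uniform_partition_log_size_le:
  assumes P: "P \<subseteq> color_sets q" "card P = s" "disjoint P"
    and \<alpha>: "\<And>A. \<alpha> A = (if A \<in> P then 1 / real s else 0)" and "distribution q \<alpha>" "0 < s" "s \<le> q"
  shows "log_size q \<alpha> \<le> turan_value s q"
proof -
  interpret color_distr q \<alpha> by unfold_locales fact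
  define a where "a = q div s"
  have a: "1 \<le> a" using \<open>0 < s\<close> \<open>s \<le> q\<close> by (simp add: a_def Suc_le_eq div_greater_zero_iff)
  have "expect q \<alpha> (\<lambda>A. card A) = (\<Sum>A\<in>P. 1 / real s * card A)"
    unfolding expect_def using P(1) by (intro sum.mono_neutral_cong_right) (auto simp: \<alpha>)
  also have "\<dots> = 1 / real s * real (\<Sum>A\<in>P. card A)" by (simp add: sum_distrib_left)
  also have "(\<Sum>A\<in>P. card A) = card (\<Union>P)"
    using P color_setsD(3) by (subst card_Union_disjoint) (auto simp: disjoint_def pairwise_def disjnt_def)
  also have "card (\<Union>P) \<le> q" using P(1) color_setsD(1) card_mono[of "{..<q}" "\<Union>P"] by force
  finally have "expect q \<alpha> (\<lambda>A. card A) \<le> real q / s" using \<open>0 < s\<close> by (simp add: field_simps)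
  then have "(expect q \<alpha> (\<lambda>A. card A) - a) * (ln (real a + 1) - ln a) \<le> (real q / s - a) * (ln (real a + 1) - ln a)"
    using a by (intro mult_right_mono) auto
  then show ?thesis using log_size_le[OF a] by (simp add: turan_value_def a_def Let_def)
qed

text \<open>The two inequalities hold for all large \<open>s\<close> and all \<open>q \<ge> 100 * s\<^sup>2 / ln s\<close>. The first one is weaker
  than this condition by a power of \<open>s\<close>; the second one is its actual strength, since \<open>ln (q / s)\<close> is
  at least \<open>ln s / 2\<close>.\<close>
definition large_quotient :: "nat \<Rightarrow> nat \<Rightarrow> bool" where
  "large_quotient s q \<longleftrightarrow> 0 < s \<and> s \<le> q \<and> 1000000 * (s * sqrt s) \<le> (q / s)\<^sup>2 \<and> 50 * s \<le> (q / s) * ln (q / s)"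

text \<open>A maximum of \<open>log_size\<close> exists by compactness, and it is attained at a uniform distribution on \<open>s\<close>
  disjoint sets. So the maximum is \<open>turan_value\<close>, and \<open>\<beta>\<close> is itself a maximum.\<close>

theorem uniform_partition_if_value:
  assumes sq: "large_quotient s q"
    and "distribution q \<beta>" "clash q \<beta> \<le> 1 / s" "turan_value s q \<le> log_size q \<beta>"
  shows "uniform_partition s q \<beta>"
proof -
  let ?K = "{\<alpha>. distribution q \<alpha>} \<inter> {\<alpha>. clash q \<alpha> \<le> 1 / s}"
  have "compact ?K"
    by (intro compact_Int_closed compact_distr closed_Collect_le continuous_intros)
  moreover have "\<beta> \<in> ?K" using assms by simp
  ultimately obtain \<alpha> where \<alpha>: "\<alpha> \<in> ?K" "\<And>\<gamma>. \<gamma> \<in> ?K \<Longrightarrow> log_size q \<gamma> \<le> log_size q \<alpha>"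
    using continuous_attains_sup[of ?K "log_size q"] continuous_log_size by blast
  have uniform: "uniform_partition s q \<gamma>" if "\<gamma> \<in> ?K" "log_size q \<alpha> \<le> log_size q \<gamma>" for \<gamma>
  proof (rule optimal_distr_uniform)
    have "log_size q \<gamma>' \<le> log_size q \<gamma>" if "distribution q \<gamma>'" "clash q \<gamma>' \<le> 1 / s" for \<gamma>'
      using \<alpha>(2)[of \<gamma>'] that \<open>log_size q \<alpha> \<le> log_size q \<gamma>\<close> by auto
    moreover have "turan_value s q \<le> log_size q \<gamma>"
      using \<alpha>(2)[OF \<open>\<beta> \<in> ?K\<close>] that(2) assms(4) by linarith
    ultimately show "optimal_distr q \<gamma> s"
      using that sq by unfold_locales (auto simp: large_quotient_def)
  qed (use sq in \<open>auto simp: large_quotient_def\<close>)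
  have "uniform_partition s q \<alpha>" using uniform \<alpha>(1) by simp
  then have "log_size q \<alpha> \<le> turan_value s q"
    using uniform_partition_log_size_le[of _ q s \<alpha>] \<alpha>(1) sq unfolding uniform_partition_def large_quotient_def by blast
  then show ?thesis using uniform[OF \<open>\<beta> \<in> ?K\<close>] assms(4) by linarith
qed

text \<open>On the compact set of distributions that are far from all uniform ones, the larger of the two
  violations is a continuous positive function and hence bounded below.\<close>

theorem stability:
  assumes sq: "large_quotient s q" and "0 < \<rho>"
  obtains \<tau> where "0 < \<tau>"
    "\<And>\<alpha>. distribution q \<alpha> \<Longrightarrow> clash q \<alpha> \<le> 1 / s + \<tau> \<Longrightarrow> turan_value s q - \<tau> \<le> log_size q \<alpha> \<Longrightarrow>
      \<exists>P\<subseteq>color_sets q. card P = s \<and> disjoint P \<and>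
        (\<Sum>A\<in>color_sets q. \<bar>\<alpha> A - (if A \<in> P then 1 / s else 0)\<bar>) < \<rho>"
proof -
  define dist where "dist P \<alpha> = (\<Sum>A\<in>color_sets q. \<bar>\<alpha> A - (if A \<in> P then 1 / real s else 0)\<bar>)" for P and \<alpha> :: "nat set \<Rightarrow> real"
  define parts where "parts = {P. P \<subseteq> color_sets q \<and> card P = s \<and> disjoint P}"
  define K where "K = {\<alpha>. distribution q \<alpha>} \<inter> {\<alpha>. \<forall>P. P \<in> parts \<longrightarrow> \<rho> \<le> dist P \<alpha>}"
  define f where "f \<alpha> = max (clash q \<alpha> - 1 / s) (turan_value s q - log_size q \<alpha>)" for \<alpha>
  have "compact K" unfolding K_def dist_def
    by (intro compact_Int_closed compact_distr closed_Collect_all closed_Collect_imp closed_Collect_le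
       continuous_intros open_Collect_const)
  have cont: "continuous_on K f" unfolding f_def[abs_def] by (intro continuous_intros)
  have far: "\<alpha> \<in> K" if "distribution q \<alpha>" "\<not> (\<exists>P\<subseteq>color_sets q. card P = s \<and> disjoint P \<and> dist P \<alpha> < \<rho>)" for \<alpha>
    using that unfolding K_def parts_def by (auto simp: not_less)
  show thesis
  proof (cases "K = {}")
    case True
    then show ?thesis using that[of 1] far unfolding dist_def by auto
  next
    case False
    then obtain \<alpha>0 where \<alpha>0: "\<alpha>0 \<in> K" "\<And>\<alpha>. \<alpha> \<in> K \<Longrightarrow> f \<alpha>0 \<le> f \<alpha>"
      using continuous_attains_inf[OF \<open>compact K\<close> False cont] by blast
    have "0 < f \<alpha>0"
    proof (rule ccontr)
      assume "\<not> 0 < f \<alpha>0"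
      then have "clash q \<alpha>0 \<le> 1 / s" "turan_value s q \<le> log_size q \<alpha>0" by (auto simp: f_def)
      then have "uniform_partition s q \<alpha>0"
        using uniform_partition_if_value[OF sq] \<alpha>0(1) by (auto simp: K_def)
      then obtain P where P: "P \<in> parts" "\<And>A. \<alpha>0 A = (if A \<in> P then 1 / real s else 0)"
        unfolding uniform_partition_def parts_def by blast
      have "dist P \<alpha>0 = 0" unfolding dist_def P(2) by simp
      then show False using \<alpha>0(1) P(1) \<open>0 < \<rho>\<close> by (auto simp: K_def)
    qed
    show ?thesis
    proof (rule that[of "f \<alpha>0 / 2"])
      fix \<alpha> assume *: "distribution q \<alpha>" "clash q \<alpha> \<le> 1 / s + f \<alpha>0 / 2" "turan_value s q - f \<alpha>0 / 2 \<le> log_size q \<alpha>"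
      then have "clash q \<alpha> - 1 / s \<le> f \<alpha>0 / 2" "turan_value s q - log_size q \<alpha> \<le> f \<alpha>0 / 2" by linarith+
      then have "f \<alpha> \<le> f \<alpha>0 / 2" unfolding f_def[of \<alpha>] by (rule max.boundedI)
      then have "\<alpha> \<notin> K" using \<alpha>0(2)[of \<alpha>] \<open>0 < f \<alpha>0\<close> by auto
      then show "\<exists>P\<subseteq>color_sets q. card P = s \<and> disjoint P \<and>
        (\<Sum>A\<in>color_sets q. \<bar>\<alpha> A - (if A \<in> P then 1 / s else 0)\<bar>) < \<rho>"
        using far[OF *(1)] unfolding dist_def by blast
    qed (use \<open>0 < f \<alpha>0\<close> in simp)
  qed
qed

section \<open>Containers for colorings\<close>

text \<open>Edges are counted as ordered pairs, in accordance with the clash of two independent samples.\<close>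
definition arcs :: "'a set set \<Rightarrow> ('a \<times> 'a) set" where
  "arcs E = {(u, v). {u, v} \<in> E}"

lemma arcs_subset: "E \<subseteq> nsets V 2 \<Longrightarrow> arcs E \<subseteq> V \<times> V"
  by (auto simp: arcs_def)

lemma card_arcs: assumes "finite V" "E \<subseteq> nsets V 2" shows "card (arcs E) = 2 * card E"
proof -
  have "finite E" using assms finite_imp_finite_nsets finite_subset by blast
  have two: "finite {(u, v). {u, v} = e}" "card {(u, v). {u, v} = e} = 2" if "e \<in> E" for e
  proof -
    obtain x y where e: "e = {x, y}" "x \<noteq> y" using assms(2) \<open>e \<in> E\<close> nsets2_E by (metis subsetD)
    then have "{(u, v). {u, v} = e} = {(x, y), (y, x)}" by (auto simp: doubleton_eq_iff)
    then show "finite {(u, v). {u, v} = e}" "card {(u, v). {u, v} = e} = 2" using e(2) by auto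
  qed
  have "arcs E = (\<Union>e\<in>E. {(u, v). {u, v} = e})" by (auto simp: arcs_def)
  also have "card \<dots> = (\<Sum>e\<in>E. card {(u, v). {u, v} = e})"
    using \<open>finite E\<close> two(1) by (intro card_UN_disjoint) auto
  finally show ?thesis using two(2) by simp
qed

definition nbs :: "'a set set \<Rightarrow> 'a set \<Rightarrow> 'a set" where
  "nbs E T = {u. \<exists>v\<in>T. {u, v} \<in> E}"

text \<open>The vertices that are not adjacent to \<open>T\<close> and have at most \<open>d\<close> neighbours that are not adjacent to
  \<open>T\<close>.\<close>
definition container :: "'a sgraph \<Rightarrow> real \<Rightarrow> 'a set \<Rightarrow> 'a set" where
  "container G d T = {v \<in> verts G - nbs (edges G) T. real (card (nbs (edges G) {v} - nbs (edges G) T)) \<le> d}"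

lemma nbs_subset: "sgraph G \<Longrightarrow> nbs (edges G) T \<subseteq> verts G"
  by (auto simp: nbs_def sgraph_def)

text \<open>Choose \<open>T \<subseteq> I\<close> such that the number of vertices adjacent to \<open>T\<close> minus \<open>d * card T\<close> is maximal.
  Comparison with the empty set bounds the size of \<open>T\<close>, and comparison with \<open>insert v T\<close> shows that
  \<open>v\<close> has at most \<open>d\<close> new neighbours.\<close>

lemma independent_subset_container:
  assumes G: "sgraph G" and "0 < d" and I: "I \<subseteq> verts G" "\<And>u v. u \<in> I \<Longrightarrow> v \<in> I \<Longrightarrow> {u, v} \<notin> edges G"
  obtains T where "T \<subseteq> I" "real (card T) * d \<le> card (verts G)" "I \<subseteq> container G d T"
proof -
  let ?N = "nbs (edges G)"
  have fV: "finite (verts G)" using G by (simp add: sgraph_def)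
  have fN: "finite (?N T)" for T using nbs_subset[OF G] fV finite_subset by blast
  have fI: "finite I" using I fV finite_subset by blast
  define f where "f T = real (card (?N T)) - d * card T" for T
  have "finite (f ` Pow I)" "f ` Pow I \<noteq> {}" using fI by auto
  then obtain T where T: "T \<subseteq> I" "f T = Max (f ` Pow I)" using Max_in by (metis (no_types, lifting) PowD imageE)
  then have max: "f T' \<le> f T" if "T' \<subseteq> I" for T' using that fI by simp
  have "f {} = 0" by (simp add: f_def nbs_def)
  then have "card T * d \<le> card (?N T)" using max[of "{}"] by (simp add: f_def mult.commute)
  also have "\<dots> \<le> card (verts G)" using nbs_subset[OF G] fV by (simp add: card_mono)
  finally have size: "card T * d \<le> card (verts G)" .
  show thesis
  proof (rule that[OF T(1) size], rule subsetI)
    fix v assume v: "v \<in> I"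
    have "v \<notin> ?N T" using I(2) v T(1) by (auto simp: nbs_def)
    moreover have "real (card (?N {v} - ?N T)) \<le> d"
    proof (cases "v \<in> T")
      case True
      have "?N {v} - ?N T = {}" using True by (auto simp: nbs_def)
      show ?thesis unfolding \<open>?N {v} - ?N T = {}\<close> using \<open>0 < d\<close> by simp
    next
      case False
      have "?N (insert v T) = ?N T \<union> (?N {v} - ?N T)" by (auto simp: nbs_def)
      moreover have "card (?N T \<union> (?N {v} - ?N T)) = card (?N T) + card (?N {v} - ?N T)"
        using fN by (intro card_Un_disjoint) auto
      ultimately have "card (?N (insert v T)) = card (?N T) + card (?N {v} - ?N T)" by simp
      moreover have "f (insert v T) \<le> f T" using max v T(1) by simp
      ultimately show ?thesis using False T(1) fI finite_subset[OF T(1)] by (simp add: f_def algebra_simps)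
    qed
    ultimately show "v \<in> container G d T" using v I(1) by (auto simp: container_def)
  qed
qed

text \<open>No vertex of the container is adjacent to \<open>T\<close>, so a vertex of the container has at most \<open>d\<close>
  neighbours in it.\<close>

lemma container_arcs:
  fixes d :: real
  assumes G: "sgraph G" and "0 < d"
  shows "card (arcs (edges G) \<inter> container G d T \<times> container G d T) \<le> card (verts G) * d"
proof -
  let ?C = "container G d T"
  have fV: "finite (verts G)" using G by (simp add: sgraph_def)
  have C: "?C \<subseteq> verts G" by (auto simp: container_def)
  then have fC: "finite ?C" using fV finite_subset by blast
  have fN: "finite (nbs (edges G) {v} - nbs (edges G) T)" for v
    using nbs_subset[OF G] fV finite_subset by blast
  have "card (arcs (edges G) \<inter> ?C \<times> ?C) \<le> card (SIGMA v:?C. nbs (edges G) {v} - nbs (edges G) T)"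
    using fC fN by (intro card_mono finite_SigmaI)
      (auto simp: arcs_def container_def nbs_def insert_commute)
  then have "real (card (arcs (edges G) \<inter> ?C \<times> ?C)) \<le> (\<Sum>v\<in>?C. real (card (nbs (edges G) {v} - nbs (edges G) T)))"
    using fC fN by (subst (asm) card_SigmaI) (auto simp flip: of_nat_sum)
  also have "\<dots> \<le> (\<Sum>v\<in>?C. d)" by (intro sum_mono) (auto simp: container_def)
  also have "\<dots> = card ?C * d" by simp
  also have "\<dots> \<le> card (verts G) * d"
    using card_mono[OF fV C] \<open>0 < d\<close> by (intro mult_right_mono) auto
  finally show ?thesis .
qed

lemma card_small_subsets: assumes "finite V"
  shows "card {T. T \<subseteq> V \<and> card T \<le> k} \<le> (card V + 1) ^ k"
proof (induction k)
  case 0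
  have "{T. T \<subseteq> V \<and> card T \<le> 0} = {{}}" using assms finite_subset by fastforce
  then show ?case by simp
next
  case (Suc k)
  let ?S = "\<lambda>k. {T. T \<subseteq> V \<and> card T \<le> k}"
  let ?f = "\<lambda>(x, T). case x of None \<Rightarrow> T | Some v \<Rightarrow> insert v T"
  let ?D = "insert None (Some ` V) \<times> ?S k"
  have fin: "finite ?D" using assms by simp
  have "?S (Suc k) \<subseteq> ?f ` ?D"
  proof
    fix T assume T: "T \<in> ?S (Suc k)"
    show "T \<in> ?f ` ?D"
    proof (cases "card T \<le> k")
      case True
      then show ?thesis using T by (intro image_eqI[of _ _ "(None, T)"]) auto
    next
      case False
      then obtain v where v: "v \<in> T" by fastforce
      have "card (T - {v}) \<le> k" using T v assms finite_subset[of T V] by (auto simp: card_Diff_singleton)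
      then show ?thesis using T v by (intro image_eqI[of _ _ "(Some v, T - {v})"]) auto
    qed
  qed
  then have "card (?S (Suc k)) \<le> card (?f ` ?D)" using fin by (intro card_mono finite_imageI)
  also have "\<dots> \<le> card ?D" by (rule card_image_le[OF fin])
  also have "\<dots> = (card V + 1) * card (?S k)"
    using assms by (simp add: card_cartesian_product card_image)
  also have "\<dots> \<le> (card V + 1) * (card V + 1) ^ k" using Suc.IH by (intro mult_left_mono) auto
  finally show ?case by simp
qed

text \<open>Every color class lies in the container of a set \<open>T i\<close> with at most \<open>1 / \<delta>\<close> elements. For fixed sets
  \<open>T i\<close> the color of \<open>v\<close> can only be an \<open>i\<close> whose container has \<open>v\<close> in it. There are only polynomially many
  choices of the sets \<open>T i\<close>, and \<open>L\<close> comes from the best one.\<close>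

lemma coloring_lists:
  fixes \<delta> :: real
  assumes G: "sgraph G" and "0 < \<delta>" "0 < card (verts G)"
  obtains L where "\<And>v. L v \<subseteq> {..<q}"
    "card (proper_colorings q G) \<le> (card (verts G) + 1) ^ (nat \<lfloor>1 / \<delta>\<rfloor> * q) * (\<Prod>v\<in>verts G. card (L v))"
    "card {(u, v) \<in> arcs (edges G). L u \<inter> L v \<noteq> {}} \<le> q * \<delta> * (card (verts G))\<^sup>2"
proof -
  let ?V = "verts G"
  define n where "n = card ?V"
  define d where "d = \<delta> * n"
  define k where "k = nat \<lfloor>1 / \<delta>\<rfloor>"
  have n: "0 < n" using assms by (simp add: n_def)
  have d: "0 < d" using assms n by (simp add: d_def)
  have fV: "finite ?V" using G by (simp add: sgraph_def)
  define S where "S = {T. T \<subseteq> ?V \<and> card T \<le> k}"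
  have fS: "finite S" using fV by (simp add: S_def)
  define L where "L T v = {i \<in> {..<q}. v \<in> container G d (T i)}" for T v
  have "proper_colorings q G \<subseteq> (\<Union>T\<in>{..<q} \<rightarrow>\<^sub>E S. \<Pi>\<^sub>E v\<in>?V. L T v)"
  proof
    fix c assume c: "c \<in> proper_colorings q G"
    have "\<exists>T. T \<in> S \<and> {v \<in> ?V. c v = i} \<subseteq> container G d T" for i
    proof -
      obtain T where T: "T \<subseteq> {v \<in> ?V. c v = i}" "real (card T) * d \<le> card ?V" "{v \<in> ?V. c v = i} \<subseteq> container G d T"
      proof (rule independent_subset_container[OF G d])
        show "{u, v} \<notin> edges G" if "u \<in> {v \<in> ?V. c v = i}" "v \<in> {v \<in> ?V. c v = i}" for u v
        proof -
          have "c u = c v" using that by simp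
          then show ?thesis using c unfolding proper_colorings_def by blast
        qed
      qed auto
      have "card T * \<delta> \<le> 1" using T(2) n by (simp add: d_def n_def[symmetric] mult.assoc[symmetric])
      then have "card T \<le> 1 / \<delta>" using \<open>0 < \<delta>\<close> by (simp add: field_simps)
      then have "card T \<le> k" unfolding k_def by (simp add: le_nat_floor)
      then show ?thesis using T by (auto simp: S_def)
    qed
    then obtain T where T: "\<And>i. T i \<in> S" "\<And>i. {v \<in> ?V. c v = i} \<subseteq> container G d (T i)" by metis
    have cV: "c \<in> ?V \<rightarrow>\<^sub>E {..<q}" using c by (simp add: proper_colorings_def)
    have "c \<in> (\<Pi>\<^sub>E v\<in>?V. L (restrict T {..<q}) v)"
    proof (rule PiE_I)
      fix v assume v: "v \<in> ?V"
      have "c v < q" using cV v by auto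
      moreover have "v \<in> container G d (T (c v))" using T(2)[of "c v"] v by auto
      ultimately show "c v \<in> L (restrict T {..<q}) v" by (simp add: L_def)
    next
      fix v assume "v \<notin> ?V"
      then show "c v = undefined" using cV by (rule PiE_arb[rotated])
    qed
    moreover have "restrict T {..<q} \<in> {..<q} \<rightarrow>\<^sub>E S" using T(1) by simp
    ultimately show "c \<in> (\<Union>T\<in>{..<q} \<rightarrow>\<^sub>E S. \<Pi>\<^sub>E v\<in>?V. L T v)" by blast
  qed
  moreover have fin: "finite ({..<q} \<rightarrow>\<^sub>E S)" using fS by (intro finite_PiE) auto
  moreover have "finite (\<Pi>\<^sub>E v\<in>?V. L T v)" for T using fV by (intro finite_PiE) (auto simp: L_def)
  ultimately have "card (proper_colorings q G) \<le> card (\<Union>T\<in>{..<q} \<rightarrow>\<^sub>E S. \<Pi>\<^sub>E v\<in>?V. L T v)"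
    by (intro card_mono finite_UN_I)
  also have "\<dots> \<le> (\<Sum>T\<in>{..<q} \<rightarrow>\<^sub>E S. card (\<Pi>\<^sub>E v\<in>?V. L T v))" using fin by (rule card_UN_le)
  also have "\<dots> = (\<Sum>T\<in>{..<q} \<rightarrow>\<^sub>E S. \<Prod>v\<in>?V. card (L T v))" using fV by (simp add: card_PiE)
  finally have 1: "card (proper_colorings q G) \<le> (\<Sum>T\<in>{..<q} \<rightarrow>\<^sub>E S. \<Prod>v\<in>?V. card (L T v))" .
  let ?W = "(\<lambda>T. \<Prod>v\<in>?V. card (L T v)) ` ({..<q} \<rightarrow>\<^sub>E S)"
  have "{} \<in> S" by (simp add: S_def)
  then have "{..<q} \<rightarrow>\<^sub>E S \<noteq> {}" by (auto simp: PiE_eq_empty_iff)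
  then have "Max ?W \<in> ?W" using fin by (intro Max_in) auto
  then obtain T where T: "T \<in> {..<q} \<rightarrow>\<^sub>E S" "(\<Prod>v\<in>?V. card (L T v)) = Max ?W" by auto
  have "(\<Sum>T\<in>{..<q} \<rightarrow>\<^sub>E S. \<Prod>v\<in>?V. card (L T v)) \<le> card ({..<q} \<rightarrow>\<^sub>E S) * (\<Prod>v\<in>?V. card (L T v))"
  proof -
    have "(\<Sum>T\<in>{..<q} \<rightarrow>\<^sub>E S. \<Prod>v\<in>?V. card (L T v)) \<le> of_nat (card ({..<q} \<rightarrow>\<^sub>E S)) * Max ?W"
      by (rule sum_bounded_above) (use fin in auto)
    then show ?thesis unfolding T(2) by simp
  qed
  also have "card ({..<q} \<rightarrow>\<^sub>E S) = card S ^ q" by (simp add: card_PiE)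
  also have "\<dots> \<le> ((n + 1) ^ k) ^ q"
    using card_small_subsets[OF fV, of k] by (intro power_mono) (auto simp: S_def n_def)
  finally have 2: "card (proper_colorings q G) \<le> (n + 1) ^ (k * q) * (\<Prod>v\<in>?V. card (L T v))"
    using 1 by (simp add: power_mult)
  have fa: "finite (arcs (edges G))"
    using arcs_subset[of "edges G" ?V] G fV finite_subset unfolding sgraph_def by blast
  have "{(u, v) \<in> arcs (edges G). L T u \<inter> L T v \<noteq> {}}
      \<subseteq> (\<Union>i<q. arcs (edges G) \<inter> container G d (T i) \<times> container G d (T i))"
    by (auto simp: L_def)
  then have "card {(u, v) \<in> arcs (edges G). L T u \<inter> L T v \<noteq> {}}
      \<le> card (\<Union>i<q. arcs (edges G) \<inter> container G d (T i) \<times> container G d (T i))"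
    using fa by (intro card_mono) auto
  also have "\<dots> \<le> (\<Sum>i<q. card (arcs (edges G) \<inter> container G d (T i) \<times> container G d (T i)))"
    by (rule card_UN_le) simp
  finally have "real (card {(u, v) \<in> arcs (edges G). L T u \<inter> L T v \<noteq> {}})
      \<le> (\<Sum>i<q. real (card (arcs (edges G) \<inter> container G d (T i) \<times> container G d (T i))))"
    by (simp flip: of_nat_sum)
  also have "\<dots> \<le> (\<Sum>i<q. n * d)"
    unfolding n_def using d by (intro sum_mono container_arcs[OF G d])
  also have "\<dots> = q * \<delta> * n\<^sup>2" by (simp add: d_def power2_eq_square)
  finally show thesis using that[of "L T"] 2 by (simp add: n_def k_def L_def subset_iff)
qed

section \<open>The distribution of the lists\<close>

definition label_distr :: "'a set \<Rightarrow> ('a \<Rightarrow> nat set) \<Rightarrow> nat set \<Rightarrow> real" where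
  "label_distr V L A = card {v \<in> V. L v = A} / card V"

lemma expect_label_distr:
  assumes "finite V" "L ` V \<subseteq> color_sets q"
  shows "expect q (label_distr V L) f = (\<Sum>v\<in>V. f (L v)) / card V"
proof -
  have "(\<Sum>A\<in>color_sets q. card {v \<in> V. L v = A} * f A) = (\<Sum>A\<in>color_sets q. \<Sum>v\<in>{v \<in> V. L v = A}. f (L v))"
    by (intro sum.cong refl) simp
  also have "\<dots> = (\<Sum>v\<in>V. f (L v))" using assms by (intro sum.group) auto
  finally show ?thesis
    by (simp add: expect_def label_distr_def flip: sum_divide_distrib)
qed

lemma distr_label_distr:
  assumes "finite V" "V \<noteq> {}" "L ` V \<subseteq> color_sets q"
  shows "distribution q (label_distr V L)"
proof -
  have "sum (label_distr V L) (color_sets q) = 1"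
    using expect_label_distr[OF assms(1,3), of "\<lambda>_. 1"] assms(1,2) by (simp add: expect_def)
  moreover have "label_distr V L A = 0" if "A \<notin> color_sets q" for A
  proof -
    have "{v \<in> V. L v = A} = {}" using assms(3) that by auto
    then show ?thesis by (simp only: label_distr_def) simp
  qed
  ultimately show ?thesis by (simp add: distribution_def label_distr_def)
qed

lemma clash_label_distr:
  assumes "finite V" "L ` V \<subseteq> color_sets q"
  shows "clash q (label_distr V L) = card {(u, v) \<in> V \<times> V. L u \<inter> L v \<noteq> {}} / (card V)\<^sup>2"
proof -
  have "clash q (label_distr V L) = (\<Sum>u\<in>V. \<Sum>v\<in>V. of_bool (L u \<inter> L v \<noteq> {})) / (card V)\<^sup>2"
    unfolding clash_def meet_def expect_label_distr[OF assms]
    by (simp add: power2_eq_square flip: sum_divide_distrib)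
  also have "(\<Sum>u\<in>V. \<Sum>v\<in>V. of_bool (L u \<inter> L v \<noteq> {})) = (\<Sum>p\<in>V \<times> V. of_bool (L (fst p) \<inter> L (snd p) \<noteq> {}) :: real)"
    by (simp add: sum.cartesian_product case_prod_unfold)
  also have "\<dots> = card {p \<in> V \<times> V. L (fst p) \<inter> L (snd p) \<noteq> {}}"
    using assms(1) by (simp add: of_bool_def flip: sum.inter_filter)
  also have "{p \<in> V \<times> V. L (fst p) \<inter> L (snd p) \<noteq> {}} = {(u, v) \<in> V \<times> V. L u \<inter> L v \<noteq> {}}" by auto
  finally show ?thesis by simp
qed

definition bad_arcs :: "'a sgraph \<Rightarrow> ('a \<Rightarrow> nat set) \<Rightarrow> ('a \<times> 'a) set" where
  "bad_arcs G L = {(u, v) \<in> arcs (edges G). L u \<inter> L v \<noteq> {}}"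

text \<open>The logarithm of the number of colorings, divided by \<open>n\<close>, becomes the \<open>log_size\<close> of the list of a random
  vertex, and an arc that is not bad joins disjoint lists. So a large number of edges means a small
  clash.\<close>

lemma many_colorings_lists:
  fixes \<delta> \<eta> \<tau> :: real
  assumes G: "sgraph G" "card (verts G) = n" "0 < n" and "0 < \<delta>" "0 < s"
    and edges: "((real s - 1) / (2 * real s) - \<eta>) * (real n)\<^sup>2 \<le> card (edges G)"
    and colorings: "exp (n * (turan_value s q - \<tau>)) \<le> card (proper_colorings q G)"
  obtains L where "L ` verts G \<subseteq> color_sets q"
    "clash q (label_distr (verts G) L) \<le> 1 / s + (2 * \<eta> + q * \<delta>)"
    "turan_value s q - \<tau> - real (nat \<lfloor>1 / \<delta>\<rfloor> * q) * ln (real n + 1) / n \<le> log_size q (label_distr (verts G) L)"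
    "card (bad_arcs G L) \<le> q * \<delta> * (real n)\<^sup>2"
proof -
  let ?V = "verts G"
  define k where "k = nat \<lfloor>1 / \<delta>\<rfloor>"
  have fV: "finite ?V" using G by (simp add: sgraph_def)
  have Vne: "?V \<noteq> {}" using G by auto
  obtain L where L: "\<And>v. L v \<subseteq> {..<q}"
    "card (proper_colorings q G) \<le> (card ?V + 1) ^ (k * q) * (\<Prod>v\<in>?V. card (L v))"
    "card {(u, v) \<in> arcs (edges G). L u \<inter> L v \<noteq> {}} \<le> q * \<delta> * (card ?V)\<^sup>2"
    using coloring_lists[OF G(1) \<open>0 < \<delta>\<close>, of q] G(2,3) unfolding k_def by auto
  have "0 < card (proper_colorings q G)"
    using colorings exp_gt_zero[of "n * (turan_value s q - \<tau>)"] by linarith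
  then have prod: "0 < (\<Prod>v\<in>?V. card (L v))" using L(2) by (intro Nat.gr0I) simp
  have pos: "0 < card (L v)" if "v \<in> ?V" for v
    using prod that fV by (metis prod_pos_nat_iff)
  then have sets: "L ` ?V \<subseteq> color_sets q" using L(1) by (force simp: color_sets_def)
  let ?\<alpha> = "label_distr ?V L"
  have c1: "clash q ?\<alpha> \<le> 1 / s + (2 * \<eta> + q * \<delta>)"
  proof -
    let ?I = "{(u, v) \<in> ?V \<times> ?V. L u \<inter> L v \<noteq> {}}"
    have "arcs (edges G) \<union> ?I \<subseteq> ?V \<times> ?V" using G(1) arcs_subset unfolding sgraph_def by blast
    then have "card (arcs (edges G) \<union> ?I) \<le> card (?V \<times> ?V)" using fV by (intro card_mono) auto
    also have "\<dots> = n\<^sup>2" using G(2) by (simp add: card_cartesian_product power2_eq_square)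
    finally have "real (card (arcs (edges G) \<union> ?I)) \<le> (real n)\<^sup>2" by (simp flip: of_nat_power)
    moreover have fin: "finite (arcs (edges G))" "finite ?I"
      using \<open>arcs (edges G) \<union> ?I \<subseteq> ?V \<times> ?V\<close> fV finite_subset[of _ "?V \<times> ?V"] by auto
    moreover have int: "arcs (edges G) \<inter> ?I = {(u, v) \<in> arcs (edges G). L u \<inter> L v \<noteq> {}}"
      using \<open>arcs (edges G) \<union> ?I \<subseteq> ?V \<times> ?V\<close> by auto
    moreover have "real (card (arcs (edges G))) + card ?I
        = real (card (arcs (edges G) \<union> ?I)) + card {(u, v) \<in> arcs (edges G). L u \<inter> L v \<noteq> {}}"
      using arg_cong[OF card_Un_Int[OF fin], of real] unfolding int of_nat_add .
    moreover have "real (card {(u, v) \<in> arcs (edges G). L u \<inter> L v \<noteq> {}}) \<le> q * \<delta> * (real n)\<^sup>2"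
      using L(3) G(2) by simp
    ultimately have "real (card (arcs (edges G))) + card ?I \<le> (real n)\<^sup>2 + q * \<delta> * (real n)\<^sup>2"
      by linarith
    moreover have "real (card (arcs (edges G))) = 2 * card (edges G)"
      using card_arcs[OF fV] G(1) by (simp add: sgraph_def)
    ultimately have "card ?I \<le> (real n)\<^sup>2 + q * \<delta> * (real n)\<^sup>2 - 2 * (((real s - 1) / (2 * real s) - \<eta>) * (real n)\<^sup>2)"
      using edges by linarith
    also have "\<dots> = (1 / s + (2 * \<eta> + q * \<delta>)) * (real n)\<^sup>2"
      using \<open>0 < s\<close> by (simp add: field_simps of_nat_diff)
    finally show ?thesis
      using clash_label_distr[OF fV sets] G(2,3) by (simp add: divide_le_eq)
  qed
  have c2: "turan_value s q - \<tau> - real (k * q) * ln (real n + 1) / n \<le> log_size q ?\<alpha>"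
  proof -
    have "exp (n * (turan_value s q - \<tau>)) \<le> real ((n + 1) ^ (k * q) * (\<Prod>v\<in>?V. card (L v)))"
      using colorings L(2) G(2) of_nat_le_iff order_trans by metis
    then have "n * (turan_value s q - \<tau>) \<le> ln (real ((n + 1) ^ (k * q) * (\<Prod>v\<in>?V. card (L v))))"
      using ln_ge_iff prod by (metis (no_types, lifting) exp_gt_zero less_le_trans)
    also have "\<dots> = real (k * q) * ln (real n + 1) + (\<Sum>v\<in>?V. ln (card (L v)))"
      using prod pos fV by (simp add: ln_mult ln_realpow ln_prod)
    also have "(\<Sum>v\<in>?V. ln (card (L v))) = n * log_size q ?\<alpha>"
      using expect_label_distr[OF fV sets] G(2,3) by (simp add: log_size_def)
    finally have "n * (turan_value s q - \<tau>) / n \<le> (real (k * q) * ln (real n + 1) + n * log_size q ?\<alpha>) / n"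
      by (intro divide_right_mono) auto
    moreover have "n * x / n = x" for x :: real using G(3) by simp
    ultimately have "turan_value s q - \<tau> \<le> real (k * q) * ln (real n + 1) / n + log_size q ?\<alpha>"
      by (simp only: add_divide_distrib)
    then show ?thesis by linarith
  qed
  have c3: "card (bad_arcs G L) \<le> q * \<delta> * (real n)\<^sup>2"
    using L(3) G(2) by (simp add: bad_arcs_def)
  show thesis by (rule that[OF sets c1 c2[unfolded k_def] c3])
qed

section \<open>A graph with many colorings\<close>

definition residue_class :: "nat \<Rightarrow> nat \<Rightarrow> nat \<Rightarrow> nat set" where
  "residue_class s n r = {i. i < n \<and> i mod s = r}"

lemma residue_class_facts:
  assumes "r < s"
  shows "finite (residue_class s n r)" "card (residue_class s n r) \<in> {n div s, n div s + 1}"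
    "n div s \<le> card (residue_class s n r)" "real (card (residue_class s n r)) \<le> n / s + 1"
    "real n / s - 1 \<le> card (residue_class s n r)"
proof -
  show "finite (residue_class s n r)" by (simp add: residue_class_def)
  show card: "card (residue_class s n r) \<in> {n div s, n div s + 1}"
    unfolding residue_class_def by (rule turan_part_card[OF assms])
  then show "n div s \<le> card (residue_class s n r)" by auto
  have "real (n div s) \<le> n / s" by (rule of_nat_div_le_of_nat)
  then show "real (card (residue_class s n r)) \<le> n / s + 1" using card by auto
  have "n < s * (n div s + 1)" using assms dividend_less_times_div[of s n] by auto
  then have "real n < s * (real (n div s) + 1)" by (metis of_nat_less_iff of_nat_mult of_nat_add of_nat_1)
  then have "real n / s - 1 \<le> real (n div s)" using assms by (simp add: field_simps)
  then show "real n / s - 1 \<le> card (residue_class s n r)" using card by auto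
qed

lemma sum_residue_classes:
  assumes "0 < s" shows "(\<Sum>i<n. f (i mod s)) = (\<Sum>r<s. of_nat (card (residue_class s n r)) * f r :: 'a :: comm_semiring_1)"
proof -
  have "(\<Sum>r<s. of_nat (card (residue_class s n r)) * f r) = (\<Sum>r<s. \<Sum>i\<in>{i \<in> {..<n}. i mod s = r}. f (i mod s))"
  proof (intro sum.cong refl)
    fix r
    have "(\<Sum>i\<in>{i \<in> {..<n}. i mod s = r}. f (i mod s)) = (\<Sum>i\<in>{i \<in> {..<n}. i mod s = r}. f r)"
      by (intro sum.cong) auto
    then show "of_nat (card (residue_class s n r)) * f r = (\<Sum>i\<in>{i \<in> {..<n}. i mod s = r}. f (i mod s))"
      by (simp add: residue_class_def)
  qed
  also have "\<dots> = (\<Sum>i<n. f (i mod s))" using assms by (intro sum.group) auto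
  finally show ?thesis ..
qed

text \<open>Each class has \<open>q div s\<close> or \<open>q div s + 1\<close> elements, where \<open>ln\<close> agrees with its secant.\<close>

lemma turan_value_sum:
  assumes "0 < s" "s \<le> q" shows "(\<Sum>r<s. ln (card (residue_class s q r))) = s * turan_value s q"
proof -
  define a where "a = q div s"
  define c where "c = ln (real a + 1) - ln (real a)"
  have total: "(\<Sum>r<s. card (residue_class s q r)) = q"
    using sum_residue_classes[OF assms(1), where f = "\<lambda>_. 1 :: nat" and n = q] by simp
  have "ln (card (residue_class s q r)) = (ln a - a * c) + card (residue_class s q r) * c" if "r < s" for r
    using residue_class_facts(2)[OF that, of q] by (auto simp: c_def a_def algebra_simps)
  then have "(\<Sum>r<s. ln (card (residue_class s q r))) = (\<Sum>r<s. (ln a - a * c) + card (residue_class s q r) * c)"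
    by simp
  also have "\<dots> = s * (ln a - a * c) + real (\<Sum>r<s. card (residue_class s q r)) * c"
    by (simp add: sum.distrib sum_distrib_right)
  also have "\<dots> = s * turan_value s q"
    using assms(1) unfolding total by (simp add: turan_value_def Let_def flip: a_def c_def) (simp add: field_simps)
  finally show ?thesis .
qed

text \<open>The list of a vertex is the residue class of its residue, except that the list of the residue \<open>0\<close> is
  split for \<open>2 * t\<close> vertices: \<open>t\<close> of them only get the color \<open>0\<close>, and \<open>t\<close> of them get the others.\<close>
definition color_list :: "nat \<Rightarrow> nat \<Rightarrow> nat \<Rightarrow> nat \<Rightarrow> nat set" where
  "color_list s q t v = (let C = residue_class s q (v mod s) in
     if v mod s = 0 \<and> v div s < t then {0}
     else if v mod s = 0 \<and> v div s < 2 * t then C - {0} else C)"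

lemma disjoint_color_list:
  assumes "0 < s" shows "u mod s \<noteq> v mod s \<Longrightarrow> color_list s q t u \<inter> color_list s q t v = {}"
    and "j < t \<Longrightarrow> t \<le> k \<Longrightarrow> k < 2 * t \<Longrightarrow> color_list s q t (s * j) \<inter> color_list s q t (s * k) = {}"
  using assms by (auto simp: color_list_def residue_class_def Let_def split: if_splits)

text \<open>Join two vertices if their lists are disjoint. This is the Turan graph together with \<open>t\<^sup>2\<close> edges inside
  one part, so that edge numbers a little above that of the Turan graph are covered, whereas only the
  lists of \<open>2 * t\<close> vertices have become smaller. Removing edges does not destroy colorings.\<close>

lemma comparison_graph:
  assumes s: "0 < s" "2 * s \<le> q" and t: "2 * t \<le> n div s"
    and m: "m \<le> (real s - 1) / (2 * real s) * (real n)\<^sup>2 - n / 2 + (real t)\<^sup>2"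
  obtains H :: "nat sgraph" where "sgraph H" "card (verts H) = n" "card (edges H) = m"
    "exp (n * turan_value s q - (s + 2 * t) * ln q) \<le> card (proper_colorings q H)"
proof -
  have s0: "0 < real s" using s by simp
  let ?l = "color_list s q t"
  define E where "E = {{u, v} |u v. u < n \<and> v < n \<and> ?l u \<inter> ?l v = {}}"
  have cls: "2 \<le> card (residue_class s q r)" if "r < s" for r
  proof -
    have "2 \<le> q div s" using s by (simp add: less_eq_div_iff_mult_less_eq)
    then show "2 \<le> card (residue_class s q r)" using residue_class_facts(3)[OF that, of q] by linarith
  qed
  have lne: "1 \<le> card (?l v)" and lsub: "?l v \<subseteq> {..<q}" for v
  proof -
    have r: "v mod s < s" using s by simp
    show lsub: "?l v \<subseteq> {..<q}" using s by (auto simp: color_list_def Let_def residue_class_def)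
    have "1 \<le> card (residue_class s q (v mod s) - {0})"
      using cls[OF r] residue_class_facts(1)[OF r, of q] by (auto simp: card_Diff_singleton_if)
    moreover have "2 \<le> card (residue_class s q (v mod s))" by (rule cls[OF r])
    ultimately show "1 \<le> card (?l v)" by (auto simp: color_list_def Let_def)
  qed
  have lne': "?l v \<noteq> {}" for v using lne[of v] by auto
  have E: "E \<subseteq> nsets {..<n} 2" using lne' by (auto simp: E_def)
  have arcs: "arcs E = {(u, v) \<in> {..<n} \<times> {..<n}. ?l u \<inter> ?l v = {}}"
    by (auto simp: arcs_def E_def doubleton_eq_iff)
  define A where "A = {(u, v) \<in> {..<n} \<times> {..<n}. u mod s \<noteq> v mod s}"
  define f where "f = (\<lambda>(j, k). (s * j, s * k))"
  define B where "B = f ` ({..<t} \<times> {t..<2 * t} \<union> {t..<2 * t} \<times> {..<t})"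
  have "s * j < n" if "j < 2 * t" for j
  proof -
    have "s * j < s * (2 * t)" using that s by simp
    also have "\<dots> \<le> s * (n div s)" using t by simp
    also have "\<dots> \<le> n" by simp
    finally show ?thesis .
  qed
  then have "(s * j, s * k) \<in> arcs E \<and> (s * k, s * j) \<in> arcs E" if "j < t" "t \<le> k" "k < 2 * t" for j k
    using disjoint_color_list(2)[OF s(1) that, of q] that unfolding arcs by (simp add: Int_commute)
  then have "B \<subseteq> arcs E" by (auto simp: B_def f_def)
  moreover have "A \<subseteq> arcs E"
    unfolding arcs A_def using disjoint_color_list(1)[OF s(1), of _ _ q t] by blast
  ultimately have AB: "A \<union> B \<subseteq> arcs E" by blast
  have finA: "finite A" unfolding A_def by (rule finite_subset[of _ "{..<n} \<times> {..<n}"]) auto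
  have finB: "finite B" by (simp add: B_def)
  have "A \<inter> B = {}" by (auto simp: A_def B_def f_def)
  have cB: "card B = 2 * t\<^sup>2"
  proof -
    have "inj_on f S" for S using s by (auto simp: inj_on_def f_def)
    then have "card B = card ({..<t} \<times> {t..<2 * t} \<union> {t..<2 * t} \<times> {..<t})"
      unfolding B_def by (rule card_image)
    also have "\<dots> = 2 * t\<^sup>2"
      by (subst card_Un_disjoint) (auto simp: card_cartesian_product power2_eq_square)
    finally show ?thesis .
  qed
  have cA: "(real n)\<^sup>2 - (real n)\<^sup>2 / s - n \<le> card A"
  proof -
    let ?D = "SIGMA u:{..<n}. residue_class s n (u mod s)"
    have "A \<union> ?D = {..<n} \<times> {..<n}" by (auto simp: A_def residue_class_def)
    moreover have "A \<inter> ?D = {}" by (auto simp: A_def residue_class_def)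
    moreover have finD: "finite ?D" by (auto simp: residue_class_def)
    ultimately have "card A + card ?D = n\<^sup>2"
      using card_Un_disjoint[OF finA] by (metis card_cartesian_product card_lessThan power2_eq_square)
    moreover have "card ?D \<le> (real n)\<^sup>2 / s + n"
    proof -
      have "real (card ?D) = (\<Sum>u<n. real (card (residue_class s n (u mod s))))"
        by (subst card_SigmaI) (auto simp: residue_class_def)
      also have "\<dots> \<le> (\<Sum>u<n. n / s + 1)" using s by (intro sum_mono residue_class_facts(4)) auto
      also have "\<dots> = (real n)\<^sup>2 / s + n" by (simp add: power2_eq_square algebra_simps)
      finally show ?thesis .
    qed
    moreover have "real (n\<^sup>2) = (real n)\<^sup>2" by simp
    ultimately show ?thesis by (smt (verit) of_nat_add)
  qed
  have "card A + card B \<le> card (arcs E)"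
    using card_mono[OF _ AB] card_Un_disjoint[OF finA finB \<open>A \<inter> B = {}\<close>] arcs_subset[OF E]
    by (metis finite_SigmaI finite_lessThan finite_subset)
  also have "card (arcs E) = 2 * card E" by (rule card_arcs[OF _ E]) simp
  finally have "real (card A) + 2 * (real t)\<^sup>2 \<le> 2 * card E"
    unfolding cB by (simp flip: of_nat_power add: of_nat_le_iff[symmetric, where 'a = real] del: of_nat_le_iff)
  then have E2: "real (card A) + 2 * (real t)\<^sup>2 \<le> 2 * real (card E)" by simp
  have *: "(real s - 1) / (2 * real s) * (real n)\<^sup>2 = 1 / 2 * (real n)\<^sup>2 - 1 / 2 * ((real n)\<^sup>2 / s)"
    using s0 by (simp add: field_simps)
  have "real m \<le> 1 / 2 * (real n)\<^sup>2 - 1 / 2 * ((real n)\<^sup>2 / s) - n / 2 + (real t)\<^sup>2" using m unfolding * .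
  then have "real m \<le> card E" using cA E2 by linarith
  then have "m \<le> card E" by simp
  then obtain E' where E': "E' \<subseteq> E" "card E' = m" using obtain_subset_with_card_n by metis
  let ?H = "({..<n}, E')"
  have "(\<Pi>\<^sub>E v\<in>{..<n}. ?l v) \<subseteq> proper_colorings q ?H"
  proof
    fix c assume c: "c \<in> (\<Pi>\<^sub>E v\<in>{..<n}. ?l v)"
    have "c u \<noteq> c v" if "{u, v} \<in> E'" for u v
    proof -
      have "(u, v) \<in> arcs E" using that E'(1) by (auto simp: arcs_def)
      then have uv: "u < n" "v < n" "?l u \<inter> ?l v = {}" unfolding arcs by auto
      then have "c u \<in> ?l u" "c v \<in> ?l v" using c by auto
      then show ?thesis using uv(3) by auto
    qed
    moreover have "c \<in> {..<n} \<rightarrow>\<^sub>E {..<q}" using c lsub by (auto simp: PiE_iff)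
    ultimately show "c \<in> proper_colorings q ?H" by (auto simp: proper_colorings_def)
  qed
  moreover have "finite (proper_colorings q ?H)"
    by (rule finite_subset[of _ "{..<n} \<rightarrow>\<^sub>E {..<q}"]) (auto simp: proper_colorings_def intro: finite_PiE)
  ultimately have "card (\<Pi>\<^sub>E v\<in>{..<n}. ?l v) \<le> card (proper_colorings q ?H)" by (rule card_mono[rotated])
  then have col: "(\<Prod>v<n. real (card (?l v))) \<le> card (proper_colorings q ?H)"
    by (simp add: card_PiE flip: of_nat_prod)
  have lq: "0 \<le> ln (real q)" using s by simp
  have ln_q: "ln (card (residue_class s q r)) \<le> ln q" "0 \<le> ln (card (residue_class s q r))" if "r < s" for r
  proof -
    have "card (residue_class s q r) \<le> card {..<q}" by (intro card_mono) (auto simp: residue_class_def)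
    then show "ln (card (residue_class s q r)) \<le> ln q" using cls[OF that] by (intro ln_mono) auto
    show "0 \<le> ln (card (residue_class s q r))" using cls[OF that] by simp
  qed
  have "n * turan_value s q - (s + 2 * t) * ln q \<le> (\<Sum>v<n. ln (card (?l v)))"
  proof -
    let ?S = "{v \<in> {..<n}. v mod s = 0 \<and> v div s < 2 * t}"
    have "ln (card (residue_class s q (v mod s))) - (if v \<in> ?S then ln q else 0) \<le> ln (card (?l v))"
      if "v < n" for v
    proof (cases "v \<in> ?S")
      case True
      then show ?thesis using ln_q(1)[of "v mod s"] s lne[of v] by (smt (verit) ln_ge_zero mod_less_divisor of_nat_1 of_nat_le_iff)
    next
      case False
      then have "?l v = residue_class s q (v mod s)" using that by (auto simp: color_list_def Let_def)
      then show ?thesis unfolding if_not_P[OF False] by simp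
    qed
    then have "(\<Sum>v<n. ln (card (residue_class s q (v mod s))) - (if v \<in> ?S then ln q else 0)) \<le> (\<Sum>v<n. ln (card (?l v)))"
      by (intro sum_mono) auto
    moreover have "(\<Sum>v<n. ln (card (residue_class s q (v mod s))) - (if v \<in> ?S then ln q else 0))
        = (\<Sum>v<n. ln (card (residue_class s q (v mod s)))) - card ?S * ln q"
      by (simp add: sum_subtractf sum.If_cases Int_def)
    moreover have "card ?S * ln q \<le> (2 * t) * ln q"
    proof -
      have "?S \<subseteq> (\<lambda>j. s * j) ` {..<2 * t}"
      proof
        fix v assume v: "v \<in> ?S"
        then have "v = s * (v div s)" using mult_div_mod_eq[of s v] by simp
        then show "v \<in> (\<lambda>j. s * j) ` {..<2 * t}" using v by blast
      qed
      then have "card ?S \<le> 2 * t" using surj_card_le[of "{..<2 * t}" ?S] by simp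
      then show ?thesis using lq by (intro mult_right_mono) auto
    qed
    moreover have "n * turan_value s q - s * ln q \<le> (\<Sum>v<n. ln (card (residue_class s q (v mod s))))"
    proof -
      have "n * turan_value s q - s * ln q = (\<Sum>r<s. n / s * ln (card (residue_class s q r)) - ln q)"
      proof -
        have "(\<Sum>r<s. n / s * ln (card (residue_class s q r))) = n / s * (s * turan_value s q)"
          unfolding sum_distrib_left[symmetric] using s by (subst turan_value_sum) auto
        then show ?thesis using s by (simp add: sum_subtractf)
      qed
      also have "\<dots> \<le> (\<Sum>r<s. card (residue_class s n r) * ln (card (residue_class s q r)))"
      proof (rule sum_mono)
        fix r assume "r \<in> {..<s}"
        then have r: "r < s" by simp
        have "(n / s - 1) * ln (card (residue_class s q r)) \<le> card (residue_class s n r) * ln (card (residue_class s q r))"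
          using residue_class_facts(5)[OF r] ln_q(2)[OF r] by (intro mult_right_mono)
        then show "n / s * ln (card (residue_class s q r)) - ln q \<le> card (residue_class s n r) * ln (card (residue_class s q r))"
          using ln_q(1)[OF r] by (simp add: algebra_simps)
      qed
      also have "\<dots> = (\<Sum>v<n. ln (card (residue_class s q (v mod s))))"
        using sum_residue_classes[OF s(1), where f = "\<lambda>r. ln (card (residue_class s q r))"] by simp
      finally show ?thesis .
    qed
    ultimately show ?thesis by (simp add: algebra_simps)
  qed
  also have "\<dots> = ln (\<Prod>v<n. real (card (?l v)))"
    using lne by (subst ln_prod) (auto simp: Suc_le_eq card_gt_0_iff)
  finally have "exp (n * turan_value s q - (s + 2 * t) * ln q) \<le> exp (ln (\<Prod>v<n. real (card (?l v))))" by simp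
  also have "\<dots> = (\<Prod>v<n. real (card (?l v)))"
    using lne by (intro exp_ln prod_pos) (auto simp: Suc_le_eq)
  finally have "exp (n * turan_value s q - (s + 2 * t) * ln q) \<le> card (proper_colorings q ?H)"
    using col by linarith
  moreover have "sgraph ?H" using E E'(1) by (auto simp: sgraph_def)
  ultimately show thesis using that[of ?H] E'(2) by simp
qed

section \<open>Edit distance to the Turan graph\<close>

text \<open>For each label \<open>c\<close> as many elements as possible with this label are matched with each other; the
  remaining elements are matched arbitrarily.\<close>

lemma matching_bijection:
  assumes fin: "finite V" "finite N" and card: "card V = card N"
    and C: "finite C" "r ` N \<subseteq> C"
  obtains f where "bij_betw f V N"
    "card {v \<in> V. l v \<noteq> r (f v)} \<le> (\<Sum>c\<in>C. card {i \<in> N. r i = c} - card {v \<in> V. l v = c})"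
proof -
  define Vc where "Vc c = {v \<in> V. l v = c}" for c
  define Nc where "Nc c = {i \<in> N. r i = c}" for c
  have fc: "finite (Vc c)" "finite (Nc c)" for c using fin by (auto simp: Vc_def Nc_def)
  have "\<exists>A B g. A \<subseteq> Vc c \<and> B \<subseteq> Nc c \<and> card B = min (card (Vc c)) (card (Nc c)) \<and> bij_betw g A B" for c
  proof -
    define k where "k = min (card (Vc c)) (card (Nc c))"
    have "k \<le> card (Vc c)" "k \<le> card (Nc c)" by (simp_all add: k_def)
    then obtain A B where A: "A \<subseteq> Vc c" "card A = k" and B: "B \<subseteq> Nc c" "card B = k"
      by (meson obtain_subset_with_card_n)
    have "finite A" "finite B" using A B fc finite_subset by blast+
    then obtain g where "bij_betw g A B" using A(2) B(2) finite_same_card_bij by metis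
    then show ?thesis using A B unfolding k_def by blast
  qed
  then obtain A B g where ABg: "\<And>c. A c \<subseteq> Vc c" "\<And>c. B c \<subseteq> Nc c"
    "\<And>c. card (B c) = min (card (Vc c)) (card (Nc c))" "\<And>c. bij_betw (g c) (A c) (B c)" by metis
  define V' where "V' = (\<Union>c\<in>C. A c)"
  define N' where "N' = (\<Union>c\<in>C. B c)"
  have V': "V' \<subseteq> V" and N': "N' \<subseteq> N" using ABg(1,2) by (auto simp: V'_def N'_def Vc_def Nc_def)
  have lab: "l v = c" if "v \<in> A c" for v c using that ABg(1) by (auto simp: Vc_def)
  have labN: "r i = c" if "i \<in> B c" for i c using that ABg(2) by (auto simp: Nc_def)
  define g' where "g' v = g (l v) v" for v
  have g'A: "bij_betw g' (A c) (B c)" for c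
    using ABg(4)[of c] by (rule bij_betw_cong[THEN iffD1, rotated]) (simp add: g'_def lab)
  have g': "bij_betw g' V' N'"
    unfolding V'_def N'_def
  proof (rule bij_betw_UNION_disjoint)
    show "disjoint_family_on B C" using labN by (auto simp: disjoint_family_on_def)
  qed (rule g'A)
  have "B c \<inter> B c' = {}" if "c \<noteq> c'" for c c' using that labN by blast
  then have "card N' = (\<Sum>c\<in>C. card (B c))"
    unfolding N'_def using C(1) finite_subset[OF ABg(2) fc(2)] by (intro card_UN_disjoint) auto
  moreover have "card N = (\<Sum>c\<in>C. card (Nc c))"
  proof -
    have "N = (\<Union>c\<in>C. Nc c)" using C(2) by (auto simp: Nc_def)
    then have "card N = card (\<Union>c\<in>C. Nc c)" by (rule arg_cong)
    also have "\<dots> = (\<Sum>c\<in>C. card (Nc c))" using C(1) fc by (intro card_UN_disjoint) (auto simp: Nc_def)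
    finally show ?thesis .
  qed
  ultimately have rest: "card (N - N') = (\<Sum>c\<in>C. card (Nc c) - card (Vc c))"
  proof -
    assume c1: "card N' = (\<Sum>c\<in>C. card (B c))" and c2: "card N = (\<Sum>c\<in>C. card (Nc c))"
    have "card N = (\<Sum>c\<in>C. (card (Nc c) - card (Vc c)) + card (B c))"
      unfolding c2 ABg(3) by (intro sum.cong refl) auto
    then have "card N = (\<Sum>c\<in>C. card (Nc c) - card (Vc c)) + card N'" by (simp add: c1 sum.distrib)
    then show ?thesis using card_Diff_subset[of N' N] N' finite_subset[OF N' fin(2)] by simp
  qed
  have "card V' = card N'" using g' by (rule bij_betw_same_card)
  then have "card (V - V') = card (N - N')"
    using card V' N' finite_subset[OF V' fin(1)] finite_subset[OF N' fin(2)]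
    by (simp add: card_Diff_subset)
  then obtain h where h: "bij_betw h (V - V') (N - N')"
    using finite_same_card_bij fin by (metis finite_Diff)
  define f where "f v = (if v \<in> V' then g' v else h v)" for v
  have "bij_betw f (V' \<union> (V - V')) (N' \<union> (N - N'))"
    unfolding f_def using g' h by (intro bij_betw_disjoint_Un) auto
  then have f: "bij_betw f V N" using V' N' by (simp add: Un_absorb1)
  have "{v \<in> V. l v \<noteq> r (f v)} \<subseteq> V - V'"
  proof -
    have "l v = r (f v)" if "v \<in> V'" for v
    proof -
      obtain c where c: "c \<in> C" "v \<in> A c" using \<open>v \<in> V'\<close> by (auto simp: V'_def)
      have "g' v \<in> B c" using g'A[of c] c(2) by (auto simp: bij_betw_def)
      then show ?thesis using labN lab c(2) that by (simp add: f_def)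
    qed
    then show ?thesis by auto
  qed
  then have "card {v \<in> V. l v \<noteq> r (f v)} \<le> card (N - N')"
    using \<open>card (V - V') = card (N - N')\<close> fin by (metis card_mono finite_Diff)
  then show thesis using that[OF f] rest by (simp add: Vc_def Nc_def)
qed

lemma collisions_ge:
  fixes g :: "'a \<Rightarrow> nat"
  assumes "finite V" "\<And>v. v \<in> V \<Longrightarrow> g v < s" "0 < s"
  shows "(real (card V))\<^sup>2 / s \<le> card {(u, v) \<in> V \<times> V. g u = g v}"
proof -
  let ?W = "\<lambda>r. {v \<in> V. g v = r}"
  have "card V = (\<Sum>r<s. card (?W r))"
  proof -
    have "V = (\<Union>r<s. ?W r)" using assms(2) by auto
    then have "card V = card (\<Union>r<s. ?W r)" by (rule arg_cong)
    also have "\<dots> = (\<Sum>r<s. card (?W r))" using assms(1) by (intro card_UN_disjoint) auto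
    finally show ?thesis .
  qed
  then have "(real (card V))\<^sup>2 = (\<Sum>r<s. 1 * real (card (?W r)))\<^sup>2" by simp
  also have "\<dots> \<le> (\<Sum>r<s. 1\<^sup>2) * (\<Sum>r<s. (real (card (?W r)))\<^sup>2)" by (rule Cauchy_Schwarz_ineq_sum)
  also have "(\<Sum>r<s. (real (card (?W r)))\<^sup>2) = card {(u, v) \<in> V \<times> V. g u = g v}"
  proof -
    have "{(u, v) \<in> V \<times> V. g u = g v} = (\<Union>r<s. ?W r \<times> ?W r)" using assms(2) by auto
    then have "card {(u, v) \<in> V \<times> V. g u = g v} = card (\<Union>r<s. ?W r \<times> ?W r)" by (rule arg_cong)
    also have "\<dots> = (\<Sum>r<s. card (?W r \<times> ?W r))"
      using assms(1) by (intro card_UN_disjoint) auto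
    finally have "card {(u, v) \<in> V \<times> V. g u = g v} = (\<Sum>r<s. card (?W r \<times> ?W r))" .
    then show ?thesis by (simp add: card_cartesian_product power2_eq_square)
  qed
  finally show ?thesis using assms(3) by (simp add: divide_le_eq mult.commute)
qed

text \<open>Transport the Turan graph along \<open>f\<close>. It has at most \<open>(s - 1) / (2 * s) * n\<^sup>2\<close> edges, so that its edges
  missing in \<open>G\<close> are, up to \<open>\<eta> * n\<^sup>2\<close>, outnumbered by the edges of \<open>G\<close> inside the parts. The factor
  \<open>2\<close> this causes is absorbed because \<open>b\<close> counts ordered pairs.\<close>

lemma edit_distance_turan_le:
  fixes b \<eta> :: real
  assumes G: "sgraph G" and f: "bij_betw f (verts G) {..<n}" and "0 < s"
    and edges: "((real s - 1) / (2 * real s) - \<eta>) * (real n)\<^sup>2 \<le> card (edges G)"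
    and inside: "card {(u, v) \<in> arcs (edges G). f u mod s = f v mod s} \<le> b"
  shows "edit_distance G (turan_graph s n) \<le> \<eta> * (real n)\<^sup>2 + b"
proof -
  let ?V = "verts G"
  have fV: "finite ?V" using G by (simp add: sgraph_def)
  have E: "edges G \<subseteq> nsets ?V 2" using G by (simp add: sgraph_def)
  have cV: "card ?V = n" using bij_betw_same_card[OF f] by simp
  define F where "F = {{u, v} |u v. u \<in> ?V \<and> v \<in> ?V \<and> f u mod s \<noteq> f v mod s}"
  have F: "F \<subseteq> nsets ?V 2" by (auto simp: F_def)
  have inF: "{u, v} \<in> F \<longleftrightarrow> u \<in> ?V \<and> v \<in> ?V \<and> f u mod s \<noteq> f v mod s" for u v
    by (auto simp: F_def doubleton_eq_iff)
  have inT: "{i, j} \<in> edges (turan_graph s n) \<longleftrightarrow> i < n \<and> j < n \<and> i mod s \<noteq> j mod s" for i j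
    by (auto simp: turan_graph_def doubleton_eq_iff)
  have fl: "f u < n" if "u \<in> ?V" for u using f that by (auto simp: bij_betw_def)
  have "sgraph_iso (?V, F) (turan_graph s n)"
    unfolding sgraph_iso_def
    using f by (intro exI[of _ f]) (auto simp: inF inT fl, auto simp: turan_graph_def)
  moreover have "sgraph (?V, F)" using F fV by (simp add: sgraph_def)
  ultimately have le: "edit_distance G (turan_graph s n) \<le> card ((edges G - F) \<union> (F - edges G))"
    unfolding edit_distance_def by (intro Least_le) blast
  have fin: "finite (edges G)" "finite F"
    using E F fV finite_imp_finite_nsets finite_subset by blast+
  have "card ((edges G - F) \<union> (F - edges G)) = card (edges G - F) + card (F - edges G)"
    using fin by (intro card_Un_disjoint) auto
  moreover have "card (edges G) = card (edges G - F) + card (edges G \<inter> F)"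
    "card F = card (F - edges G) + card (edges G \<inter> F)"
    using card_Int_Diff[of "edges G" F] card_Int_Diff[of F "edges G"] fin by (auto simp: Int_commute)
  ultimately have sym: "real (card ((edges G - F) \<union> (F - edges G)))
      = real (card F) - card (edges G) + 2 * card (edges G - F)" by linarith
  have "2 * card (edges G - F) = card (arcs (edges G - F))"
    by (rule card_arcs[OF fV, symmetric]) (use E in auto)
  also have "arcs (edges G - F) = {(u, v) \<in> arcs (edges G). f u mod s = f v mod s}"
    using arcs_subset[OF E] by (auto simp: arcs_def inF)
  finally have "real (2 * card (edges G - F)) \<le> b" using inside by simp
  moreover have "2 * real (card F) \<le> (real n)\<^sup>2 - (real n)\<^sup>2 / s"
  proof -
    let ?D = "{(u, v) \<in> ?V \<times> ?V. f u mod s = f v mod s}"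
    have un: "arcs F \<union> ?D = ?V \<times> ?V" and int: "arcs F \<inter> ?D = {}" by (auto simp: arcs_def inF)
    have "finite (arcs F \<union> ?D)" unfolding un using fV by simp
    then have "finite (arcs F)" "finite ?D" by simp_all
    then have "card (arcs F \<union> ?D) = card (arcs F) + card ?D"
      using int by (rule card_Un_disjoint)
    then have "card (?V \<times> ?V) = card (arcs F) + card ?D" unfolding un .
    then have "n\<^sup>2 = card (arcs F) + card ?D" by (simp only: card_cartesian_product cV power2_eq_square)
    then have "(real n)\<^sup>2 = real (card (arcs F)) + card ?D" by (simp flip: of_nat_power)
    moreover have "(real (card ?V))\<^sup>2 / s \<le> card ?D"
      using fV \<open>0 < s\<close> by (intro collisions_ge) auto
    ultimately have "real (card (arcs F)) \<le> (real n)\<^sup>2 - (real n)\<^sup>2 / s"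
      unfolding cV by linarith
    then show ?thesis using card_arcs[OF fV F] by simp
  qed
  moreover have "(real n)\<^sup>2 - (real n)\<^sup>2 / s = 2 * ((real s - 1) / (2 * real s) * (real n)\<^sup>2)"
    using \<open>0 < s\<close> by (simp add: field_simps)
  ultimately have "2 * real (card F) \<le> 2 * ((real s - 1) / (2 * real s) * (real n)\<^sup>2)"
    "2 * real (card (edges G - F)) \<le> b" by simp_all
  then have "real (card ((edges G - F) \<union> (F - edges G))) \<le> \<eta> * (real n)\<^sup>2 + b"
    using sym edges unfolding left_diff_distrib by linarith
  then show ?thesis using le by linarith
qed

section \<open>Extremal graphs are close to the Turan graph\<close>

text \<open>Send the vertices with list \<open>A \<in> P\<close> to one residue class as far as possible. An edge inside a
  residue class then contains one of the few exceptional vertices, or joins two vertices with the same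
  nonempty list and is bad.\<close>

lemma near_partition_edit_distance:
  fixes \<rho> \<eta> \<beta> :: real
  assumes G: "sgraph G" "card (verts G) = n" "0 < n" and "0 < s"
    and L: "L ` verts G \<subseteq> color_sets q"
    and P: "P \<subseteq> color_sets q" "card P = s"
    and near: "(\<Sum>A\<in>color_sets q. \<bar>label_distr (verts G) L A - (if A \<in> P then 1 / s else 0)\<bar>) < \<rho>"
    and edges: "((real s - 1) / (2 * real s) - \<eta>) * (real n)\<^sup>2 \<le> card (edges G)"
    and bad: "card (bad_arcs G L) \<le> \<beta>"
  shows "edit_distance G (turan_graph s n) \<le> \<eta> * (real n)\<^sup>2 + (2 * (\<rho> * n + s) * n + \<beta>)"
proof -
  let ?V = "verts G"
  have fV: "finite ?V" using G by (simp add: sgraph_def)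
  have fP: "finite P" using P(1) finite_subset finite_color_sets by blast
  then obtain \<sigma> where \<sigma>: "bij_betw \<sigma> P {..<s}"
    using P(2) finite_same_card_bij[of P "{..<s}"] by auto
  define l where "l v = (if L v \<in> P then \<sigma> (L v) else s)" for v
  have \<sigma>less: "\<sigma> A < s" if "A \<in> P" for A using \<sigma> that by (auto simp: bij_betw_def)
  obtain f where f: "bij_betw f ?V {..<n}"
    and mis: "card {v \<in> ?V. l v \<noteq> f v mod s}
      \<le> (\<Sum>c<s. card {i \<in> {..<n}. i mod s = c} - card {v \<in> ?V. l v = c})"
    by (rule matching_bijection[of ?V "{..<n}" "{..<s}" "\<lambda>i. i mod s" l])
       (use fV G(2) \<open>0 < s\<close> in auto)
  define X where "X = {v \<in> ?V. l v \<noteq> f v mod s}"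
  have "real (card X) \<le> (\<Sum>c<s. real (card {i \<in> {..<n}. i mod s = c} - card {v \<in> ?V. l v = c}))"
    unfolding X_def of_nat_sum[symmetric] of_nat_le_iff by (rule mis)
  also have "\<dots> = (\<Sum>A\<in>P. real (card {i \<in> {..<n}. i mod s = \<sigma> A} - card {v \<in> ?V. l v = \<sigma> A}))"
    by (rule sum.reindex_bij_betw[OF \<sigma>, symmetric])
  also have "\<dots> \<le> (\<Sum>A\<in>P. n * \<bar>label_distr ?V L A - 1 / s\<bar> + 1)"
  proof (rule sum_mono)
    fix A assume A: "A \<in> P"
    have "{v \<in> ?V. l v = \<sigma> A} = {v \<in> ?V. L v = A}"
    proof (intro Collect_cong conj_cong refl)
      fix v
      show "l v = \<sigma> A \<longleftrightarrow> L v = A"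
        using A \<sigma> \<sigma>less[OF A] by (auto simp: l_def bij_betw_def inj_on_def)
    qed
    then have c: "real (card {v \<in> ?V. l v = \<sigma> A}) = n * label_distr ?V L A"
      using G(2,3) by (simp add: label_distr_def)
    have "real (card {i \<in> {..<n}. i mod s = \<sigma> A}) \<le> n / s + 1"
      using residue_class_facts(4)[OF \<sigma>less[OF A], of n] by (simp add: residue_class_def)
    moreover have "n / s - n * label_distr ?V L A \<le> n * \<bar>label_distr ?V L A - 1 / s\<bar>"
    proof -
      have "n * (1 / s - label_distr ?V L A) \<le> n * \<bar>label_distr ?V L A - 1 / s\<bar>"
        by (intro mult_left_mono) auto
      then show ?thesis by (simp add: algebra_simps)
    qed
    moreover have "0 \<le> n * \<bar>label_distr ?V L A - 1 / s\<bar> + 1" by simp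
    moreover have "real (a - b) \<le> z" if "real a - real b \<le> z" "0 \<le> z" for a b z
      using that by (cases "b \<le> a") (auto simp: of_nat_diff)
    ultimately show "real (card {i \<in> {..<n}. i mod s = \<sigma> A} - card {v \<in> ?V. l v = \<sigma> A})
        \<le> n * \<bar>label_distr ?V L A - 1 / s\<bar> + 1"
      using c by (smt (verit, best))
  qed
  also have "\<dots> = n * (\<Sum>A\<in>P. \<bar>label_distr ?V L A - 1 / s\<bar>) + s"
    by (simp add: sum.distrib sum_distrib_left P(2))
  also have "n * (\<Sum>A\<in>P. \<bar>label_distr ?V L A - 1 / s\<bar>) + s \<le> n * \<rho> + s"
  proof -
    have "(\<Sum>A\<in>P. \<bar>label_distr ?V L A - 1 / s\<bar>)
        = (\<Sum>A\<in>P. \<bar>label_distr ?V L A - (if A \<in> P then 1 / s else 0)\<bar>)" by simp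
    also have "\<dots> \<le> (\<Sum>A\<in>color_sets q. \<bar>label_distr ?V L A - (if A \<in> P then 1 / s else 0)\<bar>)"
      using P(1) by (intro sum_mono2) auto
    finally have "(\<Sum>A\<in>P. \<bar>label_distr ?V L A - 1 / s\<bar>) \<le> \<rho>" using near by linarith
    then show ?thesis by (intro add_right_mono mult_left_mono) auto
  qed
  finally have X: "card X \<le> \<rho> * n + s" by (simp add: mult.commute)
  let ?I = "{(u, v) \<in> arcs (edges G). f u mod s = f v mod s}"
  have sub: "?I \<subseteq> X \<times> ?V \<union> ?V \<times> X \<union> bad_arcs G L"
  proof
    fix p assume "p \<in> ?I"
    then obtain u v where p: "p = (u, v)" and uv: "(u, v) \<in> arcs (edges G)" "f u mod s = f v mod s" by blast
    have V: "u \<in> ?V" "v \<in> ?V" using uv(1) arcs_subset[of "edges G" ?V] G(1) by (auto simp: sgraph_def)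
    show "p \<in> X \<times> ?V \<union> ?V \<times> X \<union> bad_arcs G L"
    proof (rule ccontr)
      assume not: "\<not> ?thesis"
      then have "l u = f u mod s" "l v = f v mod s" using V by (auto simp: X_def p)
      then have "l u = l v" "l u < s" using uv(2) \<open>0 < s\<close> by auto
      then have "L u \<in> P" "L v \<in> P" "\<sigma> (L u) = \<sigma> (L v)" by (auto simp: l_def split: if_splits)
      then have "L u = L v" using \<sigma> by (auto simp: bij_betw_def inj_on_def)
      moreover have "L u \<noteq> {}" using L V(1) color_setsD(2) by blast
      ultimately show False using uv(1) not by (simp add: bad_arcs_def p)
    qed
  qed
  have "arcs (edges G) \<subseteq> ?V \<times> ?V" using arcs_subset G(1) unfolding sgraph_def by blast
  then have fin: "finite (arcs (edges G))" using fV finite_subset by blast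
  then have finb: "finite (bad_arcs G L)" by (rule rev_finite_subset) (auto simp: bad_arcs_def)
  have finX: "finite X" using fV by (simp add: X_def)
  have "card ?I \<le> card (X \<times> ?V \<union> ?V \<times> X \<union> bad_arcs G L)"
    using finX fV finb by (intro card_mono[OF _ sub]) auto
  also have "\<dots> \<le> card (X \<times> ?V) + card (?V \<times> X) + card (bad_arcs G L)"
    by (intro order_trans[OF card_Un_le] add_mono card_Un_le order_refl)
  also have "\<dots> = 2 * card X * n + card (bad_arcs G L)" using G(2) by (simp add: card_cartesian_product)
  finally have "real (card ?I) \<le> real (2 * card X * n + card (bad_arcs G L))" by (simp only: of_nat_le_iff)
  also have "\<dots> \<le> 2 * (\<rho> * n + s) * n + \<beta>"
    using X bad by (simp add: mult_right_mono add_mono)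
  finally show ?thesis
    using edit_distance_turan_le[OF G(1) f \<open>0 < s\<close> edges] by blast
qed

lemma large_quotient_if_large:
  "\<exists>s0 :: nat. \<forall>s q :: nat. s0 \<le> s \<longrightarrow> 100 * (real s)\<^sup>2 / ln s \<le> q \<longrightarrow> large_quotient s q \<and> 2 * s \<le> q"
proof -
  have "\<forall>\<^sub>F s :: nat in sequentially. 0 < s \<and> 1 \<le> ln (real s) \<and> 100 * (ln (real s))\<^sup>2 \<le> sqrt s
      \<and> sqrt s \<le> 100 * real s / ln s \<and> 2 \<le> 100 * real s / ln s"
    by (intro eventually_conj) real_asymp+
  then obtain s0 where s0: "\<And>s :: nat. s0 \<le> s \<Longrightarrow> 0 < s \<and> 1 \<le> ln (real s) \<and> 100 * (ln (real s))\<^sup>2 \<le> sqrt s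
      \<and> sqrt s \<le> 100 * real s / ln s \<and> 2 \<le> 100 * real s / ln s"
    unfolding eventually_sequentially by blast
  show ?thesis
  proof (intro exI[of _ s0] allI impI)
    fix s q :: nat assume "s0 \<le> s" and q: "100 * (real s)\<^sup>2 / ln s \<le> real q"
    note s = s0[OF \<open>s0 \<le> s\<close>]
    define M where "M = real q / s"
    have M: "100 * real s / ln s \<le> M"
      using q s by (simp add: M_def field_simps power2_eq_square)
    have "sqrt s \<le> M" "2 \<le> M" using M s by linarith+
    have "1000000 * (s * sqrt s) * (ln s)\<^sup>2 = 10000 * (s * sqrt s) * (100 * (ln s)\<^sup>2)" by simp
    also have "\<dots> \<le> 10000 * (s * sqrt s) * sqrt s" using s by (intro mult_left_mono) auto
    also have "\<dots> = (100 * real s)\<^sup>2" by (simp add: power2_eq_square)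
    finally have "1000000 * (s * sqrt s) * (ln s)\<^sup>2 \<le> (100 * real s)\<^sup>2" .
    moreover have "0 < (ln (real s))\<^sup>2" using s by (intro zero_less_power) linarith
    ultimately have "1000000 * (s * sqrt s) \<le> (100 * real s / ln s)\<^sup>2"
      unfolding power_divide by (subst pos_le_divide_eq)
    also have "\<dots> \<le> M\<^sup>2" using M s by (intro power_mono) auto
    finally have "1000000 * (s * sqrt s) \<le> M\<^sup>2" .
    moreover have "50 * s \<le> M * ln M"
    proof -
      have "ln s / 2 = ln (sqrt s)" using s by (simp add: ln_sqrt)
      also have "\<dots> \<le> ln M" using \<open>sqrt s \<le> M\<close> s by (intro ln_mono) auto
      finally have "100 * real s / ln s * (ln s / 2) \<le> M * ln M" using M \<open>2 \<le> M\<close> s by (intro mult_mono) auto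
      moreover have "ln (real s) \<noteq> 0" using s by linarith
      ultimately show ?thesis by (simp only: times_divide_times_eq) simp
    qed
    moreover have "2 * s \<le> q"
    proof -
      have "2 * real s \<le> q" using \<open>2 \<le> M\<close> s by (simp add: M_def field_simps)
      then show ?thesis by linarith
    qed
    ultimately show "large_quotient s q \<and> 2 * s \<le> q"
      using s by (auto simp: large_quotient_def M_def)
  qed
qed

text \<open>The parameter \<open>\<theta>\<close> is the proportion of vertices whose lists are reduced in the comparison graph. It
  costs \<open>2 * \<theta> * ln q\<close> in the exponential rate and gains \<open>\<theta>\<^sup>2 * n\<^sup>2\<close> edges, half of which, \<open>\<eta> * n\<^sup>2\<close>, is the
  allowed deviation, while the other half makes up for terms that are linear in \<open>n\<close>.\<close>

lemma extremal_close_to_turan: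
  assumes sq: "large_quotient s q" "2 * s \<le> q" and "0 < \<epsilon>"
  shows "\<exists>\<eta> > 0. \<exists>n0 :: nat. \<forall>n \<ge> n0. \<forall>G :: nat sgraph.
       extremal q G \<and> card (verts G) = n \<and>
       \<bar>real (card (edges G)) - (real s - 1) / (2 * real s) * (real n)\<^sup>2\<bar> \<le> \<eta> * (real n)\<^sup>2 \<longrightarrow>
       close_to (\<epsilon> * (real n)\<^sup>2) G (turan_graph s n)"
proof -
  have s: "0 < s" using sq by (simp add: large_quotient_def)
  have q: "0 < q" using s sq by simp
  have lq: "0 \<le> ln (real q)" using q by simp
  obtain \<tau> where \<tau>: "0 < \<tau>" and stab:
    "\<And>\<alpha>. distribution q \<alpha> \<Longrightarrow> clash q \<alpha> \<le> 1 / s + \<tau> \<Longrightarrow> turan_value s q - \<tau> \<le> log_size q \<alpha> \<Longrightarrow>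
      \<exists>P\<subseteq>color_sets q. card P = s \<and> disjoint P \<and>
        (\<Sum>A\<in>color_sets q. \<bar>\<alpha> A - (if A \<in> P then 1 / s else 0)\<bar>) < \<epsilon> / 8"
    using stability[OF sq(1), of "\<epsilon> / 8"] \<open>0 < \<epsilon>\<close> by auto
  define \<delta> where "\<delta> = min \<tau> \<epsilon> / (8 * q)"
  define \<theta> where "\<theta> = Min {1 / (4 * s), \<tau> / (8 * (ln q + 1)), \<tau> / 4, \<epsilon> / 4, 1}"
  define \<eta> where "\<eta> = \<theta>\<^sup>2 / 2"
  define k where "k = nat \<lfloor>1 / \<delta>\<rfloor>"
  have \<delta>: "0 < \<delta>" "q * \<delta> \<le> \<tau> / 4" "q * \<delta> \<le> \<epsilon> / 8"
    using \<tau> \<open>0 < \<epsilon>\<close> q by (auto simp: \<delta>_def)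
  have "\<theta> \<le> x" if "x \<in> {1 / (4 * s), \<tau> / (8 * (ln q + 1)), \<tau> / 4, \<epsilon> / 4, 1}" for x
    unfolding \<theta>_def using that by (intro Min_le) auto
  then have \<theta>_le: "\<theta> \<le> 1 / (4 * s)" "\<theta> \<le> \<tau> / (8 * (ln q + 1))" "\<theta> \<le> \<tau> / 4" "\<theta> \<le> \<epsilon> / 4" "\<theta> \<le> 1"
    by blast+
  have "0 < \<theta>"
    using \<tau> \<open>0 < \<epsilon>\<close> s lq by (auto simp: \<theta>_def intro!: divide_pos_pos)
  note \<theta> = this \<theta>_le
  have "\<theta>\<^sup>2 \<le> \<theta>" using \<theta> by (simp add: power2_eq_square mult_left_le)
  then have \<eta>: "\<eta> \<le> \<tau> / 8" "\<eta> \<le> \<epsilon> / 8"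
    unfolding \<eta>_def using \<theta>(4,5) by linarith+
  have \<eta>_pos: "0 < \<eta>" using \<theta>(1) by (simp add: \<eta>_def)
  have large: "\<forall>\<^sub>F n in sequentially. c \<le> real n" for c
    using filterlim_real_sequentially by (simp add: filterlim_at_top)
  have "(\<lambda>n. real (k * q) * ln (real n + 1) / real n) \<longlonglongrightarrow> 0" by real_asymp
  from order_tendstoD(2)[OF this, of "\<tau> / 2"]
  have "\<forall>\<^sub>F n in sequentially. real (k * q) * ln (real n + 1) / real n < \<tau> / 2" using \<tau> by simp
  then have "\<forall>\<^sub>F n in sequentially. 0 < n \<and> real (k * q) * ln (real n + 1) / real n < \<tau> / 2
      \<and> (1 + 4 * \<theta>) / \<theta>\<^sup>2 \<le> real n \<and> 2 * real s \<le> real n \<and> 4 * s * ln q / \<tau> \<le> real n \<and> 4 * s / \<epsilon> \<le> real n"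
    by (intro eventually_conj large eventually_gt_at_top)
  then obtain n0 where n0: "\<And>n. n0 \<le> n \<Longrightarrow> 0 < n \<and> real (k * q) * ln (real n + 1) / real n < \<tau> / 2
      \<and> (1 + 4 * \<theta>) / \<theta>\<^sup>2 \<le> real n \<and> 2 * real s \<le> real n \<and> 4 * s * ln q / \<tau> \<le> real n \<and> 4 * s / \<epsilon> \<le> real n"
    unfolding eventually_sequentially by blast
  have "close_to (\<epsilon> * (real n)\<^sup>2) G (turan_graph s n)"
    if "n0 \<le> n" and G: "extremal q G" "card (verts G) = n"
      and m: "\<bar>real (card (edges G)) - (real s - 1) / (2 * real s) * (real n)\<^sup>2\<bar> \<le> \<eta> * (real n)\<^sup>2"
    for n and G :: "nat sgraph"
  proof -
    note n = n0[OF \<open>n0 \<le> n\<close>]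
    have sG: "sgraph G" using G(1) by (simp add: extremal_def)
    define t where "t = nat \<lfloor>\<theta> * n\<rfloor>"
    have t: "real t \<le> \<theta> * n" "\<theta> * n - 1 \<le> real t" using \<theta>(1) by (auto simp: t_def)
    have colorings: "exp (n * (turan_value s q - \<tau> / 2)) \<le> card (proper_colorings q G)"
    proof -
      have t_div: "2 * t \<le> n div s"
      proof -
        have "real (2 * t) \<le> 2 * (1 / (4 * s)) * n" using t(1) mult_right_mono[OF \<theta>(2), of n] by simp
        also have "\<dots> \<le> n / s - 1" using n s by (simp add: field_simps)
        finally have "real (2 * t + 1) \<le> n / s" by simp
        then have "(2 * t + 1) * s \<le> n" using s by (simp add: field_simps del: of_nat_add of_nat_mult flip: of_nat_mult)
        then show ?thesis using s by (simp add: less_eq_div_iff_mult_less_eq)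
      qed
      have m_le: "card (edges G) \<le> (real s - 1) / (2 * real s) * (real n)\<^sup>2 - n / 2 + (real t)\<^sup>2"
      proof -
        have tn: "1 + 4 * \<theta> \<le> \<theta>\<^sup>2 * n" using n \<theta>(1) by (simp add: divide_le_eq mult.commute)
        have "1 \<le> \<theta> * n"
        proof -
          have "\<theta> * (\<theta> * n) \<le> 1 * (\<theta> * n)" using \<theta> by (intro mult_right_mono) auto
          moreover have "1 + 4 * \<theta> \<le> \<theta> * (\<theta> * n)" using tn by (simp only: power2_eq_square mult.assoc)
          ultimately show ?thesis using \<theta>(1) by linarith
        qed
        then have "(\<theta> * n - 1)\<^sup>2 \<le> (real t)\<^sup>2" using t(2) by (intro power_mono) auto
        moreover have "(\<theta> * n - 1)\<^sup>2 = \<theta>\<^sup>2 * (real n)\<^sup>2 - 2 * \<theta> * n + 1"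
          by (simp add: power2_eq_square algebra_simps)
        moreover have "(1 + 4 * \<theta>) * n \<le> \<theta>\<^sup>2 * n * n" using tn by (intro mult_right_mono) auto
        then have "n / 2 + 2 * \<theta> * n \<le> \<theta>\<^sup>2 * (real n)\<^sup>2 - \<eta> * (real n)\<^sup>2"
          by (simp add: \<eta>_def power2_eq_square algebra_simps)
        ultimately show ?thesis using m by linarith
      qed
      obtain H :: "nat sgraph" where H: "sgraph H" "card (verts H) = n" "card (edges H) = card (edges G)"
        "exp (n * turan_value s q - (real s + 2 * real t) * ln q) \<le> card (proper_colorings q H)"
        by (rule comparison_graph[OF s sq(2) t_div m_le])
      have "card (proper_colorings q H) \<le> card (proper_colorings q G)"
        using G H(1-3) unfolding extremal_def by blast
      moreover have "(real s + 2 * real t) * ln q \<le> n * (\<tau> / 2)"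
      proof -
        have "s * ln q \<le> \<tau> / 4 * n" using n \<tau> by (simp add: divide_le_eq field_simps)
        moreover have "2 * t * ln q \<le> \<tau> / 4 * n"
        proof -
          have "2 * t * ln q \<le> 2 * (\<theta> * n) * ln q" using t(1) lq by (intro mult_right_mono) auto
          also have "\<dots> = 2 * n * (\<theta> * ln q)" by simp
          also have "\<dots> \<le> 2 * n * (\<tau> / 8)"
          proof (rule mult_left_mono)
            have "\<theta> * ln q \<le> \<tau> / (8 * (ln q + 1)) * (ln q + 1)" using \<theta> lq \<tau> by (intro mult_mono) auto
            also have "\<dots> = \<tau> / 8" using lq by (simp add: field_simps)
            finally show "\<theta> * ln q \<le> \<tau> / 8" .
          qed simp
          finally show ?thesis by (simp add: mult_ac)
        qed
        ultimately show ?thesis by (simp add: algebra_simps)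
      qed
      then have "exp (n * (turan_value s q - \<tau> / 2)) \<le> exp (n * turan_value s q - (real s + 2 * real t) * ln q)"
        by (simp add: algebra_simps)
      ultimately show ?thesis using H(4) by linarith
    qed
    have edges: "((real s - 1) / (2 * real s) - \<eta>) * (real n)\<^sup>2 \<le> card (edges G)"
      using m by (simp add: left_diff_distrib)
    obtain L where L: "L ` verts G \<subseteq> color_sets q"
      "clash q (label_distr (verts G) L) \<le> 1 / s + (2 * \<eta> + q * \<delta>)"
      "turan_value s q - \<tau> / 2 - real (k * q) * ln (real n + 1) / n \<le> log_size q (label_distr (verts G) L)"
      "card (bad_arcs G L) \<le> q * \<delta> * (real n)\<^sup>2"
    proof -
      have "0 < n" using n by blast
      from many_colorings_lists[OF sG G(2) this \<delta>(1) s edges colorings, folded k_def] that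
      show thesis .
    qed
    have fV: "finite (verts G)" "verts G \<noteq> {}" using sG G(2) n by (auto simp: sgraph_def)
    obtain P where P: "P \<subseteq> color_sets q" "card P = s"
      "(\<Sum>A\<in>color_sets q. \<bar>label_distr (verts G) L A - (if A \<in> P then 1 / s else 0)\<bar>) < \<epsilon> / 8"
    proof -
      have "clash q (label_distr (verts G) L) \<le> 1 / s + \<tau>" using L(2) \<eta>(1) \<delta>(2) \<tau> by linarith
      moreover have "turan_value s q - \<tau> \<le> log_size q (label_distr (verts G) L)" using L(3) n by linarith
      ultimately show thesis using stab[OF distr_label_distr[OF fV L(1)]] that by blast
    qed
    have "edit_distance G (turan_graph s n)
        \<le> \<eta> * (real n)\<^sup>2 + (2 * (\<epsilon> / 8 * n + s) * n + q * \<delta> * (real n)\<^sup>2)"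
      using n by (intro near_partition_edit_distance[OF sG G(2) _ s L(1) P edges L(4)]) auto
    also have "\<dots> \<le> \<epsilon> / 8 * (real n)\<^sup>2 + ((\<epsilon> / 4 * (real n)\<^sup>2 + \<epsilon> / 2 * (real n)\<^sup>2) + \<epsilon> / 8 * (real n)\<^sup>2)"
    proof (intro add_mono mult_right_mono \<eta> \<delta>)
      have "4 * s \<le> \<epsilon> * n" using n \<open>0 < \<epsilon>\<close> by (simp add: divide_le_eq mult.commute)
      then have "(2 * real s) * n \<le> (\<epsilon> / 2 * n) * n" by (intro mult_right_mono) auto
      then show "2 * (\<epsilon> / 8 * n + s) * n \<le> \<epsilon> / 4 * (real n)\<^sup>2 + \<epsilon> / 2 * (real n)\<^sup>2"
        by (simp add: power2_eq_square algebra_simps)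
    qed auto
    also have "\<dots> = \<epsilon> * (real n)\<^sup>2" by (simp add: field_simps)
    finally show ?thesis using G(2) by (simp add: close_to_def turan_graph_def)
  qed
  then show ?thesis using \<eta>_pos by blast
qed

theorem theorem1p4:
  shows "\<exists>s0 q0 :: nat. \<forall>s q :: nat.
    s \<ge> s0 \<and> q \<ge> q0 \<and> real q \<ge> 100 * (real s)\<^sup>2 / ln (real s) \<longrightarrow>
    (\<forall>\<epsilon> > 0. \<exists>\<eta> > 0. \<exists>n0 :: nat. \<forall>n \<ge> n0. \<forall>G :: nat sgraph.
       extremal q G \<and> card (verts G) = n \<and>
       \<bar>real (card (edges G)) - (real s - 1) / (2 * real s) * (real n)\<^sup>2\<bar> \<le> \<eta> * (real n)\<^sup>2 \<longrightarrow>
       close_to (\<epsilon> * (real n)\<^sup>2) G (turan_graph s n))"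
proof -
  obtain s0 :: nat where
    s0: "\<forall>s q :: nat. s0 \<le> s \<longrightarrow> 100 * (real s)\<^sup>2 / ln s \<le> q \<longrightarrow> large_quotient s q \<and> 2 * s \<le> q"
    using large_quotient_if_large by blast
  show ?thesis
  proof (rule exI[of _ s0], rule exI[of _ 0], intro allI impI)
    fix s q :: nat and \<epsilon> :: real
    assume "s0 \<le> s \<and> 0 \<le> q \<and> real q \<ge> 100 * (real s)\<^sup>2 / ln (real s)" "0 < \<epsilon>"
    then show "\<exists>\<eta> > 0. \<exists>n0 :: nat. \<forall>n \<ge> n0. \<forall>G :: nat sgraph.
       extremal q G \<and> card (verts G) = n \<and>
       \<bar>real (card (edges G)) - (real s - 1) / (2 * real s) * (real n)\<^sup>2\<bar> \<le> \<eta> * (real n)\<^sup>2 \<longrightarrow>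
       close_to (\<epsilon> * (real n)\<^sup>2) G (turan_graph s n)"
      using s0 extremal_close_to_turan by blast
  qed
qed

end
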